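(* For each integer $n\geq 3$, there exist integers $n_i$ ($i\in\mathbb{Z}$) and a family $\{Y_i\}_{i\in\mathbb{Z}}$ of $n$-dimensional complex algebraic varieties $Y_i\subset\mathbb{C}^{n_i+1}$, each containing the origin, such that: (a) for each pair $i\neq j$, the germs at the origin of $Y_i\subset\mathbb{C}^{n_i+1}$ and $Y_j\subset\mathbb{C}^{n_j+1}$ are bi-Lipschitz equivalent, but $(Y_i,0)$ and $(Y_j,0)$ have different multiplicity, i.e. $\mathrm{mult}(Y_i,0)\neq \mathrm{mult}(Y_j,0)$; (b) for each pair $i\neq j$, there are $n$-dimensional complex algebraic varieties $Z_{ij},\widetilde{Z}_{ij}\subset\mathbb{C}^{n_i+n_j+2}$, each containing the origin, such that $(Z_{ij},0)$ and $(\widetilde{Z}_{ij},0)$ are ambient bi-Lipschitz equivalent, but $\mathrm{mult}(Z_{ij},0)=\mathrm{mult}(Y_i,0)$ and $\mathrm{mult}(\widetilde{Z}_{ij},0)=\mathrm{mult}(Y_j,0)$; in particular, $(Z_{ij},0)$ and $(\widetilde{Z}_{ij},0)$ have different multiplicity.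
   Context: Multiplicity: for a complex algebraic set $A\subset\mathbb{C}^{N}$ and a point $x\in A$, the multiplicity $\mathrm{mult}(A,x)$ is the (Hilbert–Samuel) multiplicity of the maximal ideal of the local ring $\mathcal{O}_{A,x}$. Outer metric: the outer metric on a complex variety $X\subset\mathbb{C}^N$ is the restriction to $X$ of the Euclidean distance on $\mathbb{C}^N$. Bi-Lipschitz equivalence: let $X\subset\mathbb{C}^{N}$ and $X'\subset\mathbb{C}^{N'}$ be complex varieties equipped with the outer metrics, and let $x\in X$, $x'\in X'$. Then $(X,x)$ is bi-Lipschitz equivalent to $(X',x')$ if there exist a neighborhood $U$ of $x$ in $\mathbb{C}^{N}$, a neighborhood $U'$ of $x'$ in $\mathbb{C}^{N'}$, and a bi-Lipschitz homeomorphism from $X\cap U$ to $X'\cap U'$ mapping $x$ to $x'$. Ambient bi-Lipschitz equivalence: let $X,X'\subset\mathbb{C}^{N}$ be complex varieties and $x\in X$, $x'\in X'$. Then $(X,x)$ is ambient bi-Lipschitz equivalent to $(X',x')$ if there exist a neighborhood $U$ of $x$ in $\mathbb{C}^N$, a neighborhood $U'$ of $x'$ in $\mathbb{C}^N$, and a bi-Lipschitz homeomorphism from $U$ to $U'$ (for the Euclidean distance) mapping $X\cap U$ to $X'\cap U'$ and $x$ to $x'$. *)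

theory Defs
  imports
    "HOL-Analysis.Analysis"
    "HOL-Algebra.Ideal_Product"
    "HOL-Algebra.QuotRing"
    "HOL-Library.Poly_Mapping"
    "HOL-Library.Extended_Nat"
    "HOL-Computational_Algebra.Polynomial"
begin

section \<open>Complex affine space with the Euclidean distance\<close>

text \<open>As in \<open>Euclidean_space\<close>, a point of complex \<open>N\<close>-space is a sequence whose entries
  of index at least \<open>N\<close> vanish, so that \<open>N\<close> can be quantified over.\<close>

definition complex_space :: "nat \<Rightarrow> (nat \<Rightarrow> complex) set" where
  "complex_space N = {x. \<forall>i\<ge>N. x i = 0}"

definition origin :: "nat \<Rightarrow> complex" where
  "origin = (\<lambda>_. 0)"

definition complex_dist :: "nat \<Rightarrow> (nat \<Rightarrow> complex) \<Rightarrow> (nat \<Rightarrow> complex) \<Rightarrow> real" where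
  "complex_dist N x y = L2_set (\<lambda>i. dist (x i) (y i)) {..<N}"

definition complex_metric :: "nat \<Rightarrow> (nat \<Rightarrow> complex) metric" where
  "complex_metric N = metric (complex_space N, complex_dist N)"

lemma Metric_space_complex: "Metric_space (complex_space N) (complex_dist N)"
proof
  fix x y z
  show "0 \<le> complex_dist N x y" by (simp add: complex_dist_def)
  show "complex_dist N x y = complex_dist N y x" by (simp add: complex_dist_def dist_commute)
  show "complex_dist N x y = 0 \<longleftrightarrow> x = y" if "x \<in> complex_space N" "y \<in> complex_space N"
  proof -
    have "complex_dist N x y = 0 \<longleftrightarrow> (\<forall>i<N. x i = y i)"
      by (simp add: complex_dist_def L2_set_eq_0_iff Ball_def)
    also have "\<dots> \<longleftrightarrow> (\<forall>i. x i = y i)"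
    proof (intro iffI allI)
      fix i assume "\<forall>i<N. x i = y i"
      with that show "x i = y i"
        by (cases "i < N") (simp_all add: complex_space_def)
    qed simp
    finally show ?thesis by (simp add: fun_eq_iff)
  qed
  have "L2_set (\<lambda>i. dist (x i) (z i)) {..<N}
      \<le> L2_set (\<lambda>i. dist (x i) (y i) + dist (y i) (z i)) {..<N}"
    by (intro L2_set_mono dist_triangle zero_le_dist)
  then show "complex_dist N x z \<le> complex_dist N x y + complex_dist N y z"
    unfolding complex_dist_def by (rule order_trans[OF _ L2_set_triangle_ineq])
qed

lemma mspace_complex_metric [simp]: "mspace (complex_metric N) = complex_space N"
  unfolding complex_metric_def by (rule Metric_space.mspace_metric[OF Metric_space_complex])

lemma mdist_complex_metric [simp]: "mdist (complex_metric N) = complex_dist N"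
  unfolding complex_metric_def by (rule Metric_space.mdist_metric[OF Metric_space_complex])


section \<open>Bi-Lipschitz equivalence of germs\<close>

definition bi_lipschitz_homeomorphism :: "'a metric \<Rightarrow> 'b metric \<Rightarrow> ('a \<Rightarrow> 'b) \<Rightarrow> bool" where
  "bi_lipschitz_homeomorphism m m' h \<longleftrightarrow>
     (\<exists>g. Lipschitz_continuous_map m m' h \<and> Lipschitz_continuous_map m' m g \<and>
          (\<forall>x\<in>mspace m. g (h x) = x) \<and> (\<forall>y\<in>mspace m'. h (g y) = y))"

definition bi_lipschitz_equivalent ::
    "nat \<Rightarrow> (nat \<Rightarrow> complex) set \<Rightarrow> (nat \<Rightarrow> complex) \<Rightarrow>
     nat \<Rightarrow> (nat \<Rightarrow> complex) set \<Rightarrow> (nat \<Rightarrow> complex) \<Rightarrow> bool" where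
  "bi_lipschitz_equivalent N X x N' X' x' \<longleftrightarrow>
     (\<exists>U U' h. openin (mtopology_of (complex_metric N)) U \<and> x \<in> U \<and>
        openin (mtopology_of (complex_metric N')) U' \<and> x' \<in> U' \<and>
        bi_lipschitz_homeomorphism
          (submetric (complex_metric N) (X \<inter> U)) (submetric (complex_metric N') (X' \<inter> U')) h \<and>
        h x = x')"

definition ambient_bi_lipschitz_equivalent ::
    "nat \<Rightarrow> (nat \<Rightarrow> complex) set \<Rightarrow> (nat \<Rightarrow> complex) \<Rightarrow>
     (nat \<Rightarrow> complex) set \<Rightarrow> (nat \<Rightarrow> complex) \<Rightarrow> bool" where
  "ambient_bi_lipschitz_equivalent N X x X' x' \<longleftrightarrow>
     (\<exists>U U' h. openin (mtopology_of (complex_metric N)) U \<and> x \<in> U \<and>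
        openin (mtopology_of (complex_metric N)) U' \<and> x' \<in> U' \<and>
        bi_lipschitz_homeomorphism
          (submetric (complex_metric N) U) (submetric (complex_metric N) U') h \<and>
        h ` (X \<inter> U) = X' \<inter> U' \<and> h x = x')"


section \<open>Algebraic varieties\<close>

text \<open>The outer exponents of a polynomial are its monomials, encoded as finitely supported
  exponent vectors indexed by the variables.\<close>

type_synonym cpoly = "(nat \<Rightarrow>\<^sub>0 nat) \<Rightarrow>\<^sub>0 complex"

definition polys :: "nat \<Rightarrow> cpoly set" where
  "polys N = {p. \<forall>m\<in>Poly_Mapping.keys p. Poly_Mapping.keys m \<subseteq> {..<N}}"

definition cpoly_eval :: "cpoly \<Rightarrow> (nat \<Rightarrow> complex) \<Rightarrow> complex" where
  "cpoly_eval p x = (\<Sum>m\<in>Poly_Mapping.keys p. Poly_Mapping.lookup p m * (\<Prod>i\<in>Poly_Mapping.keys m. x i ^ Poly_Mapping.lookup m i))"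

definition algebraic_set :: "nat \<Rightarrow> (nat \<Rightarrow> complex) set \<Rightarrow> bool" where
  "algebraic_set N A \<longleftrightarrow>
     (\<exists>F\<subseteq>polys N. A = {x \<in> complex_space N. \<forall>p\<in>F. cpoly_eval p x = 0})"

text \<open>A variety is an irreducible algebraic set.\<close>

definition algebraic_variety :: "nat \<Rightarrow> (nat \<Rightarrow> complex) set \<Rightarrow> bool" where
  "algebraic_variety N A \<longleftrightarrow> algebraic_set N A \<and> A \<noteq> {} \<and>
     (\<forall>B C. algebraic_set N B \<and> algebraic_set N C \<and> A = B \<union> C \<longrightarrow> A = B \<or> A = C)"

text \<open>The supremum of the numbers \<open>k\<close> of steps in strict chains \<open>c 0 \<subset> \<dots> \<subset> c k\<close> of members
  of a family of sets.\<close>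

definition chain_length :: "'a set set \<Rightarrow> enat" where
  "chain_length \<F> = (SUP k \<in> {k. \<exists>c. (\<forall>i\<le>k. c i \<in> \<F>) \<and> (\<forall>i<k. c i \<subset> c (Suc i))}. enat k)"

definition variety_dim :: "nat \<Rightarrow> (nat \<Rightarrow> complex) set \<Rightarrow> enat" where
  "variety_dim N A = chain_length {B. B \<subseteq> A \<and> algebraic_variety N B}"


section \<open>Localizations and the local ring of an algebraic set at a point\<close>

definition fraction_rel :: "('a, 'b) ring_scheme \<Rightarrow> 'a set \<Rightarrow> (('a \<times> 'a) \<times> ('a \<times> 'a)) set" where
  "fraction_rel R S = {((a, s), (b, t)). a \<in> carrier R \<and> b \<in> carrier R \<and> s \<in> S \<and> t \<in> S \<and>
     (\<exists>u\<in>S. u \<otimes>\<^bsub>R\<^esub> (t \<otimes>\<^bsub>R\<^esub> a) = u \<otimes>\<^bsub>R\<^esub> (s \<otimes>\<^bsub>R\<^esub> b))}"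

definition localization :: "('a, 'b) ring_scheme \<Rightarrow> 'a set \<Rightarrow> (('a \<times> 'a) set) ring" where
  "localization R S =
     \<lparr>carrier = (carrier R \<times> S) // fraction_rel R S,
      mult = (\<lambda>X Y. \<Union>(a, s)\<in>X. \<Union>(b, t)\<in>Y. fraction_rel R S `` {(a \<otimes>\<^bsub>R\<^esub> b, s \<otimes>\<^bsub>R\<^esub> t)}),
      one = fraction_rel R S `` {(\<one>\<^bsub>R\<^esub>, \<one>\<^bsub>R\<^esub>)},
      zero = fraction_rel R S `` {(\<zero>\<^bsub>R\<^esub>, \<one>\<^bsub>R\<^esub>)},
      add = (\<lambda>X Y. \<Union>(a, s)\<in>X. \<Union>(b, t)\<in>Y.
               fraction_rel R S `` {(t \<otimes>\<^bsub>R\<^esub> a \<oplus>\<^bsub>R\<^esub> s \<otimes>\<^bsub>R\<^esub> b, s \<otimes>\<^bsub>R\<^esub> t)})\<rparr>"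

definition poly_ring :: "nat \<Rightarrow> cpoly ring" where
  "poly_ring N = \<lparr>carrier = polys N, mult = (*), one = 1, zero = 0, add = (+)\<rparr>"

definition vanishing_ideal :: "nat \<Rightarrow> (nat \<Rightarrow> complex) set \<Rightarrow> cpoly set" where
  "vanishing_ideal N A = {p \<in> polys N. \<forall>x\<in>A. cpoly_eval p x = 0}"

definition coordinate_ring :: "nat \<Rightarrow> (nat \<Rightarrow> complex) set \<Rightarrow> cpoly set ring" where
  "coordinate_ring N A = poly_ring N Quot vanishing_ideal N A"

text \<open>The denominators are the classes of the polynomials that do not vanish at \<open>x\<close>, i.e. the
  complement of the maximal ideal of the point \<open>x \<in> A\<close> in the coordinate ring.\<close>

definition local_ring ::
    "nat \<Rightarrow> (nat \<Rightarrow> complex) set \<Rightarrow> (nat \<Rightarrow> complex) \<Rightarrow> ((cpoly set \<times> cpoly set) set) ring" where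
  "local_ring N A x = localization (coordinate_ring N A)
     {vanishing_ideal N A +>\<^bsub>poly_ring N\<^esub> q | q. q \<in> polys N \<and> cpoly_eval q x \<noteq> 0}"


section \<open>Hilbert--Samuel multiplicity\<close>

text \<open>The length of a commutative ring as a module over itself. For an ideal \<open>I\<close> of \<open>R\<close>, the
  \<open>R\<close>-submodules of \<open>R Quot I\<close> are its ideals, so this is also the length of the
  \<open>R\<close>-module \<open>R Quot I\<close>.\<close>

definition ring_length :: "('a, 'b) ring_scheme \<Rightarrow> enat" where
  "ring_length R = chain_length {J. ideal J R}"

text \<open>The Hilbert--Samuel polynomial \<open>P\<close> of \<open>I\<close> gives the length of \<open>R Quot I\<^sup>k\<close> for all
  large \<open>k\<close>. If \<open>d\<close> is its degree (for an ideal primary to the maximal ideal of a Noetherian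
  local ring this is the Krull dimension), its leading coefficient is \<open>e / d!\<close>, where \<open>e\<close> is
  the multiplicity. Ideal powers are taken in the monoid of ideals under the ideal product.\<close>

definition hilbert_samuel_multiplicity :: "('a, 'b) ring_scheme \<Rightarrow> 'a set \<Rightarrow> nat" where
  "hilbert_samuel_multiplicity R I = (THE e. \<exists>P :: rat poly.
     (\<forall>\<^sub>F k in sequentially. \<exists>l. ring_length (R Quot (I [^]\<^bsub>ideals_set R\<^esub> k)) = enat l \<and>
        poly P (of_nat k) = of_nat l) \<and>
     lead_coeff P = of_nat e / fact (Polynomial.degree P))"

definition point_multiplicity :: "nat \<Rightarrow> (nat \<Rightarrow> complex) set \<Rightarrow> (nat \<Rightarrow> complex) \<Rightarrow> nat" where
  "point_multiplicity N A x =
     hilbert_samuel_multiplicity (local_ring N A x) (THE M. maximalideal M (local_ring N A x))"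

end

theory Submission
  imports
    Defs
    "HOL-Library.Function_Algebras"
    "HOL-Library.Nat_Bijection"
begin

text \<open>
  For \<open>a \<ge> 1\<close> let \<open>Y\<close> be the affine cone over the rational normal scroll \<open>S(a, a)\<close>, that is, over
  the image of \<open>\<complex>P\<^sup>1 \<times> \<complex>P\<^sup>1\<close> under the embedding of bidegree \<open>(a, 1)\<close>, times an affine space of
  dimension \<open>r = n - 3\<close>. Its points are \<open>(u\<^sup>a \<otimes> v, w)\<close> with \<open>u, v\<close> in \<open>\<complex>\<^sup>2\<close>. All these varieties are
  bi-Lipschitz equivalent at the origin, while the multiplicity is the degree \<open>2 a\<close> of the scroll.

  \<^emph>\<open>Bi-Lipschitz equivalence.\<close> The pairs \<open>(u, v)\<close> and \<open>(\<tau> u, \<tau>\<^bsup>-a\<^esup> v)\<close> with \<open>\<bar>\<tau>\<bar> = 1\<close> define the same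
  point, so for \<open>\<bar>u\<bar> = 1\<close> the cone is a bundle over \<open>\<complex>P\<^sup>1\<close> with fibre \<open>\<complex>\<^sup>2\<close> and collapsed zero section. As a
  real bundle it is trivial: regard \<open>v\<close> as a quaternion; the unit quaternion along
  \<open>cnj (u\<^sub>0)\<^sup>a + cnj (u\<^sub>1)\<^sup>a j\<close> transforms like \<open>v\<close>, so division by it turns \<open>v\<close> into a quaternion \<open>q\<close>
  that depends on the point only. In the coordinates \<open>([u], q)\<close> the distance of the cone is comparable
  with an expression that does not involve \<open>a\<close> (\<open>cone_dist2_model\<close>). This rests on
  an exact formula for the distance, with binomial weights, in terms of the Hermitian products
  (\<open>weighted_distance\<close>). Two cones that lie in complementary coordinate subspaces
  are even ambient equivalent: the homeomorphism and its inverse are extended by McShane's formula,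
  and two shears built from the extensions move one cone to the other
  (\<open>ambient_bi_lipschitz_equivalent_complementary\<close>).

  \<^emph>\<open>Multiplicity.\<close> For a cone, the quotient of the local ring at the vertex by the \<open>k\<close>-th power of the
  maximal ideal is the quotient of the polynomial ring by the ideal of the polynomials that vanish to
  order \<open>k\<close> along the rays (\<open>ring_length_local_ring_quotient\<close>). As the cone is also
  closed under coordinatewise multiplication, distinct nonzero monomial functions on it are linearly
  independent by Dedekind's argument, and the length is the number of monomial functions of
  degree less than \<open>k\<close> (\<open>ring_length_toric\<close>). Counting the monomials gives
  \<open>(k + n - 1 choose n) + (2 a - 1) (k + n - 2 choose n)\<close>, with leading coefficient \<open>2 a / n!\<close>.

  \<^emph>\<open>Dimension.\<close> A strict chain of irreducible algebraic sets yields algebraically independent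
  polynomials, whose products contradict the growth of the same counting function if the chain is too
  long (\<open>variety_chain_bound\<close>). Coordinate subspaces, followed by \<open>Y\<close>, form a chain of the right length.
\<close>

section \<open>Evaluation of polynomials\<close>

text \<open>The value of the monomial with exponent vector \<open>m\<close>.\<close>

definition monom_eval :: "(nat \<Rightarrow>\<^sub>0 nat) \<Rightarrow> (nat \<Rightarrow> complex) \<Rightarrow> complex" where
  "monom_eval m x = (\<Prod>i\<in>Poly_Mapping.keys m. x i ^ Poly_Mapping.lookup m i)"

text \<open>The total degree of the monomial with exponent vector \<open>m\<close>.\<close>

definition monom_deg :: "(nat \<Rightarrow>\<^sub>0 nat) \<Rightarrow> nat" where
  "monom_deg m = (\<Sum>i\<in>Poly_Mapping.keys m. Poly_Mapping.lookup m i)"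

lemma cpoly_eval_monom_eval:
  "cpoly_eval p x = (\<Sum>m\<in>Poly_Mapping.keys p. Poly_Mapping.lookup p m * monom_eval m x)"
  by (simp add: cpoly_eval_def monom_eval_def)

lemma monom_eval_superset:
  assumes "finite S" "Poly_Mapping.keys m \<subseteq> S"
  shows "monom_eval m x = (\<Prod>i\<in>S. x i ^ Poly_Mapping.lookup m i)"
  unfolding monom_eval_def using assms
  by (intro prod.mono_neutral_left) (auto simp: in_keys_iff)

lemma monom_deg_superset:
  assumes "finite S" "Poly_Mapping.keys m \<subseteq> S"
  shows "monom_deg m = (\<Sum>i\<in>S. Poly_Mapping.lookup m i)"
  unfolding monom_deg_def using assms
  by (intro sum.mono_neutral_left) (auto simp: in_keys_iff)

lemma monom_eval_add: "monom_eval (m + m') x = monom_eval m x * monom_eval m' x"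
proof -
  define S where "S = Poly_Mapping.keys m \<union> Poly_Mapping.keys m'"
  have S: "finite S" "Poly_Mapping.keys m \<subseteq> S" "Poly_Mapping.keys m' \<subseteq> S"
    "Poly_Mapping.keys (m + m') \<subseteq> S"
    using keys_add[of m m'] by (auto simp: S_def)
  show ?thesis
    by (simp add: monom_eval_superset[OF S(1,2)] monom_eval_superset[OF S(1,3)]
        monom_eval_superset[OF S(1,4)] lookup_add power_add prod.distrib)
qed

lemma monom_deg_add: "monom_deg (m + m') = monom_deg m + monom_deg m'"
proof -
  define S where "S = Poly_Mapping.keys m \<union> Poly_Mapping.keys m'"
  have S: "finite S" "Poly_Mapping.keys m \<subseteq> S" "Poly_Mapping.keys m' \<subseteq> S"
    "Poly_Mapping.keys (m + m') \<subseteq> S"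
    using keys_add[of m m'] by (auto simp: S_def)
  show ?thesis
    by (simp add: monom_deg_superset[OF S(1,2)] monom_deg_superset[OF S(1,3)]
        monom_deg_superset[OF S(1,4)] lookup_add sum.distrib)
qed

lemma monom_eval_0 [simp]: "monom_eval 0 x = 1"
  by (simp add: monom_eval_def)

lemma monom_deg_0 [simp]: "monom_deg 0 = 0"
  by (simp add: monom_deg_def)

lemma monom_eval_single [simp]: "monom_eval (Poly_Mapping.single i e) x = x i ^ e"
  by (cases "e = 0") (simp_all add: monom_eval_def)

lemma monom_deg_single [simp]: "monom_deg (Poly_Mapping.single i e) = e"
  by (cases "e = 0") (simp_all add: monom_deg_def)

lemma monom_eval_mult: "monom_eval m (\<lambda>i. x i * y i) = monom_eval m x * monom_eval m y"
  by (simp add: monom_eval_def power_mult_distrib prod.distrib)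

lemma monom_eval_scale: "monom_eval m (\<lambda>i. t * x i) = t ^ monom_deg m * monom_eval m x"
  by (simp add: monom_eval_def monom_deg_def power_mult_distrib prod.distrib power_sum)

lemma cpoly_eval_superset:
  assumes "finite S" "Poly_Mapping.keys p \<subseteq> S"
  shows "cpoly_eval p x = (\<Sum>m\<in>S. Poly_Mapping.lookup p m * monom_eval m x)"
  unfolding cpoly_eval_monom_eval using assms
  by (intro sum.mono_neutral_left) (auto simp: in_keys_iff)

lemma cpoly_eval_0 [simp]: "cpoly_eval 0 x = 0"
  by (simp add: cpoly_eval_def)

lemma cpoly_eval_single [simp]: "cpoly_eval (Poly_Mapping.single m c) x = c * monom_eval m x"
  by (cases "c = 0") (simp_all add: cpoly_eval_monom_eval)

lemma cpoly_eval_1 [simp]: "cpoly_eval 1 x = 1"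
  using cpoly_eval_single[of 0 1 x] by simp

lemma cpoly_eval_add [simp]: "cpoly_eval (p + q) x = cpoly_eval p x + cpoly_eval q x"
proof -
  define S where "S = Poly_Mapping.keys p \<union> Poly_Mapping.keys q"
  have S: "finite S" "Poly_Mapping.keys p \<subseteq> S" "Poly_Mapping.keys q \<subseteq> S"
    "Poly_Mapping.keys (p + q) \<subseteq> S"
    using keys_add[of p q] by (auto simp: S_def)
  show ?thesis
    by (simp add: cpoly_eval_superset[OF S(1,2)] cpoly_eval_superset[OF S(1,3)]
        cpoly_eval_superset[OF S(1,4)] lookup_add sum.distrib distrib_right)
qed

lemma cpoly_eval_uminus [simp]: "cpoly_eval (- p) x = - cpoly_eval p x"
  using cpoly_eval_add[of p "- p" x] by (simp add: add_eq_0_iff)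

lemma cpoly_eval_diff [simp]: "cpoly_eval (p - q) x = cpoly_eval p x - cpoly_eval q x"
  using cpoly_eval_add[of p "- q" x] by simp

lemma cpoly_eval_sum: "cpoly_eval (sum f A) x = (\<Sum>a\<in>A. cpoly_eval (f a) x)"
  by (induction A rule: infinite_finite_induct) simp_all

lemma cpoly_sum_singles:
  fixes p :: cpoly
  shows "p = (\<Sum>m\<in>Poly_Mapping.keys p. Poly_Mapping.single m (Poly_Mapping.lookup p m))"
proof (rule poly_mapping_eqI)
  fix k
  have "Poly_Mapping.lookup (\<Sum>m\<in>Poly_Mapping.keys p.
          Poly_Mapping.single m (Poly_Mapping.lookup p m)) k
      = (\<Sum>m\<in>Poly_Mapping.keys p. if m = k then Poly_Mapping.lookup p m else 0)"
    by (simp add: lookup_sum lookup_single when_def)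
  also have "\<dots> = Poly_Mapping.lookup p k"
    by (simp add: sum.delta in_keys_iff)
  finally show "Poly_Mapping.lookup p k = Poly_Mapping.lookup (\<Sum>m\<in>Poly_Mapping.keys p.
          Poly_Mapping.single m (Poly_Mapping.lookup p m)) k" ..
qed

lemma cpoly_eval_mult [simp]: "cpoly_eval (p * q) x = cpoly_eval p x * cpoly_eval q x"
proof -
  have "p * q = (\<Sum>m\<in>Poly_Mapping.keys p. \<Sum>m'\<in>Poly_Mapping.keys q.
      Poly_Mapping.single (m + m') (Poly_Mapping.lookup p m * Poly_Mapping.lookup q m'))"
    by (subst (1) cpoly_sum_singles[of p], subst (1) cpoly_sum_singles[of q])
      (simp add: sum_product mult_single)
  then show ?thesis
    by (simp add: cpoly_eval_sum cpoly_eval_monom_eval[of p] cpoly_eval_monom_eval[of q]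
        sum_product monom_eval_add mult_ac)
qed

subsection \<open>Restriction to polynomial curves\<close>

text \<open>The composition of \<open>p\<close> with the polynomial curve whose coordinates are the \<open>h i\<close>.\<close>

definition curve_poly :: "(nat \<Rightarrow> complex poly) \<Rightarrow> cpoly \<Rightarrow> complex poly" where
  "curve_poly h p = (\<Sum>m\<in>Poly_Mapping.keys p.
     smult (Poly_Mapping.lookup p m) (\<Prod>i\<in>Poly_Mapping.keys m. h i ^ Poly_Mapping.lookup m i))"

lemma poly_curve_poly [simp]: "poly (curve_poly h p) t = cpoly_eval p (\<lambda>i. poly (h i) t)"
  by (simp add: curve_poly_def cpoly_eval_def poly_sum poly_prod)

lemma poly_eq_if_same_values:
  fixes p q :: "complex poly"
  shows "(\<And>t. poly p t = poly q t) \<Longrightarrow> p = q"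
  using poly_eq_poly_eq_iff[of p q] by blast

text \<open>The restriction \<open>p (t y)\<close> of \<open>p\<close> to the ray through \<open>y\<close>, as a polynomial in \<open>t\<close>. Its coefficient of
  \<open>t\<^sup>d\<close> is the value at \<open>y\<close> of the homogeneous component of degree \<open>d\<close> of \<open>p\<close>.\<close>

definition ray_poly :: "(nat \<Rightarrow> complex) \<Rightarrow> cpoly \<Rightarrow> complex poly" where
  "ray_poly y p = curve_poly (\<lambda>i. [:0, y i:]) p"

definition hom_part :: "nat \<Rightarrow> cpoly \<Rightarrow> (nat \<Rightarrow> complex) \<Rightarrow> complex" where
  "hom_part d p y = coeff (ray_poly y p) d"

lemma poly_ray_poly: "poly (ray_poly y p) t = cpoly_eval p (\<lambda>i. t * y i)"
  by (simp add: ray_poly_def)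

lemma ray_poly_add: "ray_poly y (p + q) = ray_poly y p + ray_poly y q"
  by (rule poly_eq_if_same_values) (simp add: poly_ray_poly)

lemma ray_poly_mult: "ray_poly y (p * q) = ray_poly y p * ray_poly y q"
  by (rule poly_eq_if_same_values) (simp add: poly_ray_poly)

lemma ray_poly_single: "ray_poly y (Poly_Mapping.single m c) = monom (c * monom_eval m y) (monom_deg m)"
  by (rule poly_eq_if_same_values) (simp add: poly_ray_poly poly_monom monom_eval_scale)

lemma hom_part_0 [simp]: "hom_part d 0 y = 0"
  by (simp add: hom_part_def ray_poly_def curve_poly_def)

lemma hom_part_add [simp]: "hom_part d (p + q) y = hom_part d p y + hom_part d q y"
  by (simp add: hom_part_def ray_poly_add)

lemma hom_part_uminus [simp]: "hom_part d (- p) y = - hom_part d p y"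
  using hom_part_add[of d p "- p" y] by (simp add: add_eq_0_iff)

lemma hom_part_diff [simp]: "hom_part d (p - q) y = hom_part d p y - hom_part d q y"
  using hom_part_add[of d p "- q" y] by simp

lemma hom_part_sum: "hom_part d (sum f A) y = (\<Sum>a\<in>A. hom_part d (f a) y)"
  by (induction A rule: infinite_finite_induct) simp_all

lemma hom_part_single:
  "hom_part d (Poly_Mapping.single m c) y = (if monom_deg m = d then c * monom_eval m y else 0)"
  by (simp add: hom_part_def ray_poly_single)

lemma hom_part_eq_sum:
  "hom_part d p y = (\<Sum>m\<in>{m\<in>Poly_Mapping.keys p. monom_deg m = d}. Poly_Mapping.lookup p m * monom_eval m y)"
  by (subst cpoly_sum_singles)
     (simp add: hom_part_sum hom_part_single sum.inter_filter)

lemma hom_part_scale: "hom_part d p (\<lambda>i. t * y i) = t ^ d * hom_part d p y"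
  by (simp add: hom_part_eq_sum sum_distrib_left monom_eval_scale mult_ac)

lemma hom_part_mult:
  "hom_part d (p * q) y = (\<Sum>i\<le>d. hom_part i p y * hom_part (d - i) q y)"
  by (simp add: hom_part_def ray_poly_mult coeff_mult)

lemma hom_part_constant: "hom_part 0 p y = cpoly_eval p origin"
proof -
  have "hom_part 0 p y = poly (ray_poly y p) 0"
    by (simp add: hom_part_def poly_0_coeff_0)
  then show ?thesis by (simp add: poly_ray_poly origin_def)
qed

subsection \<open>Polynomials in finitely many variables\<close>

text \<open>The exponent vectors of the monomials in the first \<open>N\<close> variables.\<close>

definition monoms :: "nat \<Rightarrow> (nat \<Rightarrow>\<^sub>0 nat) set" where
  "monoms N = {m. Poly_Mapping.keys m \<subseteq> {..<N}}"

lemma polys_iff: "p \<in> polys N \<longleftrightarrow> Poly_Mapping.keys p \<subseteq> monoms N"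
  by (auto simp: polys_def monoms_def)

lemma monoms_0 [simp]: "0 \<in> monoms N"
  by (simp add: monoms_def)

lemma monoms_add: "m \<in> monoms N \<Longrightarrow> m' \<in> monoms N \<Longrightarrow> m + m' \<in> monoms N"
  using keys_add[of m m'] by (auto simp: monoms_def)

lemma monoms_single [simp]: "i < N \<Longrightarrow> Poly_Mapping.single i e \<in> monoms N"
  by (auto simp: monoms_def)

lemma monom_split:
  assumes m: "m \<in> monoms N" "m \<noteq> 0"
  obtains m' i where "i < N" "m' \<in> monoms N" "m = m' + Poly_Mapping.single i 1"
proof -
  from m(2) obtain i where i: "i \<in> Poly_Mapping.keys m" by fastforce
  define m' where "m' = m - Poly_Mapping.single i 1"
  have "m = m' + Poly_Mapping.single i 1"
    using i by (intro poly_mapping_eqI)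
      (auto simp: m'_def lookup_add lookup_minus lookup_single when_def in_keys_iff)
  moreover have "Poly_Mapping.keys m' \<subseteq> Poly_Mapping.keys m"
    by (auto simp: m'_def in_keys_iff lookup_minus)
  with m have "m' \<in> monoms N" by (auto simp: monoms_def)
  moreover have "i < N" using i m by (auto simp: monoms_def)
  ultimately show ?thesis using that by blast
qed

lemma polys_0 [simp]: "0 \<in> polys N"
  by (simp add: polys_iff)

lemma polys_single [simp]: "m \<in> monoms N \<Longrightarrow> Poly_Mapping.single m c \<in> polys N"
  by (auto simp: polys_iff)

lemma polys_1 [simp]: "1 \<in> polys N"
  using polys_single[of 0 N 1] by simp

lemma polys_add [simp]: "p \<in> polys N \<Longrightarrow> q \<in> polys N \<Longrightarrow> p + q \<in> polys N"
  using keys_add[of p q] by (auto simp: polys_iff)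

lemma polys_uminus [simp]: "p \<in> polys N \<Longrightarrow> - p \<in> polys N"
  by (simp add: polys_iff keys_def)

lemma polys_diff [simp]: "p \<in> polys N \<Longrightarrow> q \<in> polys N \<Longrightarrow> p - q \<in> polys N"
  using polys_add[of p N "- q"] by simp

lemma polys_mult [simp]: "p \<in> polys N \<Longrightarrow> q \<in> polys N \<Longrightarrow> p * q \<in> polys N"
  using keys_mult[of p q] monoms_add by (fastforce simp: polys_iff)

lemma polys_power [simp]: "p \<in> polys N \<Longrightarrow> p ^ k \<in> polys N"
  by (induction k) simp_all

lemma polys_sum: "(\<And>a. a \<in> A \<Longrightarrow> f a \<in> polys N) \<Longrightarrow> sum f A \<in> polys N"
  by (induction A rule: infinite_finite_induct) auto

section \<open>Localizations of commutative rings\<close>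

text \<open>The class of the fraction \<open>a / s\<close>, with denominators in \<open>S\<close>.\<close>

definition fraction :: "('a, 'b) ring_scheme \<Rightarrow> 'a set \<Rightarrow> 'a \<Rightarrow> 'a \<Rightarrow> ('a \<times> 'a) set" where
  "fraction R S a s = fraction_rel R S `` {(a, s)}"

text \<open>A commutative ring with a multiplicatively closed set \<open>S\<close> of denominators. Zero divisors are allowed in \<open>S\<close>,
  which is why equality of fractions involves a further factor from \<open>S\<close>.\<close>

locale ring_with_denominators = cring R for R (structure) +
  fixes S
  assumes S_carrier: "S \<subseteq> carrier R"
    and S_one [simp, intro]: "\<one> \<in> S"
    and S_mult [simp, intro]: "\<And>s t. s \<in> S \<Longrightarrow> t \<in> S \<Longrightarrow> s \<otimes> t \<in> S"
begin

lemma S_carrierD [simp, intro]: "s \<in> S \<Longrightarrow> s \<in> carrier R"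
  using S_carrier by blast

lemma fraction_rel_iff:
  "((a, s), (b, t)) \<in> fraction_rel R S \<longleftrightarrow> a \<in> carrier R \<and> b \<in> carrier R \<and> s \<in> S \<and> t \<in> S \<and>
     (\<exists>u\<in>S. u \<otimes> (t \<otimes> a) = u \<otimes> (s \<otimes> b))"
  by (simp add: fraction_rel_def)

lemma equiv_fraction_rel: "equiv (carrier R \<times> S) (fraction_rel R S)"
proof (rule equivI)
  show "fraction_rel R S \<subseteq> (carrier R \<times> S) \<times> (carrier R \<times> S)"
    by (auto simp: fraction_rel_def)
  show "refl_on (carrier R \<times> S) (fraction_rel R S)"
    by (rule refl_onI) (auto simp: fraction_rel_def)
  show "sym (fraction_rel R S)"
    proof (rule symI)
    fix x y assume "(x, y) \<in> fraction_rel R S"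
    then show "(y, x) \<in> fraction_rel R S"
      by (cases x; cases y) (simp add: fraction_rel_iff, metis)
  qed
  show "trans (fraction_rel R S)"
  proof (rule transI)
    fix x y z assume xy: "(x, y) \<in> fraction_rel R S" and yz: "(y, z) \<in> fraction_rel R S"
    obtain a s b t c r where [simp]: "x = (a, s)" "y = (b, t)" "z = (c, r)"
      by (metis surj_pair)
    from xy yz have carr [simp]: "a \<in> carrier R" "b \<in> carrier R" "c \<in> carrier R"
      "s \<in> S" "t \<in> S" "r \<in> S"
      by (simp_all add: fraction_rel_iff)
    from xy obtain u where u: "u \<in> S" "u \<otimes> (t \<otimes> a) = u \<otimes> (s \<otimes> b)"
      by (auto simp: fraction_rel_iff)
    from yz obtain v where v: "v \<in> S" "v \<otimes> (r \<otimes> b) = v \<otimes> (t \<otimes> c)"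
      by (auto simp: fraction_rel_iff)
    have "(u \<otimes> v \<otimes> t) \<otimes> (r \<otimes> a) = (v \<otimes> r) \<otimes> (u \<otimes> (t \<otimes> a))"
      using u(1) v(1) by (simp add: m_ac)
    also have "\<dots> = (u \<otimes> s) \<otimes> (v \<otimes> (r \<otimes> b))"
      unfolding u(2) using u(1) v(1) by (simp add: m_ac)
    also have "\<dots> = (u \<otimes> v \<otimes> t) \<otimes> (s \<otimes> c)"
      unfolding v(2) using u(1) v(1) by (simp add: m_ac)
    finally show "(x, z) \<in> fraction_rel R S"
      using u(1) v(1) by (auto simp: fraction_rel_iff intro!: bexI[of _ "u \<otimes> v \<otimes> t"])
  qed
qed

lemma frac_eq_iff:
  assumes "a \<in> carrier R" "s \<in> S" "b \<in> carrier R" "t \<in> S"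
  shows "fraction R S a s = fraction R S b t \<longleftrightarrow> (\<exists>u\<in>S. u \<otimes> (t \<otimes> a) = u \<otimes> (s \<otimes> b))"
  using eq_equiv_class_iff[OF equiv_fraction_rel, of "(a, s)" "(b, t)"] assms
  by (simp add: fraction_def fraction_rel_iff)

lemma frac_eqI:
  assumes "a \<in> carrier R" "s \<in> S" "b \<in> carrier R" "t \<in> S" "t \<otimes> a = s \<otimes> b"
  shows "fraction R S a s = fraction R S b t"
  using assms by (auto simp: frac_eq_iff)

lemma mem_frac_iff:
  assumes "a \<in> carrier R" "s \<in> S"
  shows "(b, t) \<in> fraction R S a s \<longleftrightarrow> b \<in> carrier R \<and> t \<in> S \<and> fraction R S b t = fraction R S a s"
  using assms frac_eq_iff[of a s b t] by (fastforce simp: fraction_def fraction_rel_iff)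

lemma frac_self: "a \<in> carrier R \<Longrightarrow> s \<in> S \<Longrightarrow> (a, s) \<in> fraction R S a s"
  by (simp add: mem_frac_iff)

abbreviation "L \<equiv> localization R S"

lemma carrier_localization: "carrier L = {fraction R S a s | a s. a \<in> carrier R \<and> s \<in> S}"
  by (auto simp: localization_def fraction_def quotient_def)

lemma frac_closed [simp, intro]: "a \<in> carrier R \<Longrightarrow> s \<in> S \<Longrightarrow> fraction R S a s \<in> carrier L"
  by (auto simp: carrier_localization)

lemma carrier_localizationE:
  assumes "x \<in> carrier L"
  obtains a s where "a \<in> carrier R" "s \<in> S" "x = fraction R S a s"
  using assms by (auto simp: carrier_localization)

lemma one_localization: "\<one>\<^bsub>L\<^esub> = fraction R S \<one> \<one>"
  by (simp add: localization_def fraction_def)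

lemma zero_localization: "\<zero>\<^bsub>L\<^esub> = fraction R S \<zero> \<one>"
  by (simp add: localization_def fraction_def)

lemma mult_frac_cong:
  assumes [simp]: "a \<in> carrier R" "s \<in> S" "b \<in> carrier R" "t \<in> S"
    "a' \<in> carrier R" "s' \<in> S" "b' \<in> carrier R" "t' \<in> S"
    and eq: "fraction R S a s = fraction R S a' s'" "fraction R S b t = fraction R S b' t'"
  shows "fraction R S (a \<otimes> b) (s \<otimes> t) = fraction R S (a' \<otimes> b') (s' \<otimes> t')"
proof -
  from eq(1) obtain u where u: "u \<in> S" "u \<otimes> (s' \<otimes> a) = u \<otimes> (s \<otimes> a')"
    by (auto simp: frac_eq_iff)
  from eq(2) obtain v where v: "v \<in> S" "v \<otimes> (t' \<otimes> b) = v \<otimes> (t \<otimes> b')"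
    by (auto simp: frac_eq_iff)
  have "(u \<otimes> v) \<otimes> ((s' \<otimes> t') \<otimes> (a \<otimes> b)) = (u \<otimes> (s' \<otimes> a)) \<otimes> (v \<otimes> (t' \<otimes> b))"
    using u(1) v(1) by (simp add: m_ac)
  also have "\<dots> = (u \<otimes> v) \<otimes> ((s \<otimes> t) \<otimes> (a' \<otimes> b'))"
    unfolding u(2) v(2) using u(1) v(1) by (simp add: m_ac)
  finally show ?thesis
    using u(1) v(1) by (auto simp: frac_eq_iff)
qed

lemma add_frac_cong:
  assumes [simp]: "a \<in> carrier R" "s \<in> S" "b \<in> carrier R" "t \<in> S"
    "a' \<in> carrier R" "s' \<in> S" "b' \<in> carrier R" "t' \<in> S"
    and eq: "fraction R S a s = fraction R S a' s'" "fraction R S b t = fraction R S b' t'"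
  shows "fraction R S (t \<otimes> a \<oplus> s \<otimes> b) (s \<otimes> t) = fraction R S (t' \<otimes> a' \<oplus> s' \<otimes> b') (s' \<otimes> t')"
proof -
  from eq(1) obtain u where u: "u \<in> S" "u \<otimes> (s' \<otimes> a) = u \<otimes> (s \<otimes> a')"
    by (auto simp: frac_eq_iff)
  from eq(2) obtain v where v: "v \<in> S" "v \<otimes> (t' \<otimes> b) = v \<otimes> (t \<otimes> b')"
    by (auto simp: frac_eq_iff)
  have "(u \<otimes> v) \<otimes> ((s' \<otimes> t') \<otimes> (t \<otimes> a \<oplus> s \<otimes> b))
      = (v \<otimes> (t \<otimes> t')) \<otimes> (u \<otimes> (s' \<otimes> a)) \<oplus> (u \<otimes> (s \<otimes> s')) \<otimes> (v \<otimes> (t' \<otimes> b))"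
    using u(1) v(1) by (simp add: r_distr m_ac)
  also have "\<dots> = (u \<otimes> v) \<otimes> ((s \<otimes> t) \<otimes> (t' \<otimes> a' \<oplus> s' \<otimes> b'))"
    unfolding u(2) v(2) using u(1) v(1) by (simp add: r_distr m_ac)
  finally show ?thesis
    using u(1) v(1) by (auto simp: frac_eq_iff)
qed

lemma mult_frac:
  assumes [simp]: "a \<in> carrier R" "s \<in> S" "b \<in> carrier R" "t \<in> S"
  shows "fraction R S a s \<otimes>\<^bsub>L\<^esub> fraction R S b t = fraction R S (a \<otimes> b) (s \<otimes> t)"
proof -
  have "fraction R S a s \<otimes>\<^bsub>L\<^esub> fraction R S b t
      = (\<Union>(a', s')\<in>fraction R S a s. \<Union>(b', t')\<in>fraction R S b t. fraction R S (a' \<otimes> b') (s' \<otimes> t'))"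
    by (simp add: localization_def fraction_def)
  also have "\<dots> = (\<Union>(a', s')\<in>fraction R S a s. \<Union>(b', t')\<in>fraction R S b t. fraction R S (a \<otimes> b) (s \<otimes> t))"
    proof (intro SUP_cong refl, clarify)
    fix a' s' assume as: "(a', s') \<in> fraction R S a s"
    show "(\<Union>(b', t')\<in>fraction R S b t. fraction R S (a' \<otimes> b') (s' \<otimes> t')) = (\<Union>(b', t')\<in>fraction R S b t. fraction R S (a \<otimes> b) (s \<otimes> t))"
    proof (intro SUP_cong refl, clarify)
      fix b' t' assume "(b', t') \<in> fraction R S b t"
      with as show "fraction R S (a' \<otimes> b') (s' \<otimes> t') = fraction R S (a \<otimes> b) (s \<otimes> t)"
        by (intro mult_frac_cong) (simp_all add: mem_frac_iff)
    qed
  qed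
  also have "\<dots> = fraction R S (a \<otimes> b) (s \<otimes> t)"
    using frac_self[of a s] frac_self[of b t] by auto
  finally show ?thesis .
qed

lemma add_frac:
  assumes [simp]: "a \<in> carrier R" "s \<in> S" "b \<in> carrier R" "t \<in> S"
  shows "fraction R S a s \<oplus>\<^bsub>L\<^esub> fraction R S b t = fraction R S (t \<otimes> a \<oplus> s \<otimes> b) (s \<otimes> t)"
proof -
  have "fraction R S a s \<oplus>\<^bsub>L\<^esub> fraction R S b t
      = (\<Union>(a', s')\<in>fraction R S a s. \<Union>(b', t')\<in>fraction R S b t. fraction R S (t' \<otimes> a' \<oplus> s' \<otimes> b') (s' \<otimes> t'))"
    by (simp add: localization_def fraction_def)
  also have "\<dots> = (\<Union>(a', s')\<in>fraction R S a s. \<Union>(b', t')\<in>fraction R S b t. fraction R S (t \<otimes> a \<oplus> s \<otimes> b) (s \<otimes> t))"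
    proof (intro SUP_cong refl, clarify)
    fix a' s' assume as: "(a', s') \<in> fraction R S a s"
    show "(\<Union>(b', t')\<in>fraction R S b t. fraction R S (t' \<otimes> a' \<oplus> s' \<otimes> b') (s' \<otimes> t')) = (\<Union>(b', t')\<in>fraction R S b t. fraction R S (t \<otimes> a \<oplus> s \<otimes> b) (s \<otimes> t))"
    proof (intro SUP_cong refl, clarify)
      fix b' t' assume "(b', t') \<in> fraction R S b t"
      with as show "fraction R S (t' \<otimes> a' \<oplus> s' \<otimes> b') (s' \<otimes> t') = fraction R S (t \<otimes> a \<oplus> s \<otimes> b) (s \<otimes> t)"
        by (intro add_frac_cong) (simp_all add: mem_frac_iff)
    qed
  qed
  also have "\<dots> = fraction R S (t \<otimes> a \<oplus> s \<otimes> b) (s \<otimes> t)"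
    using frac_self[of a s] frac_self[of b t] by auto
  finally show ?thesis .
qed

lemma cring_localization: "cring L"
proof (rule cringI)
  show "abelian_group L"
  proof (rule abelian_groupI)
    fix x y assume "x \<in> carrier L" "y \<in> carrier L"
    then obtain a s b t where [simp]: "a \<in> carrier R" "s \<in> S" "b \<in> carrier R" "t \<in> S"
      and x: "x = fraction R S a s" and y: "y = fraction R S b t"
      by (metis carrier_localizationE)
    show "x \<oplus>\<^bsub>L\<^esub> y \<in> carrier L" by (simp add: x y add_frac)
    show "x \<oplus>\<^bsub>L\<^esub> y = y \<oplus>\<^bsub>L\<^esub> x"
      by (simp add: x y add_frac m_comm[of s t] a_comm)
    fix z assume "z \<in> carrier L"
    then obtain c r where [simp]: "c \<in> carrier R" "r \<in> S" and z: "z = fraction R S c r"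
      by (metis carrier_localizationE)
    show "x \<oplus>\<^bsub>L\<^esub> y \<oplus>\<^bsub>L\<^esub> z = x \<oplus>\<^bsub>L\<^esub> (y \<oplus>\<^bsub>L\<^esub> z)"
      by (simp add: x y z add_frac) (rule frac_eqI, simp_all add: r_distr l_distr m_ac a_ac)
  next
    show "\<zero>\<^bsub>L\<^esub> \<in> carrier L" by (simp add: zero_localization)
  next
    fix x assume "x \<in> carrier L"
    then obtain a s where [simp]: "a \<in> carrier R" "s \<in> S" and x: "x = fraction R S a s"
      by (metis carrier_localizationE)
    show "\<zero>\<^bsub>L\<^esub> \<oplus>\<^bsub>L\<^esub> x = x"
      by (simp add: x zero_localization add_frac)
    have "fraction R S (\<ominus> a) s \<oplus>\<^bsub>L\<^esub> x = \<zero>\<^bsub>L\<^esub>"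
      by (simp add: x zero_localization add_frac)
        (rule frac_eqI, simp_all add: r_minus l_neg)
    then show "\<exists>y\<in>carrier L. y \<oplus>\<^bsub>L\<^esub> x = \<zero>\<^bsub>L\<^esub>"
      by (rule bexI) simp
  qed
next
  show "comm_monoid L"
  proof (rule comm_monoidI)
    fix x y assume "x \<in> carrier L" "y \<in> carrier L"
    then obtain a s b t where [simp]: "a \<in> carrier R" "s \<in> S" "b \<in> carrier R" "t \<in> S"
      and x: "x = fraction R S a s" and y: "y = fraction R S b t"
      by (metis carrier_localizationE)
    show "x \<otimes>\<^bsub>L\<^esub> y \<in> carrier L" by (simp add: x y mult_frac)
    show "x \<otimes>\<^bsub>L\<^esub> y = y \<otimes>\<^bsub>L\<^esub> x"
      by (simp add: x y mult_frac m_comm)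
    fix z assume "z \<in> carrier L"
    then obtain c r where [simp]: "c \<in> carrier R" "r \<in> S" and z: "z = fraction R S c r"
      by (metis carrier_localizationE)
    show "x \<otimes>\<^bsub>L\<^esub> y \<otimes>\<^bsub>L\<^esub> z = x \<otimes>\<^bsub>L\<^esub> (y \<otimes>\<^bsub>L\<^esub> z)"
      by (simp add: x y z mult_frac m_assoc)
  next
    show "\<one>\<^bsub>L\<^esub> \<in> carrier L" by (simp add: one_localization)
  next
    fix x assume "x \<in> carrier L"
    then obtain a s where [simp]: "a \<in> carrier R" "s \<in> S" and x: "x = fraction R S a s"
      by (metis carrier_localizationE)
    show "\<one>\<^bsub>L\<^esub> \<otimes>\<^bsub>L\<^esub> x = x"
      by (simp add: x one_localization mult_frac)
  qed
next
  fix x y z assume "x \<in> carrier L" "y \<in> carrier L" "z \<in> carrier L"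
  then obtain a s b t c r where [simp]: "a \<in> carrier R" "s \<in> S" "b \<in> carrier R" "t \<in> S"
      "c \<in> carrier R" "r \<in> S"
    and x: "x = fraction R S a s" and y: "y = fraction R S b t" and z: "z = fraction R S c r"
    by (metis carrier_localizationE)
  show "(x \<oplus>\<^bsub>L\<^esub> y) \<otimes>\<^bsub>L\<^esub> z = x \<otimes>\<^bsub>L\<^esub> z \<oplus>\<^bsub>L\<^esub> y \<otimes>\<^bsub>L\<^esub> z"
    by (simp add: x y z mult_frac add_frac) (rule frac_eqI, simp_all add: r_distr l_distr m_ac a_ac)
qed

end

section \<open>Chain lengths\<close>

lemma chain_length_mono_map:
  assumes "\<And>X. X \<in> \<F> \<Longrightarrow> f X \<in> \<G>"
    and "\<And>X Y. X \<in> \<F> \<Longrightarrow> Y \<in> \<F> \<Longrightarrow> X \<subset> Y \<Longrightarrow> f X \<subset> f Y"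
  shows "chain_length \<F> \<le> chain_length \<G>"
  unfolding chain_length_def
proof (intro SUP_subset_mono subsetI order_refl)
  fix k assume "k \<in> {k. \<exists>c. (\<forall>i\<le>k. c i \<in> \<F>) \<and> (\<forall>i<k. c i \<subset> c (Suc i))}"
  then obtain c where "\<forall>i\<le>k. c i \<in> \<F>" "\<forall>i<k. c i \<subset> c (Suc i)" by blast
  with assms have "(\<forall>i\<le>k. f (c i) \<in> \<G>) \<and> (\<forall>i<k. f (c i) \<subset> f (c (Suc i)))"
    by simp
  then show "k \<in> {k. \<exists>c. (\<forall>i\<le>k. c i \<in> \<G>) \<and> (\<forall>i<k. c i \<subset> c (Suc i))}"
    by (intro CollectI exI[of _ "\<lambda>i. f (c i)"])
qed

lemma chain_length_eqI:
  assumes "\<And>k c. \<forall>i\<le>k. c i \<in> \<F> \<Longrightarrow> \<forall>i<k. c i \<subset> c (Suc i) \<Longrightarrow> k \<le> n"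
    and "\<forall>i\<le>n. c i \<in> \<F>" "\<forall>i<n. c i \<subset> c (Suc i)"
  shows "chain_length \<F> = enat n"
proof (rule antisym)
  show "chain_length \<F> \<le> enat n"
    unfolding chain_length_def using assms(1) by (auto intro!: SUP_least)
  show "enat n \<le> chain_length \<F>"
    unfolding chain_length_def using assms(2,3) by (intro SUP_upper) auto
qed

lemma (in ring_hom_ring) img_ideal_if_surj:
  assumes surj: "h ` carrier R = carrier S" and W: "ideal W R"
  shows "ideal (h ` W) S"
proof (rule idealI)
  show "ring S" by (rule S.ring_axioms)
  show "subgroup (h ` W) (add_monoid S)"
    using W by (intro img_is_add_subgroup additive_subgroup.a_subgroup ideal.axioms(1))
  fix y x assume "y \<in> h ` W" "x \<in> carrier S"
  then obtain w r where wr: "w \<in> W" "y = h w" "r \<in> carrier R" "x = h r"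
    using surj by (metis imageE)
  have "x \<otimes>\<^bsub>S\<^esub> y = h (r \<otimes>\<^bsub>R\<^esub> w)" "y \<otimes>\<^bsub>S\<^esub> x = h (w \<otimes>\<^bsub>R\<^esub> r)"
    using wr ideal.Icarr[OF W wr(1)] by simp_all
  then show "x \<otimes>\<^bsub>S\<^esub> y \<in> h ` W" "y \<otimes>\<^bsub>S\<^esub> x \<in> h ` W"
    using ideal.I_l_closed[OF W wr(1,3)] ideal.I_r_closed[OF W wr(1,3)] by simp_all
qed

text \<open>Ideals of a homomorphic image correspond to the ideals above the kernel.\<close>

lemma (in ring_hom_ring) ring_length_surj_image:
  assumes surj: "h ` carrier R = carrier S"
  shows "ring_length S = chain_length {W. ideal W R \<and> a_kernel R S h \<subseteq> W}"
proof -
  have 1: "chain_length {J. ideal J S} \<le> chain_length {W. ideal W R \<and> a_kernel R S h \<subseteq> W}"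
  proof (rule chain_length_mono_map[where f = "\<lambda>J. {r \<in> carrier R. h r \<in> J}"])
    fix J assume "J \<in> {J. ideal J S}"
    then have J: "ideal J S" by simp
    have "\<zero>\<^bsub>S\<^esub> \<in> J"
      using J by (simp add: additive_subgroup.zero_closed ideal.axioms(1))
    then have "a_kernel R S h \<subseteq> {r \<in> carrier R. h r \<in> J}"
      unfolding a_kernel_def' by (intro subsetI CollectI) simp
    then show "{r \<in> carrier R. h r \<in> J} \<in> {W. ideal W R \<and> a_kernel R S h \<subseteq> W}"
      by (simp add: ideal_vimage[OF J])
  next
    fix X Y assume XY: "X \<in> {J. ideal J S}" "Y \<in> {J. ideal J S}" "X \<subset> Y"
    then obtain y where y: "y \<in> Y" "y \<notin> X" by blast
    with XY have "y \<in> carrier S" by (simp add: ideal.Icarr[of Y S y])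
    with surj obtain r where "r \<in> carrier R" "y = h r" by (metis imageE)
    with y have "r \<in> {r \<in> carrier R. h r \<in> Y} - {r \<in> carrier R. h r \<in> X}" by simp
    moreover have "{r \<in> carrier R. h r \<in> X} \<subseteq> {r \<in> carrier R. h r \<in> Y}"
      using XY(3) by (intro Collect_mono) auto
    ultimately show "{r \<in> carrier R. h r \<in> X} \<subset> {r \<in> carrier R. h r \<in> Y}" by blast
  qed
  have 2: "chain_length {W. ideal W R \<and> a_kernel R S h \<subseteq> W} \<le> chain_length {J. ideal J S}"
  proof (rule chain_length_mono_map[where f = "\<lambda>W. h ` W"])
    fix W assume "W \<in> {W. ideal W R \<and> a_kernel R S h \<subseteq> W}"
    then have "ideal W R" by simp
    then show "h ` W \<in> {J. ideal J S}"
      using img_ideal_if_surj[OF surj] by simp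
  next
    fix V W assume "V \<in> {W. ideal W R \<and> a_kernel R S h \<subseteq> W}" "W \<in> {W. ideal W R \<and> a_kernel R S h \<subseteq> W}" and VW: "V \<subset> W"
    then have V: "ideal V R" and W: "ideal W R" and ker: "a_kernel R S h \<subseteq> V" by simp_all
    obtain w where w: "w \<in> W" "w \<notin> V" using VW by (rule psubsetE) auto
    have "h w \<notin> h ` V"
    proof
      assume "h w \<in> h ` V"
      then obtain v where v: "v \<in> V" "h w = h v" by (rule imageE) simp
      have carr: "v \<in> carrier R" "w \<in> carrier R"
        using ideal.Icarr[OF V v(1)] ideal.Icarr[OF W w(1)] by simp_all
      have "w \<ominus>\<^bsub>R\<^esub> v \<in> a_kernel R S h"
        unfolding a_kernel_def' using carr v(2) by (simp add: R.minus_eq S.r_neg)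
      with ker have "w \<ominus>\<^bsub>R\<^esub> v \<in> V" by (rule subsetD)
      then have "(w \<ominus>\<^bsub>R\<^esub> v) \<oplus>\<^bsub>R\<^esub> v \<in> V"
        using v(1) by (rule additive_subgroup.a_closed[OF ideal.axioms(1)[OF V]])
      with carr w(2) show False by (simp add: R.minus_eq R.a_assoc R.l_neg)
    qed
    then have "h w \<in> h ` W - h ` V" using w(1) by simp
    moreover have "h ` V \<subseteq> h ` W" using VW by (intro image_mono) auto
    ultimately show "h ` V \<subset> h ` W" by blast
  qed
  from 1 2 show ?thesis unfolding ring_length_def by (rule order_antisym)
qed

section \<open>The local ring of a cone at its vertex\<close>

lemma cring_poly_ring: "cring (poly_ring N)"
proof (rule cringI)
  show "abelian_group (poly_ring N)"
  proof (rule abelian_groupI)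
    fix x assume "x \<in> carrier (poly_ring N)"
    then show "\<exists>y\<in>carrier (poly_ring N). y \<oplus>\<^bsub>poly_ring N\<^esub> x = \<zero>\<^bsub>poly_ring N\<^esub>"
      by (auto simp: poly_ring_def intro!: bexI[of _ "- x"])
  qed (auto simp: poly_ring_def add_ac)
  show "comm_monoid (poly_ring N)"
    by (rule comm_monoidI) (auto simp: poly_ring_def mult_ac)
qed (auto simp: poly_ring_def algebra_simps)

lemma poly_ring_simps [simp]:
  "carrier (poly_ring N) = polys N" "mult (poly_ring N) = (*)" "one (poly_ring N) = 1"
  "zero (poly_ring N) = 0" "add (poly_ring N) = (+)"
  by (simp_all add: poly_ring_def)

lemma a_minus_poly_ring: "p \<in> polys N \<Longrightarrow> \<ominus>\<^bsub>poly_ring N\<^esub> p = - p"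
proof -
  assume p: "p \<in> polys N"
  interpret cring "poly_ring N" by (rule cring_poly_ring)
  show ?thesis using p minus_equality[of "- p" p] by simp
qed

text \<open>The ideals of the polynomial ring, in terms of the operations of the type.\<close>

lemma ideal_poly_ring_iff:
  "ideal W (poly_ring N) \<longleftrightarrow> W \<subseteq> polys N \<and> 0 \<in> W \<and> (\<forall>p\<in>W. \<forall>q\<in>W. p + q \<in> W) \<and>
     (\<forall>p\<in>W. \<forall>q\<in>polys N. q * p \<in> W)"  (is "_ \<longleftrightarrow> ?R")
proof
  assume W: "ideal W (poly_ring N)"
  then have "additive_subgroup W (poly_ring N)" by (rule ideal.axioms)
  with W show ?R
    using additive_subgroup.a_closed[of W "poly_ring N"] additive_subgroup.zero_closed[of W "poly_ring N"]
      ideal.I_l_closed[OF W] ideal.Icarr[OF W] by auto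
next
  assume R: ?R
  interpret cring "poly_ring N" by (rule cring_poly_ring)
  have uminus: "- p \<in> W" if "p \<in> W" for p
  proof -
    have "- 1 \<in> polys N" by simp
    with that R have "- 1 * p \<in> W" by blast
    then show ?thesis by simp
  qed
  show "ideal W (poly_ring N)"
  proof (rule idealI)
    show "ring (poly_ring N)" by (rule ring_axioms)
    show "subgroup W (add_monoid (poly_ring N))"
    proof (rule add.subgroupI)
      fix a assume "a \<in> W"
      with R uminus[of a] show "\<ominus>\<^bsub>poly_ring N\<^esub> a \<in> W"
        by (subst a_minus_poly_ring) auto
    qed (use R in auto)
  qed (use R in \<open>auto simp: mult.commute\<close>)
qed

text \<open>The sum of the homogeneous parts of degree less than \<open>k\<close>.\<close>

definition low_part :: "nat \<Rightarrow> cpoly \<Rightarrow> cpoly" where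
  "low_part k p = (\<Sum>m\<in>{m \<in> Poly_Mapping.keys p. monom_deg m < k}.
     Poly_Mapping.single m (Poly_Mapping.lookup p m))"

lemma low_part_polys: "p \<in> polys N \<Longrightarrow> low_part k p \<in> polys N"
  unfolding low_part_def by (intro polys_sum polys_single) (auto simp: polys_iff)

lemma cpoly_eval_low_part: "cpoly_eval (low_part k p) y = (\<Sum>d<k. hom_part d p y)"
proof -
  let ?K = "{m \<in> Poly_Mapping.keys p. monom_deg m < k}"
  have "(\<Sum>d<k. hom_part d p y)
      = (\<Sum>d<k. \<Sum>m\<in>{m\<in>?K. monom_deg m = d}. Poly_Mapping.lookup p m * monom_eval m y)"
    unfolding hom_part_eq_sum by (intro sum.cong refl) auto
  also have "\<dots> = (\<Sum>m\<in>?K. Poly_Mapping.lookup p m * monom_eval m y)"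
    by (intro sum.group) auto
  finally show ?thesis by (simp add: low_part_def cpoly_eval_sum)
qed

text \<open>A nonempty subset of affine space that is closed under scalar multiplication. The ring \<open>C\<close> is its
  coordinate ring, and \<open>R\<close> is the local ring at the vertex.\<close>

locale affine_cone =
  fixes N :: nat and A :: "(nat \<Rightarrow> complex) set"
  assumes A_space: "A \<subseteq> complex_space N"
    and A_nonempty: "A \<noteq> {}"
    and A_scale: "\<And>y t. y \<in> A \<Longrightarrow> (\<lambda>i. t * y i) \<in> A"
begin

abbreviation "I \<equiv> vanishing_ideal N A"
abbreviation "P \<equiv> poly_ring N"
abbreviation "C \<equiv> coordinate_ring N A"
abbreviation "R \<equiv> local_ring N A origin"

text \<open>The restriction of a polynomial to \<open>A\<close>, as an element of the coordinate ring.\<close>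

definition cls :: "cpoly \<Rightarrow> cpoly set" where "cls p = I +>\<^bsub>P\<^esub> p"

text \<open>The complement of the maximal ideal of the vertex in the coordinate ring.\<close>

definition denoms :: "cpoly set set" where
  "denoms = {cls q | q. q \<in> polys N \<and> cpoly_eval q origin \<noteq> 0}"

text \<open>The polynomials whose restriction to \<open>A\<close> vanishes to order at least \<open>k\<close> at the vertex.\<close>

definition order_ideal :: "nat \<Rightarrow> cpoly set" where
  "order_ideal k = {p \<in> polys N. \<forall>d<k. \<forall>y\<in>A. hom_part d p y = 0}"

lemma ideal_I: "ideal I P"
  unfolding ideal_poly_ring_iff by (auto simp: vanishing_ideal_def)

lemma order_ideal_polys: "p \<in> order_ideal k \<Longrightarrow> p \<in> polys N"
  by (simp add: order_ideal_def)

lemma order_ideal_0: "order_ideal 0 = polys N"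
  by (simp add: order_ideal_def)

lemma order_ideal_add: "p \<in> order_ideal k \<Longrightarrow> q \<in> order_ideal k \<Longrightarrow> p + q \<in> order_ideal k"
  by (simp add: order_ideal_def)

lemma order_ideal_uminus: "p \<in> order_ideal k \<Longrightarrow> - p \<in> order_ideal k"
  by (simp add: order_ideal_def)

lemma order_ideal_mult:
  assumes "p \<in> order_ideal j" "q \<in> order_ideal k"
  shows "p * q \<in> order_ideal (j + k)"
proof -
  have "hom_part d (p * q) y = 0" if "d < j + k" "y \<in> A" for d y
    unfolding hom_part_mult
  proof (rule sum.neutral, rule ballI)
    fix i assume "i \<in> {..d}"
    then have "i < j \<or> d - i < k" using that by auto
    with assms that show "hom_part i p y * hom_part (d - i) q y = 0"
      by (auto simp: order_ideal_def)
  qed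
  with assms show ?thesis by (simp add: order_ideal_def)
qed

lemma order_ideal_lmult: "p \<in> order_ideal k \<Longrightarrow> q \<in> polys N \<Longrightarrow> q * p \<in> order_ideal k"
  using order_ideal_mult[of q 0 p k] by (simp add: order_ideal_0)

lemma order_ideal_power: "p \<in> order_ideal 1 \<Longrightarrow> p ^ k \<in> order_ideal k"
proof (induction k)
  case (Suc k)
  then show ?case using order_ideal_mult[of p 1 "p ^ k" k] by simp
qed (simp add: order_ideal_0)

lemma I_order_ideal: "I \<subseteq> order_ideal k"
proof
  fix p assume p: "p \<in> I"
  have "hom_part d p y = 0" if "y \<in> A" for d y
  proof -
    have "ray_poly y p = 0"
      using p A_scale[OF that]
      by (intro poly_eq_if_same_values) (simp add: poly_ray_poly vanishing_ideal_def)
    then show ?thesis by (simp add: hom_part_def)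
  qed
  with p show "p \<in> order_ideal k" by (simp add: order_ideal_def vanishing_ideal_def)
qed

lemma mem_order_ideal_1: "p \<in> order_ideal (Suc 0) \<longleftrightarrow> p \<in> polys N \<and> cpoly_eval p origin = 0"
  using A_nonempty by (auto simp: order_ideal_def hom_part_constant)

text \<open>Polynomials that do not vanish at the vertex do not affect the order.\<close>

lemma order_ideal_cancel:
  assumes q: "cpoly_eval q origin \<noteq> 0" and p: "p \<in> polys N" and qp: "q * p \<in> order_ideal k"
  shows "p \<in> order_ideal k"
proof -
  have "hom_part d p y = 0" if "d < k" and y: "y \<in> A" for d y
    using \<open>d < k\<close>
  proof (induction d rule: less_induct)
    case (less d)
    have "0 = hom_part d (q * p) y"
      using qp less.prems y by (simp add: order_ideal_def)
    also have "\<dots> = (\<Sum>i\<in>{0}. hom_part i q y * hom_part (d - i) p y)"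
      unfolding hom_part_mult using less
      by (intro sum.mono_neutral_right) auto
    also have "\<dots> = cpoly_eval q origin * hom_part d p y"
      by (simp add: hom_part_constant)
    finally show ?case using q by simp
  qed
  with p show ?thesis by (simp add: order_ideal_def)
qed

sublocale P: cring P by (rule cring_poly_ring)
sublocale I: ideal I P by (rule ideal_I)
sublocale C: cring C
  unfolding coordinate_ring_def by (rule I.quotient_is_cring) (rule P.cring_axioms)

lemma cls_hom: "cls \<in> ring_hom P C"
  unfolding coordinate_ring_def cls_def[abs_def] by (rule I.rcos_ring_hom)

lemma cls_closed [simp]: "p \<in> polys N \<Longrightarrow> cls p \<in> carrier C"
  using ring_hom_closed[OF cls_hom] by simp

lemma cls_simps:
  assumes "p \<in> polys N" "q \<in> polys N"
  shows "cls p \<otimes>\<^bsub>C\<^esub> cls q = cls (p * q)" "cls p \<oplus>\<^bsub>C\<^esub> cls q = cls (p + q)"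
  using assms ring_hom_mult[OF cls_hom, of p q] ring_hom_add[OF cls_hom, of p q] by simp_all

lemma cls_one: "\<one>\<^bsub>C\<^esub> = cls 1"
  using ring_hom_one[OF cls_hom] by simp

lemma carrier_C: "carrier C = cls ` polys N"
  by (auto simp: coordinate_ring_def FactRing_def A_RCOSETS_def' cls_def)

lemma cls_eq_iff:
  assumes "p \<in> polys N" "q \<in> polys N"
  shows "cls p = cls q \<longleftrightarrow> p - q \<in> I"
proof -
  have "cls p = cls q \<longleftrightarrow> p \<ominus>\<^bsub>P\<^esub> q \<in> I"
    using assms P.quotient_eq_iff_same_a_r_cos[OF ideal_I, of p q] by (simp add: cls_def)
  then show ?thesis using assms by (simp add: P.minus_eq a_minus_poly_ring)
qed

sublocale den: ring_with_denominators C denoms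
proof
  show "denoms \<subseteq> carrier C" by (auto simp: denoms_def cls_simps)
  show "\<one>\<^bsub>C\<^esub> \<in> denoms" unfolding denoms_def cls_one by (auto intro!: exI[of _ 1])
  show "s \<otimes>\<^bsub>C\<^esub> t \<in> denoms" if "s \<in> denoms" "t \<in> denoms" for s t
  proof -
    from that obtain p q where "p \<in> polys N" "cpoly_eval p origin \<noteq> 0" "s = cls p"
      "q \<in> polys N" "cpoly_eval q origin \<noteq> 0" "t = cls q"
      by (auto simp: denoms_def)
    then show ?thesis by (auto simp: denoms_def cls_simps intro!: exI[of _ "p * q"])
  qed
qed

lemma local_ring_eq: "R = localization C denoms"
  by (simp add: local_ring_def denoms_def cls_def)

sublocale R: cring R
  unfolding local_ring_eq by (rule den.cring_localization)

text \<open>The element \<open>p / q\<close> of the local ring.\<close>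

definition quot :: "cpoly \<Rightarrow> cpoly \<Rightarrow> (cpoly set \<times> cpoly set) set" where
  "quot p q = fraction C denoms (cls p) (cls q)"

text \<open>The polynomials that are units in the local ring, that is, do not vanish at the vertex.\<close>

definition units0 :: "cpoly set" where
  "units0 = {q \<in> polys N. cpoly_eval q origin \<noteq> 0}"

lemma units0_polys [simp]: "q \<in> units0 \<Longrightarrow> q \<in> polys N"
  unfolding units0_def by simp

lemma units0_nonzero: "q \<in> units0 \<Longrightarrow> cpoly_eval q origin \<noteq> 0"
  unfolding units0_def by simp

lemma units0_mult [simp]: "p \<in> units0 \<Longrightarrow> q \<in> units0 \<Longrightarrow> p * q \<in> units0"
  unfolding units0_def by simp

lemma units0_1 [simp]: "1 \<in> units0"
  unfolding units0_def by simp

lemma units0_denoms [simp]: "q \<in> units0 \<Longrightarrow> cls q \<in> denoms"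
  unfolding units0_def denoms_def by blast

lemma carrier_RE:
  assumes "x \<in> carrier R"
  obtains p q where "p \<in> polys N" "q \<in> units0" "x = quot p q"
proof -
  from assms obtain a s where "a \<in> carrier C" "s \<in> denoms" "x = fraction C denoms a s"
    unfolding local_ring_eq by (rule den.carrier_localizationE)
  moreover from this obtain p where "p \<in> polys N" "a = cls p"
    unfolding carrier_C by (elim imageE) simp
  moreover from \<open>s \<in> denoms\<close> obtain q where "q \<in> units0" "s = cls q"
    unfolding denoms_def units0_def by blast
  ultimately show ?thesis using that by (simp add: quot_def)
qed

lemma quot_closed [simp]: "p \<in> polys N \<Longrightarrow> q \<in> units0 \<Longrightarrow> quot p q \<in> carrier R"
  unfolding quot_def local_ring_eq by (intro den.frac_closed) simp_all

lemma quot_simps: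
  assumes "p \<in> polys N" "q \<in> units0" "p' \<in> polys N" "q' \<in> units0"
  shows "quot p q \<otimes>\<^bsub>R\<^esub> quot p' q' = quot (p * p') (q * q')"
    "quot p q \<oplus>\<^bsub>R\<^esub> quot p' q' = quot (q' * p + q * p') (q * q')"
  using assms
  by (simp_all add: quot_def local_ring_eq den.mult_frac den.add_frac cls_simps)

lemma quot_one: "\<one>\<^bsub>R\<^esub> = quot 1 1"
  by (simp add: quot_def local_ring_eq den.one_localization cls_one)

lemma quot_eqD:
  assumes "p \<in> polys N" "q \<in> units0" "p' \<in> polys N" "q' \<in> units0" "quot p q = quot p' q'"
  obtains u where "u \<in> units0" "u * (q' * p - q * p') \<in> I"
proof -
  from assms have "\<exists>u\<in>denoms. u \<otimes>\<^bsub>C\<^esub> (cls q' \<otimes>\<^bsub>C\<^esub> cls p) = u \<otimes>\<^bsub>C\<^esub> (cls q \<otimes>\<^bsub>C\<^esub> cls p')"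
    by (simp add: quot_def den.frac_eq_iff cls_simps)
  then obtain u where u: "u \<in> units0" "cls u \<otimes>\<^bsub>C\<^esub> (cls q' \<otimes>\<^bsub>C\<^esub> cls p) = cls u \<otimes>\<^bsub>C\<^esub> (cls q \<otimes>\<^bsub>C\<^esub> cls p')"
    unfolding denoms_def units0_def by blast
  with assms have "u * (q' * p - q * p') \<in> I"
    by (simp add: cls_simps cls_eq_iff right_diff_distrib)
  with u(1) show ?thesis by (rule that)
qed

lemma quot_eqI:
  assumes "p \<in> polys N" "q \<in> units0" "p' \<in> polys N" "q' \<in> units0" "q' * p - q * p' \<in> I"
  shows "quot p q = quot p' q'"
  unfolding quot_def using assms
  by (intro den.frac_eqI) (simp_all add: cls_simps cls_eq_iff)

lemma quot_zero: "\<zero>\<^bsub>R\<^esub> = quot 0 1"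
proof -
  have "\<zero>\<^bsub>C\<^esub> = cls 0"
    using ring_hom_zero[OF cls_hom P.ring_axioms C.ring_axioms] by simp
  then show ?thesis
    by (simp add: quot_def local_ring_eq den.zero_localization cls_one)
qed

lemma quot_minus:
  assumes pq: "p \<in> polys N" "q \<in> units0"
  shows "\<ominus>\<^bsub>R\<^esub> quot p q = quot (- p) q"
proof (rule R.minus_equality)
  have "quot (- p) q \<oplus>\<^bsub>R\<^esub> quot p q = quot 0 (q * q)"
    using pq by (simp add: quot_simps)
  also have "\<dots> = quot 0 1"
    using pq by (intro quot_eqI) (auto simp: vanishing_ideal_def)
  finally show "quot (- p) q \<oplus>\<^bsub>R\<^esub> quot p q = \<zero>\<^bsub>R\<^esub>"
    by (simp add: quot_zero)
qed (use pq in \<open>simp_all add: quot_simps\<close>)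

text \<open>The fractions whose numerator vanishes to order at least \<open>k\<close>. For \<open>k = 1\<close> this is the maximal ideal, and in
  general it is the \<open>k\<close>-th power of the maximal ideal.\<close>

definition max_power :: "nat \<Rightarrow> (cpoly set \<times> cpoly set) set set" where
  "max_power k = {quot p q | p q. p \<in> order_ideal k \<and> q \<in> units0}"

lemma quot_mem_max_power:
  assumes p: "p \<in> polys N" and q: "q \<in> units0"
  shows "quot p q \<in> max_power k \<longleftrightarrow> p \<in> order_ideal k"
proof
  assume "quot p q \<in> max_power k"
  then obtain p' q' where p': "p' \<in> order_ideal k" and q': "q' \<in> units0" and eq: "quot p q = quot p' q'"
    by (auto simp: max_power_def)
  from p' have p'': "p' \<in> polys N" by (rule order_ideal_polys)
  from quot_eqD[OF p q p'' q' eq] obtain u where u: "u \<in> units0" "u * (q' * p - q * p') \<in> I" .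
  have "u * (q' * p - q * p') + (u * q) * p' \<in> order_ideal k"
    by (rule order_ideal_add[OF subsetD[OF I_order_ideal u(2)] order_ideal_lmult[OF p']]) (use u q in simp)
  then have "(u * q') * p \<in> order_ideal k" by (simp add: algebra_simps)
  then show "p \<in> order_ideal k"
    using p u(1) q' by (elim order_ideal_cancel[rotated 2]) (simp_all add: units0_nonzero)
qed (use q in \<open>auto simp: max_power_def\<close>)

lemma max_power_0: "max_power 0 = carrier R"
proof
  show "max_power 0 \<subseteq> carrier R" by (auto simp: max_power_def order_ideal_0)
  show "carrier R \<subseteq> max_power 0"
  proof
    fix x assume "x \<in> carrier R"
    then obtain p q where "p \<in> polys N" "q \<in> units0" "x = quot p q" by (rule carrier_RE)
    then show "x \<in> max_power 0" by (simp add: quot_mem_max_power order_ideal_0)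
  qed
qed

lemma ideal_max_power_1: "ideal (max_power 1) R"
proof (rule idealI)
  show "ring R" by (rule R.ring_axioms)
  show "subgroup (max_power 1) (add_monoid R)"
  proof (rule R.add.subgroupI)
    show "max_power 1 \<subseteq> carrier R"
      by (auto simp: max_power_def quot_simps order_ideal_polys)
    have "quot 0 1 \<in> max_power 1" by (simp add: quot_mem_max_power mem_order_ideal_1)
    then show "max_power 1 \<noteq> {}" by blast
  next
    fix x assume "x \<in> max_power 1"
    then obtain p q where "p \<in> order_ideal 1" "q \<in> units0" "x = quot p q"
      unfolding max_power_def by blast
    then show "\<ominus>\<^bsub>R\<^esub> x \<in> max_power 1"
      using order_ideal_uminus[of p 1] by (simp add: order_ideal_polys quot_minus quot_mem_max_power)
  next
    fix x y assume "x \<in> max_power 1" "y \<in> max_power 1"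
    then show "x \<oplus>\<^bsub>R\<^esub> y \<in> max_power 1"
      by (auto simp: max_power_def quot_simps order_ideal_polys)
         (metis order_ideal_add order_ideal_lmult units0_mult units0_polys)
  qed
next
  fix x y assume "x \<in> max_power 1" "y \<in> carrier R"
  then obtain p q p' q' where x: "p \<in> order_ideal 1" "q \<in> units0" "x = quot p q"
    and y: "p' \<in> polys N" "q' \<in> units0" "y = quot p' q'"
    by (auto simp: max_power_def elim: carrier_RE)
  show "y \<otimes>\<^bsub>R\<^esub> x \<in> max_power 1"
    using x y order_ideal_lmult[OF x(1) y(1)]
    by (simp add: order_ideal_polys quot_simps quot_mem_max_power)
  then show "x \<otimes>\<^bsub>R\<^esub> y \<in> max_power 1"
    using x y by (simp add: order_ideal_polys quot_simps mult.commute)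
qed

text \<open>All elements outside of \<open>max_power 1\<close> are units, so this is the only maximal ideal.\<close>

lemma not_in_max_power_imp_ideal_carrier:
  assumes J: "ideal J R" and x: "x \<in> J" "x \<notin> max_power 1"
  shows "J = carrier R"
proof -
  have "x \<in> carrier R" using J x(1) by (rule ideal.Icarr)
  then obtain p q where pq: "p \<in> polys N" "q \<in> units0" "x = quot p q" by (rule carrier_RE)
  with x(2) have "cpoly_eval p origin \<noteq> 0"
    by (simp add: quot_mem_max_power mem_order_ideal_1)
  with pq(1) have p: "p \<in> units0" unfolding units0_def by simp
  have "quot q p \<otimes>\<^bsub>R\<^esub> x = quot (q * p) (p * q)"
    using pq p by (simp add: quot_simps)
  also have "\<dots> = \<one>\<^bsub>R\<^esub>"
    unfolding quot_one using pq p by (intro quot_eqI) (auto simp: vanishing_ideal_def)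
  finally have "\<one>\<^bsub>R\<^esub> \<in> J"
    using ideal.I_l_closed[OF J x(1), of "quot q p"] pq p by (simp add: quot_simps)
  then show ?thesis by (rule ideal.one_imp_carrier[OF J])
qed

lemma one_notin_max_power: "\<one>\<^bsub>R\<^esub> \<notin> max_power 1"
  by (simp add: quot_one quot_mem_max_power mem_order_ideal_1)

lemma the_maximalideal: "(THE M. maximalideal M R) = max_power 1"
proof (rule the_equality)
  show "maximalideal (max_power 1) R"
  proof (rule maximalidealI[OF ideal_max_power_1])
    show "carrier R \<noteq> max_power 1" using one_notin_max_power R.one_closed by metis
    show "J = max_power 1 \<or> J = carrier R"
      if "ideal J R" "max_power 1 \<subseteq> J" "J \<subseteq> carrier R" for J
      using that not_in_max_power_imp_ideal_carrier[of J] by blast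
  qed
next
  fix M assume M: "maximalideal M R"
  then interpret M: maximalideal M R .
  have "M \<subseteq> max_power 1"
    using not_in_max_power_imp_ideal_carrier[OF M.ideal_axioms] M.I_notcarr by blast
  with M.I_maximal[OF ideal_max_power_1] ideal.Icarr[OF ideal_max_power_1]
    one_notin_max_power R.one_closed
  show "M = max_power 1" by blast
qed


lemma quot_add_same:
  assumes "p \<in> polys N" "p' \<in> polys N" "q \<in> units0"
  shows "quot p q \<oplus>\<^bsub>R\<^esub> quot p' q = quot (p + p') q"
proof -
  have "quot p q \<oplus>\<^bsub>R\<^esub> quot p' q = quot (q * p + q * p') (q * q)"
    using assms by (simp add: quot_simps)
  also have "\<dots> = quot (p + p') q"
    using assms by (intro quot_eqI) (auto simp: algebra_simps vanishing_ideal_def)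
  finally show ?thesis .
qed

lemma max_power_add:
  assumes "x \<in> max_power k" "y \<in> max_power k"
  shows "x \<oplus>\<^bsub>R\<^esub> y \<in> max_power k"
proof -
  from assms obtain p q p' q' where x: "p \<in> order_ideal k" "q \<in> units0" "x = quot p q"
    and y: "p' \<in> order_ideal k" "q' \<in> units0" "y = quot p' q'"
    unfolding max_power_def by blast
  have "q' * p + q * p' \<in> order_ideal k"
    using x y by (intro order_ideal_add order_ideal_lmult) simp_all
  with x y show ?thesis
    by (simp add: order_ideal_polys quot_simps quot_mem_max_power)
qed

text \<open>A monomial of degree greater than \<open>k\<close> is the product of a monomial of degree at least \<open>k\<close>
  and a variable, so the elements of order greater than \<open>k\<close> form the product of the ideal of the elements of
  order at least \<open>k\<close> and the maximal ideal.\<close>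

lemma ideal_prod_max_power:
  assumes k: "ideal (max_power k) R"
  shows "ideal_prod R (max_power k) (max_power 1) = max_power (Suc k)"
proof
  show "ideal_prod R (max_power k) (max_power 1) \<subseteq> max_power (Suc k)"
  proof
    fix x assume "x \<in> ideal_prod R (max_power k) (max_power 1)"
    then show "x \<in> max_power (Suc k)"
    proof induction
      case (prod i j)
      then obtain p q p' q' where x: "p \<in> order_ideal k" "q \<in> units0" "i = quot p q"
        and y: "p' \<in> order_ideal 1" "q' \<in> units0" "j = quot p' q'"
        unfolding max_power_def by blast
      have "p * p' \<in> order_ideal (Suc k)"
        using order_ideal_mult[OF x(1) y(1)] by simp
      with x y show ?case
        by (simp add: order_ideal_polys[OF x(1)] order_ideal_polys[OF y(1)] quot_simps quot_mem_max_power)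
    next
      case (sum s1 s2)
      then show ?case by (intro max_power_add)
    qed
  qed
next
  define J where "J = ideal_prod R (max_power k) (max_power 1)"
  have J: "ideal J R"
    unfolding J_def by (rule R.ideal_prod_is_ideal[OF k ideal_max_power_1])
  have single: "quot (Poly_Mapping.single m c) q \<in> J"
    if m: "m \<in> monoms N" "Suc k \<le> monom_deg m" and q: "q \<in> units0" for m c q
  proof -
    from m(2) have "m \<noteq> 0" by (intro notI) simp
    with m(1) obtain m' i where m': "m' \<in> monoms N" and iN: "i < N"
      and m_eq: "m = m' + Poly_Mapping.single i 1" by (metis monom_split)
    have "k \<le> monom_deg m'" using m(2) by (simp add: m_eq monom_deg_add)
    with m' have 1: "Poly_Mapping.single m' c \<in> order_ideal k"
      by (simp add: order_ideal_def hom_part_single)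
    have 2: "Poly_Mapping.single (Poly_Mapping.single i 1) 1 \<in> order_ideal 1"
      using iN by (simp add: order_ideal_def hom_part_single)
    have "quot (Poly_Mapping.single m' c) q \<otimes>\<^bsub>R\<^esub> quot (Poly_Mapping.single (Poly_Mapping.single i 1) 1) 1 \<in> J"
      unfolding J_def
      using 1 2 q m' iN by (intro ideal_prod.prod) (simp_all add: quot_mem_max_power)
    also have "quot (Poly_Mapping.single m' c) q \<otimes>\<^bsub>R\<^esub> quot (Poly_Mapping.single (Poly_Mapping.single i 1) 1) 1
        = quot (Poly_Mapping.single m c) q"
      using m' iN q by (simp add: quot_simps mult_single m_eq)
    finally show ?thesis .
  qed
  show "max_power (Suc k) \<subseteq> J"
  proof
    fix x assume "x \<in> max_power (Suc k)"
    then obtain p q where p: "p \<in> order_ideal (Suc k)" and q: "q \<in> units0" and x: "x = quot p q"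
      unfolding max_power_def by blast
    note pN = order_ideal_polys[OF p]
    let ?t = "\<lambda>m. Poly_Mapping.single m (Poly_Mapping.lookup p m)"
    define high where "high = (\<Sum>m\<in>{m \<in> Poly_Mapping.keys p. \<not> monom_deg m < Suc k}. ?t m)"
    have tN: "?t m \<in> polys N" if "m \<in> Poly_Mapping.keys p" for m
      using pN that by (intro polys_single) (auto simp: polys_iff)
    have p_eq: "p = low_part (Suc k) p + high"
      unfolding low_part_def high_def
      by (subst (1) cpoly_sum_singles, subst sum.union_disjoint[symmetric]) (auto intro: sum.cong)
    have highN: "high \<in> polys N"
      unfolding high_def using tN by (intro polys_sum) simp
    have lowN: "low_part (Suc k) p \<in> polys N" using pN by (rule low_part_polys)
    \<comment> \<open>The part of low degree vanishes on \<open>A\<close>, hence is zero in the local ring.\<close>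
    have low_I: "low_part (Suc k) p \<in> I"
      using lowN p by (simp add: vanishing_ideal_def cpoly_eval_low_part order_ideal_def)
    have "quot (\<Sum>m\<in>F. ?t m) q \<in> J"
      if "finite F" "F \<subseteq> {m \<in> Poly_Mapping.keys p. \<not> monom_deg m < Suc k}" for F
      using that
    proof (induction F rule: finite_induct)
      case empty
      have "quot 0 q = \<zero>\<^bsub>R\<^esub>"
        unfolding quot_zero using q by (intro quot_eqI) (auto simp: vanishing_ideal_def)
      then show ?case
        using J by (simp add: additive_subgroup.zero_closed ideal.axioms(1))
    next
      case (insert m F)
      have "quot (?t m) q \<in> J"
        using insert.prems pN q by (intro single) (auto simp: polys_iff)
      moreover have "quot (\<Sum>m\<in>F. ?t m) q \<in> J" using insert by simp
      moreover have "quot (?t m + (\<Sum>m\<in>F. ?t m)) q = quot (?t m) q \<oplus>\<^bsub>R\<^esub> quot (\<Sum>m\<in>F. ?t m) q"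
        using insert.prems tN q by (intro quot_add_same[symmetric] polys_sum) auto
      ultimately show ?case
        using insert.hyps additive_subgroup.a_closed[OF ideal.axioms(1)[OF J]] by simp
    qed
    from this[of "{m \<in> Poly_Mapping.keys p. \<not> monom_deg m < Suc k}"]
    have "quot high q \<in> J" by (simp add: high_def)
    moreover have "quot p q = quot high q"
    proof (rule quot_eqI)
      have "q * p - q * high = q * low_part (Suc k) p"
        by (subst (1) p_eq) (simp add: algebra_simps)
      with low_I q show "q * p - q * high \<in> I"
        by (simp add: vanishing_ideal_def)
    qed (use pN highN q in simp_all)
    ultimately show "x \<in> J" by (simp add: x)
  qed
qed

lemma max_power_eq_power:
  "ideal (max_power k) R \<and> max_power 1 [^]\<^bsub>ideals_set R\<^esub> k = max_power k"
proof (induction k)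
  case 0
  have "max_power 1 [^]\<^bsub>ideals_set R\<^esub> (0::nat) = \<one>\<^bsub>ideals_set R\<^esub>"
    by (rule Group.nat_pow_0)
  also have "\<dots> = max_power 0" unfolding max_power_0 ideals_set_def by simp
  finally show ?case using R.oneideal unfolding max_power_0 by (rule conjI[rotated])
next
  case (Suc k)
  then have k: "ideal (max_power k) R"
    and pow: "max_power 1 [^]\<^bsub>ideals_set R\<^esub> k = max_power k" by (rule conjunct1, rule conjunct2)
  have "max_power 1 [^]\<^bsub>ideals_set R\<^esub> Suc k = max_power k \<otimes>\<^bsub>ideals_set R\<^esub> max_power 1"
    unfolding Group.nat_pow_Suc pow ..
  also have "\<dots> = max_power (Suc k)"
    unfolding ideal_prod_max_power[OF k, symmetric] ideals_set_def by simp
  finally show ?case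
    using R.ideal_prod_is_ideal[OF k ideal_max_power_1] unfolding ideal_prod_max_power[OF k]
    by (rule conjI[rotated])
qed

lemmas ideal_max_power = max_power_eq_power[THEN conjunct1]

text \<open>The residue class of \<open>p / 1\<close> modulo the \<open>k\<close>-th power of the maximal ideal.\<close>

definition residue :: "nat \<Rightarrow> cpoly \<Rightarrow> (cpoly set \<times> cpoly set) set set" where
  "residue k p = max_power k +>\<^bsub>R\<^esub> quot p 1"

lemma residue_hom: "ring_hom_ring P (R Quot max_power k) (residue k)"
proof (rule ring_hom_ringI2)
  have "(\<lambda>p. quot p 1) \<in> ring_hom P R"
    by (rule ring_hom_memI) (simp_all only: poly_ring_simps quot_closed units0_1 quot_one quot_simps,
        simp_all)
  moreover have "(+>\<^bsub>R\<^esub>) (max_power k) \<in> ring_hom R (R Quot max_power k)"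
    by (rule ideal.rcos_ring_hom[OF ideal_max_power])
  ultimately have "(+>\<^bsub>R\<^esub>) (max_power k) \<circ> (\<lambda>p. quot p 1) \<in> ring_hom P (R Quot max_power k)"
    by (rule ring_hom_trans)
  then show "residue k \<in> ring_hom P (R Quot max_power k)"
    by (simp add: residue_def[abs_def] comp_def)
  show "ring (R Quot max_power k)"
    by (rule ideal.quotient_is_ring[OF ideal_max_power])
qed (rule P.ring_axioms)

lemma residue_kernel: "a_kernel P (R Quot max_power k) (residue k) = order_ideal k"
proof -
  have "residue k p = \<zero>\<^bsub>R Quot max_power k\<^esub> \<longleftrightarrow> p \<in> order_ideal k" if p: "p \<in> polys N" for p
  proof -
    have M: "ideal (max_power k) R" by (rule ideal_max_power)
    then interpret M: ideal "max_power k" R .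
    have "residue k p = \<zero>\<^bsub>R Quot max_power k\<^esub> \<longleftrightarrow> quot p 1 \<in> max_power k"
      using M.a_rcos_const[of "quot p 1"] M.a_rcos_self[of "quot p 1"] p
      by (auto simp: residue_def FactRing_def)
    with p show ?thesis by (simp add: quot_mem_max_power)
  qed
  then show ?thesis
    unfolding a_kernel_def' poly_ring_simps using order_ideal_polys by blast
qed

text \<open>Modulo a power of the maximal ideal, the inverse of a polynomial \<open>c (1 - z)\<close> with
  \<open>c \<noteq> 0\<close> and \<open>z\<close> in the maximal ideal is a partial sum of the geometric series.\<close>

lemma residue_surj: "residue k ` carrier P = carrier (R Quot max_power k)"
proof
  show "residue k ` carrier P \<subseteq> carrier (R Quot max_power k)"
    using ring_hom_closed[OF ring_hom_ring.homh[OF residue_hom[of k]]] by (intro image_subsetI)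
  show "carrier (R Quot max_power k) \<subseteq> residue k ` carrier P"
  proof
    have M: "ideal (max_power k) R" by (rule ideal_max_power)
    then interpret M: ideal "max_power k" R .
    fix X assume "X \<in> carrier (R Quot max_power k)"
    then obtain x where "x \<in> carrier R" and X: "X = max_power k +>\<^bsub>R\<^esub> x"
      unfolding FactRing_def A_RCOSETS_def' by auto
    then obtain p q where p: "p \<in> polys N" and q: "q \<in> units0" and x: "x = quot p q"
      by (elim carrier_RE)
    define c where "c = cpoly_eval q origin"
    have c: "c \<noteq> 0" using units0_nonzero[OF q] by (simp add: c_def)
    define e where "e = (Poly_Mapping.single 0 (inverse c) :: cpoly)"
    have e: "e \<in> polys N" "cpoly_eval e origin = inverse c" by (simp_all add: e_def)
    define z where "z = 1 - e * q"
    have z: "z \<in> order_ideal 1"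
      using e q c by (simp add: z_def mem_order_ideal_1 c_def)
    then have zN: "z \<in> polys N" by (rule order_ideal_polys)
    define s where "s = e * (\<Sum>i<k. z ^ i)"
    have s: "s \<in> polys N" unfolding s_def using e zN by (intro polys_mult polys_sum polys_power)
    have "q * s = (1 - z) * (\<Sum>i<k. z ^ i)" by (simp add: s_def z_def algebra_simps)
    also have "\<dots> = 1 - z ^ k" by (simp add: one_diff_power_eq)
    finally have qs: "q * s = 1 - z ^ k" .
    have "quot p q \<ominus>\<^bsub>R\<^esub> quot (p * s) 1 = quot (p - q * (p * s)) q"
      using p q s by (simp add: R.minus_eq quot_minus quot_simps)
    also have "p - q * (p * s) = p * z ^ k"
      using qs by (simp add: mult.left_commute[of q p] right_diff_distrib)
    finally have "quot p q \<ominus>\<^bsub>R\<^esub> quot (p * s) 1 \<in> max_power k"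
      using p q zN order_ideal_lmult[OF order_ideal_power[OF z] p, of k] by (simp add: quot_mem_max_power)
    then have "X = residue k (p * s)"
      unfolding X x residue_def
      using R.quotient_eq_iff_same_a_r_cos[OF M, of "quot p q" "quot (p * s) 1"] p q s by simp
    then show "X \<in> residue k ` carrier P" using p s by simp
  qed
qed

text \<open>The length in the definition of the multiplicity, in terms of the polynomial ring.\<close>

theorem ring_length_local_ring_quotient:
  "ring_length (R Quot (THE M. maximalideal M R) [^]\<^bsub>ideals_set R\<^esub> k)
     = chain_length {W. ideal W P \<and> order_ideal k \<subseteq> W}"
  using ring_hom_ring.ring_length_surj_image[OF residue_hom residue_surj, of k] max_power_eq_power[of k]
  by (simp add: the_maximalideal residue_kernel)

end

section \<open>Cones that are closed under coordinatewise multiplication\<close>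

interpretation fun_space: vector_space "\<lambda>(c::complex) (f::'a \<Rightarrow> complex) x. c * f x"
  by unfold_locales (auto simp: fun_eq_iff algebra_simps)

lemma fun_space_sum_apply: "(\<Sum>v\<in>t. (\<lambda>x. u v * v x)) y = (\<Sum>v\<in>t. u v * (v y :: complex))"
  by (induction t rule: infinite_finite_induct) simp_all

text \<open>Dedekind: distinct nonzero multiplicative functions are linearly independent.\<close>

lemma multiplicative_independent_aux:
  fixes op :: "'a \<Rightarrow> 'a \<Rightarrow> 'a" and u :: "('a \<Rightarrow> complex) \<Rightarrow> complex"
  assumes "finite t"
    and "\<And>f. f \<in> t \<Longrightarrow> f \<noteq> 0"
    and "\<And>f x y. f \<in> t \<Longrightarrow> f (op x y) = f x * f y"
    and "\<And>x. (\<Sum>f\<in>t. u f * f x) = 0"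
  shows "\<forall>f\<in>t. u f = 0"
  using assms
proof (induction t arbitrary: u rule: finite_induct)
  case (insert g t)
  have sum0: "u g * g x + (\<Sum>f\<in>t. u f * f x) = 0" for x
    using insert.prems(3)[of x] insert.hyps by simp
  \<comment> \<open>Substitute \<open>op a x\<close> for \<open>x\<close> and subtract \<open>g a\<close> times the relation: the term with \<open>g\<close> drops out.\<close>
  have "u f * (f a - g a) = 0" if "f \<in> t" for f a
  proof -
    have "\<forall>f\<in>t. u f * (f a - g a) = 0"
    proof (rule insert.IH)
      fix x
      have "(\<Sum>f\<in>t. u f * (f a - g a) * f x)
          = (\<Sum>f\<in>t. u f * f (op a x)) - g a * (\<Sum>f\<in>t. u f * f x)"
        unfolding sum_distrib_left sum_subtractf[symmetric]
      proof (intro sum.cong refl)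
        fix f assume "f \<in> t"
        then have "f (op a x) = f a * f x" using insert.prems(2) by simp
        then show "u f * (f a - g a) * f x = u f * f (op a x) - g a * (u f * f x)"
          by (simp add: algebra_simps)
      qed
      also have "\<dots> = - (u g * g (op a x)) + g a * (u g * g x)"
        using sum0[of x] sum0[of "op a x"] by (simp add: add_eq_0_iff)
      also have "\<dots> = 0" using insert.prems(2)[of g a x] by simp
      finally show "(\<Sum>f\<in>t. u f * (f a - g a) * f x) = 0" .
    qed (use insert.prems in auto)
    with that show ?thesis by blast
  qed
  moreover have "\<exists>a. f a \<noteq> g a" if "f \<in> t" for f
    using that insert.hyps(2) by (metis ext)
  ultimately have t: "u f = 0" if "f \<in> t" for f
    using that by (metis mult_eq_0_iff right_minus_eq)
  obtain x where "g x \<noteq> 0"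
    using insert.prems(1)[of g] by (auto simp: fun_eq_iff)
  with sum0[of x] t have "u g = 0" by simp
  with t show ?case by simp
qed simp

lemma multiplicative_independent:
  fixes op :: "'a \<Rightarrow> 'a \<Rightarrow> 'a"
  assumes "\<And>f. f \<in> S \<Longrightarrow> f \<noteq> 0"
    and "\<And>f x y. f \<in> S \<Longrightarrow> f (op x y) = f x * f y"
  shows "fun_space.independent S"
  unfolding fun_space.dependent_explicit
proof (intro notI, elim exE conjE bexE)
  fix t u v
  assume t: "finite t" "t \<subseteq> S" and sum0: "(\<Sum>v\<in>t. (\<lambda>x. u v * v x)) = 0" and v: "v \<in> t" "u v \<noteq> 0"
  have "(\<Sum>f\<in>t. u f * f x) = 0" for x
    using fun_space_sum_apply[of u t x] sum0 by simp
  with multiplicative_independent_aux[of t op u] t assms v show False by blast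
qed

lemma finite_monoms_deg_less: "finite {m \<in> monoms N. monom_deg m < k}"
proof -
  have "Poly_Mapping.lookup ` {m \<in> monoms N. monom_deg m < k}
      \<subseteq> {f. \<forall>i. (i \<in> {..<N} \<longrightarrow> f i \<in> {..<k}) \<and> (i \<notin> {..<N} \<longrightarrow> f i = 0)}"
  proof (intro image_subsetI CollectI allI conjI impI)
    fix m i assume m: "m \<in> {m \<in> monoms N. monom_deg m < k}"
    show "Poly_Mapping.lookup m i \<in> {..<k}" if "i \<in> {..<N}"
    proof (cases "i \<in> Poly_Mapping.keys m")
      case True
      then have "Poly_Mapping.lookup m i \<le> monom_deg m"
        unfolding monom_deg_def by (intro member_le_sum) auto
      with m show ?thesis by simp
    next
      case False
      with m show ?thesis by (auto simp: in_keys_iff)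
    qed
    show "Poly_Mapping.lookup m i = 0" if "i \<notin> {..<N}"
      using that m by (auto simp: monoms_def in_keys_iff)
  qed
  moreover have "finite {f. \<forall>i. (i \<in> {..<N} \<longrightarrow> f i \<in> {..<k}) \<and> (i \<notin> {..<N} \<longrightarrow> f i = (0::nat))}"
    by (rule finite_set_of_finite_funs) simp_all
  ultimately have "finite (Poly_Mapping.lookup ` {m \<in> monoms N. monom_deg m < k})"
    by (rule finite_subset)
  then show ?thesis
    by (rule finite_imageD) (auto intro: inj_onI poly_mapping_eqI)
qed

text \<open>A parametrized cone \<open>A\<close> that is closed under coordinatewise multiplication, where \<open>op\<close> is the
  corresponding operation on the parameters. Functions on \<open>A\<close> are treated as functions of the parameters.\<close>

locale toric_cone =
  fixes N :: nat and \<Phi> :: "'d \<Rightarrow> nat \<Rightarrow> complex" and op :: "'d \<Rightarrow> 'd \<Rightarrow> 'd"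
  assumes \<Phi>_space: "\<Phi> x \<in> complex_space N"
    and \<Phi>_op: "\<Phi> (op x y) = (\<lambda>i. \<Phi> x i * \<Phi> y i)"
    and \<Phi>_scale: "\<exists>z. \<Phi> z = (\<lambda>i. t * \<Phi> x i)"
begin

abbreviation "A \<equiv> range \<Phi>"

sublocale affine_cone N A
proof
  show "A \<subseteq> complex_space N" using \<Phi>_space by auto
  show "A \<noteq> {}" by simp
  show "(\<lambda>i. t * y i) \<in> A" if y: "y \<in> A" for y t
  proof -
    from y obtain x where "y = \<Phi> x" by blast
    with \<Phi>_scale[of t x] show ?thesis by (metis rangeI)
  qed
qed

text \<open>The function on the parameter space that is given by a monomial in the coordinates, and the
  nonzero functions that arise from monomials of degree \<open>d\<close>, or of degree less than \<open>k\<close>.\<close>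

definition mon_fun :: "(nat \<Rightarrow>\<^sub>0 nat) \<Rightarrow> 'd \<Rightarrow> complex" where
  "mon_fun m = (\<lambda>x. monom_eval m (\<Phi> x))"

definition mon_funs_eq :: "nat \<Rightarrow> ('d \<Rightarrow> complex) set" where
  "mon_funs_eq d = {mon_fun m | m. m \<in> monoms N \<and> monom_deg m = d} - {0}"

definition mon_funs :: "nat \<Rightarrow> ('d \<Rightarrow> complex) set" where
  "mon_funs k = {mon_fun m | m. m \<in> monoms N \<and> monom_deg m < k} - {0}"

lemma mon_funs_UN: "mon_funs k = (\<Union>d<k. mon_funs_eq d)"
  by (auto simp: mon_funs_def mon_funs_eq_def)

lemma finite_mon_funs: "finite (mon_funs k)"
proof -
  have "mon_funs k \<subseteq> mon_fun ` {m \<in> monoms N. monom_deg m < k}"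
    by (auto simp: mon_funs_def)
  then show ?thesis
    using finite_monoms_deg_less by (rule finite_subset[OF _ finite_imageI])
qed

lemma finite_mon_funs_eq: "finite (mon_funs_eq d)"
  by (rule finite_subset[OF _ finite_mon_funs[of "Suc d"]]) (auto simp: mon_funs_UN)

lemma mon_fun_op: "mon_fun m (op x y) = mon_fun m x * mon_fun m y"
  by (simp add: mon_fun_def \<Phi>_op monom_eval_mult)

lemma mon_fun_scale: "\<Phi> z = (\<lambda>i. t * \<Phi> x i) \<Longrightarrow> mon_fun m z = t ^ monom_deg m * mon_fun m x"
  by (simp add: mon_fun_def monom_eval_scale)

lemma independent_mon_funs: "fun_space.independent (mon_funs k)"
  by (rule multiplicative_independent[of _ op]) (auto simp: mon_funs_def mon_fun_op)

lemma disjoint_mon_funs_eq: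
  assumes "d \<noteq> e"
  shows "mon_funs_eq d \<inter> mon_funs_eq e = {}"
proof -
  have no: False if m: "monom_deg m = d" "monom_deg m' = e" "mon_fun m = mon_fun m'" "mon_fun m' \<noteq> 0" for m m'
  proof -
    obtain x where x: "mon_fun m x \<noteq> 0" using m(3,4) by (auto simp: fun_eq_iff)
    \<comment> \<open>Doubling the point multiplies the function by \<open>2\<^sup>d\<close> and by \<open>2\<^sup>e\<close>.\<close>
    obtain z where z: "\<Phi> z = (\<lambda>i. 2 * \<Phi> x i)" using \<Phi>_scale by blast
    have "(2::complex) ^ d * mon_fun m x = 2 ^ e * mon_fun m x"
      using mon_fun_scale[OF z, of m] mon_fun_scale[OF z, of m'] m by auto
    with x have "(2::complex) ^ d = 2 ^ e" by simp
    then have "of_nat (2 ^ d) = (of_nat (2 ^ e) :: complex)" by simp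
    then have "(2::nat) ^ d = 2 ^ e" unfolding of_nat_eq_iff .
    with assms show False by simp
  qed
  show ?thesis
  proof (intro equals0I, elim IntE)
    fix f assume "f \<in> mon_funs_eq d" "f \<in> mon_funs_eq e"
    then obtain m m' where "monom_deg m = d" "f = mon_fun m" "monom_deg m' = e" "f = mon_fun m'" "f \<noteq> 0"
      unfolding mon_funs_eq_def by blast
    with no[of m m'] show False by simp
  qed
qed

lemma card_mon_funs_Suc: "card (mon_funs (Suc k)) = card (mon_funs k) + card (mon_funs_eq k)"
proof -
  have "mon_funs (Suc k) = mon_funs k \<union> mon_funs_eq k"
    by (auto simp: mon_funs_UN lessThan_Suc)
  moreover have "mon_funs k \<inter> mon_funs_eq k = {}"
  proof -
    have "mon_funs_eq d \<inter> mon_funs_eq k = {}" if "d < k" for d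
      using that by (intro disjoint_mon_funs_eq) simp
    then show ?thesis unfolding mon_funs_UN by blast
  qed
  ultimately show ?thesis
    by (simp add: card_Un_disjoint finite_mon_funs finite_mon_funs_eq)
qed

lemma mon_fun_in_span:
  assumes "m \<in> monoms N" "monom_deg m < k"
  shows "mon_fun m \<in> fun_space.span (mon_funs k)"
proof (cases "mon_fun m = 0")
  case True
  then show ?thesis by (simp add: fun_space.span_zero)
next
  case False
  with assms show ?thesis by (intro fun_space.span_base) (auto simp: mon_funs_def)
qed

lemma mon_fun_in_span_eq:
  assumes "m \<in> monoms N"
  shows "mon_fun m \<in> fun_space.span (mon_funs_eq (monom_deg m))"
proof (cases "mon_fun m = 0")
  case True
  then show ?thesis by (simp add: fun_space.span_zero)
next
  case False
  with assms show ?thesis by (intro fun_space.span_base) (auto simp: mon_funs_eq_def)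
qed

lemma combination_in_span:
  assumes "\<And>m. m \<in> F \<Longrightarrow> mon_fun m \<in> fun_space.span S"
  shows "(\<lambda>x. \<Sum>m\<in>F. c m * monom_eval m (\<Phi> x)) \<in> fun_space.span S"
  using assms
proof (induction F rule: infinite_finite_induct)
  case (insert m F)
  have "(\<lambda>x. c m * mon_fun m x) + (\<lambda>x. \<Sum>m\<in>F. c m * monom_eval m (\<Phi> x)) \<in> fun_space.span S"
    using insert by (intro fun_space.span_add fun_space.span_scale) auto
  also have "(\<lambda>x. c m * mon_fun m x) + (\<lambda>x. \<Sum>m\<in>F. c m * monom_eval m (\<Phi> x))
      = (\<lambda>x. \<Sum>m\<in>insert m F. c m * monom_eval m (\<Phi> x))"
    using insert.hyps by (simp add: fun_eq_iff mon_fun_def)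
  finally show ?case .
qed (use fun_space.span_zero in \<open>simp_all add: zero_fun_def\<close>)

lemma independent_family_bound:
  assumes poly: "\<And>i. i < M \<Longrightarrow> p i \<in> polys N"
    and deg: "\<And>i m. i < M \<Longrightarrow> m \<in> Poly_Mapping.keys (p i) \<Longrightarrow> monom_deg m < k"
    and indep: "\<And>g :: nat \<Rightarrow> complex. (\<forall>y\<in>A. (\<Sum>i<M. g i * cpoly_eval (p i) y) = 0) \<Longrightarrow> \<forall>i<M. g i = 0"
  shows "M \<le> card (mon_funs k)"
proof -
  define f where "f i = (\<lambda>x. cpoly_eval (p i) (\<Phi> x))" for i
  have inj: "inj_on f {..<M}"
  proof (rule inj_onI, rule ccontr)
    fix i j assume ij: "i \<in> {..<M}" "j \<in> {..<M}" "f i = f j" "i \<noteq> j"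
    define g where "g l = (if l = i then 1 else if l = j then - 1 else (0::complex))" for l
    have "(\<Sum>l<M. g l * cpoly_eval (p l) (\<Phi> x)) = 0" for x
    proof -
      have "(\<Sum>l<M. g l * cpoly_eval (p l) (\<Phi> x)) = (\<Sum>l\<in>{i, j}. g l * cpoly_eval (p l) (\<Phi> x))"
        using ij by (intro sum.mono_neutral_right) (auto simp: g_def)
      also have "\<dots> = 0" using ij by (simp add: g_def f_def fun_eq_iff)
      finally show ?thesis .
    qed
    then have "g i = 0" using indep[of g] ij by blast
    then show False by (simp add: g_def)
  qed
  have "fun_space.independent (f ` {..<M})"
    unfolding fun_space.dependent_explicit
  proof (intro notI, elim exE conjE bexE)
    fix t u v
    assume t: "finite t" "t \<subseteq> f ` {..<M}" and sum0: "(\<Sum>v\<in>t. (\<lambda>x. u v * v x)) = 0" and v: "v \<in> t" "u v \<noteq> 0"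
    define g where "g i = (if f i \<in> t then u (f i) else 0)" for i
    have "(\<Sum>i<M. g i * cpoly_eval (p i) (\<Phi> x)) = 0" for x
    proof -
      have "(\<Sum>i<M. g i * cpoly_eval (p i) (\<Phi> x)) = (\<Sum>i<M. (if f i \<in> t then u (f i) * f i x else 0))"
        by (intro sum.cong) (auto simp: g_def f_def)
      also have "\<dots> = (\<Sum>v\<in>f ` {..<M}. (if v \<in> t then u v * v x else 0))"
        by (simp add: sum.reindex[OF inj])
      also have "\<dots> = (\<Sum>v\<in>t. u v * v x)"
        using t by (simp add: sum.If_cases Int_absorb1)
      also have "\<dots> = 0" using fun_space_sum_apply[of u t x] sum0 by simp
      finally show ?thesis .
    qed
    then have "\<forall>i<M. g i = 0" using indep[of g] by blast
    moreover from v t obtain i where "i < M" "v = f i" by blast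
    ultimately show False using v by (auto simp: g_def)
  qed
  moreover have "f ` {..<M} \<subseteq> fun_space.span (mon_funs k)"
  proof (rule image_subsetI)
    fix i assume i: "i \<in> {..<M}"
    show "f i \<in> fun_space.span (mon_funs k)"
      unfolding f_def cpoly_eval_monom_eval
      using i poly[of i] deg[of i] by (intro combination_in_span mon_fun_in_span) (auto simp: polys_iff)
  qed
  ultimately have "card (f ` {..<M}) \<le> card (mon_funs k)"
    using fun_space.independent_span_bound[OF finite_mon_funs] by blast
  then show ?thesis by (simp add: card_image[OF inj])
qed

text \<open>The restriction to \<open>A\<close> of the sum of the homogeneous parts of degree less than \<open>k\<close>.\<close>

definition trunc :: "nat \<Rightarrow> cpoly \<Rightarrow> 'd \<Rightarrow> complex" where
  "trunc k p = (\<lambda>x. \<Sum>d<k. hom_part d p (\<Phi> x))"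

lemma trunc_add: "trunc k (p + q) = trunc k p + trunc k q"
  by (simp add: trunc_def fun_eq_iff sum.distrib)

lemma trunc_diff: "trunc k (p - q) = trunc k p - trunc k q"
  by (simp add: trunc_def fun_eq_iff sum_subtractf)

lemma trunc_scale: "trunc k (Poly_Mapping.single 0 c * p) = (\<lambda>x. c * trunc k p x)"
proof -
  have "hom_part d (Poly_Mapping.single 0 c * p) y = c * hom_part d p y" for d y
  proof -
    have "hom_part d (Poly_Mapping.single 0 c * p) y = (\<Sum>i\<in>{0}. hom_part i (Poly_Mapping.single 0 c) y * hom_part (d - i) p y)"
      unfolding hom_part_mult by (intro sum.mono_neutral_right) (auto simp: hom_part_single)
    then show ?thesis by (simp add: hom_part_single)
  qed
  then show ?thesis by (simp add: trunc_def fun_eq_iff sum_distrib_left)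
qed

lemma trunc_in_span: "p \<in> polys N \<Longrightarrow> trunc k p \<in> fun_space.span (mon_funs k)"
proof -
  assume p: "p \<in> polys N"
  have "trunc k p = (\<lambda>x. \<Sum>m\<in>{m \<in> Poly_Mapping.keys p. monom_deg m < k}. Poly_Mapping.lookup p m * monom_eval m (\<Phi> x))"
    by (simp add: trunc_def fun_eq_iff cpoly_eval_low_part[symmetric] low_part_def cpoly_eval_sum)
  also have "\<dots> \<in> fun_space.span (mon_funs k)"
    using p by (intro combination_in_span mon_fun_in_span) (auto simp: polys_iff)
  finally show ?thesis .
qed

lemma trunc_eq_0:
  assumes p: "p \<in> polys N" and 0: "trunc k p = 0"
  shows "p \<in> order_ideal k"
proof -
  have "hom_part d p (\<Phi> x) = 0" if d: "d < k" for d x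
  proof -
    define q where "q = (\<Sum>d<k. monom (hom_part d p (\<Phi> x)) d)"
    have "poly q t = poly 0 t" for t
    proof -
      obtain z where z: "\<Phi> z = (\<lambda>i. t * \<Phi> x i)" using \<Phi>_scale by blast
      have "poly q t = (\<Sum>d<k. hom_part d p (\<Phi> z))"
        by (simp add: q_def poly_sum poly_monom z hom_part_scale mult.commute)
      also have "\<dots> = trunc k p z" by (simp add: trunc_def)
      finally show ?thesis by (simp add: 0)
    qed
    then have "q = 0" by (rule poly_eq_if_same_values)
    moreover have "coeff q d = hom_part d p (\<Phi> x)"
      using d by (simp add: q_def coeff_sum)
    ultimately show ?thesis by simp
  qed
  with p show ?thesis by (simp add: order_ideal_def)
qed

text \<open>A chain of ideals above \<open>order_ideal k\<close> gives linearly independent truncations: choose a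
  polynomial in each ideal outside of the preceding one.\<close>

lemma ideal_chain_bound:
  assumes c: "\<forall>i\<le>l. ideal (c i) P \<and> order_ideal k \<subseteq> c i" and strict: "\<forall>i<l. c i \<subset> c (Suc i)"
  shows "l \<le> card (mon_funs k)"
proof -
  have "\<exists>p. p \<in> c (Suc i) \<and> p \<notin> c i" if "i < l" for i
    using strict that by blast
  then obtain p where p: "\<And>i. i < l \<Longrightarrow> p i \<in> c (Suc i) \<and> p i \<notin> c i" by metis
  have closed: "q \<in> polys N" "q + q' \<in> c i" "Poly_Mapping.single 0 a * q \<in> c i"
    if "i \<le> l" "q \<in> c i" "q' \<in> c i" for i q q' a
    using c that unfolding ideal_poly_ring_iff by (blast, blast, simp)
  have zero: "0 \<in> c i" if "i \<le> l" for i
    using c that unfolding ideal_poly_ring_iff by blast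
  have mono: "c i \<subseteq> c j" if "i \<le> j" "j \<le> l" for i j
    using that
  proof (induction j rule: dec_induct)
    case (step n)
    then have "c i \<subseteq> c n" "c n \<subset> c (Suc n)" using strict by simp_all
    then show ?case by blast
  qed simp
  have "fun_space.independent ((\<lambda>i. trunc k (p i)) ` {..<j}) \<and> card ((\<lambda>i. trunc k (p i)) ` {..<j}) = j"
    if "j \<le> l" for j
    using that
  proof (induction j)
    case 0
    then show ?case by (simp add: fun_space.independent_empty)
  next
    case (Suc j)
    define U where "U = trunc k ` c j"
    have "fun_space.subspace U"
      unfolding fun_space.subspace_def
    proof (intro conjI ballI allI)
      have "trunc k 0 = 0" by (simp add: trunc_def fun_eq_iff)
      then show "0 \<in> U" unfolding U_def using zero[of j] Suc.prems by (metis Suc_leD imageI)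
      show "f + g \<in> U" if fg: "f \<in> U" "g \<in> U" for f g
      proof -
        from fg obtain q q' where q: "q \<in> c j" "q' \<in> c j" "f = trunc k q" "g = trunc k q'"
          unfolding U_def by blast
        then have "q + q' \<in> c j" using closed(2)[of j q q'] Suc.prems by simp
        then show ?thesis unfolding q trunc_add[symmetric] U_def by (rule imageI)
      qed
      show "(\<lambda>x. a * f x) \<in> U" if f: "f \<in> U" for f a
      proof -
        from f obtain q where q: "q \<in> c j" "f = trunc k q"
          unfolding U_def by blast
        then have "Poly_Mapping.single 0 a * q \<in> c j" using closed(3)[of j q q a] Suc.prems by simp
        then show ?thesis unfolding q trunc_scale[symmetric] U_def by (rule imageI)
      qed
    qed
    moreover have "(\<lambda>i. trunc k (p i)) ` {..<j} \<subseteq> U"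
    proof (rule image_subsetI)
      fix i assume "i \<in> {..<j}"
      then have "p i \<in> c (Suc i)" "c (Suc i) \<subseteq> c j" using p[of i] mono[of "Suc i" j] Suc.prems by simp_all
      then show "trunc k (p i) \<in> U" unfolding U_def by blast
    qed
    ultimately have span: "fun_space.span ((\<lambda>i. trunc k (p i)) ` {..<j}) \<subseteq> U"
      by (rule fun_space.span_minimal[rotated])
    have "trunc k (p j) \<notin> U"
    proof
      assume "trunc k (p j) \<in> U"
      then obtain q where q: "q \<in> c j" "trunc k (p j) = trunc k q" unfolding U_def by blast
      have pj: "p j \<in> c (Suc j)" "p j \<notin> c j" using p Suc.prems by auto
      have "trunc k (p j - q) = 0" using q by (simp add: trunc_diff)
      moreover have "p j - q \<in> polys N"
        using closed(1)[of "Suc j" "p j"] closed(1)[of j q] pj q Suc.prems by simp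
      ultimately have "p j - q \<in> order_ideal k" by (intro trunc_eq_0)
      moreover have "order_ideal k \<subseteq> c j" using c Suc.prems by simp
      ultimately have "p j - q \<in> c j" by blast
      then have "(p j - q) + q \<in> c j" using closed(2)[of j "p j - q" q] q Suc.prems by simp
      with pj show False by simp
    qed
    with span have notin: "trunc k (p j) \<notin> fun_space.span ((\<lambda>i. trunc k (p i)) ` {..<j})" by blast
    then have "trunc k (p j) \<notin> (\<lambda>i. trunc k (p i)) ` {..<j}" using fun_space.span_superset[of "(\<lambda>i. trunc k (p i)) ` {..<j}"] by (rule contra_subsetD[rotated])
    with Suc notin show ?case
      by (simp add: lessThan_Suc fun_space.independent_insertI)
  qed
  from this[of l] have ind: "fun_space.independent ((\<lambda>i. trunc k (p i)) ` {..<l})"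
    and card: "card ((\<lambda>i. trunc k (p i)) ` {..<l}) = l" by simp_all
  have "p i \<in> polys N" if "i < l" for i
    using p[OF that] closed(1)[of "Suc i" "p i" "p i"] that by simp
  then have "(\<lambda>i. trunc k (p i)) ` {..<l} \<subseteq> fun_space.span (mon_funs k)"
    by (intro image_subsetI trunc_in_span) simp
  with fun_space.independent_span_bound[OF finite_mon_funs ind] card show ?thesis by metis
qed

text \<open>Between two consecutive order ideals, the constants are the only polynomials that act
  nontrivially, so all intermediate vector spaces are ideals.\<close>

lemma hom_part_mult_order_ideal:
  assumes "p \<in> order_ideal k"
  shows "hom_part k (q * p) (\<Phi> x) = cpoly_eval q origin * hom_part k p (\<Phi> x)"
proof -
  have "hom_part k (q * p) (\<Phi> x) = (\<Sum>i\<in>{0}. hom_part i q (\<Phi> x) * hom_part (k - i) p (\<Phi> x))"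
    unfolding hom_part_mult using assms
    by (intro sum.mono_neutral_right) (auto simp: order_ideal_def)
  then show ?thesis by (simp add: hom_part_constant)
qed

text \<open>Adding the monomial functions of degree \<open>k\<close> one by one refines the step from \<open>order_ideal (Suc k)\<close> to
  \<open>order_ideal k\<close>.\<close>

lemma ideal_chain_step:
  "\<exists>c. (\<forall>i\<le>card (mon_funs_eq k). ideal (c i) P) \<and> c 0 = order_ideal (Suc k) \<and>
     c (card (mon_funs_eq k)) = order_ideal k \<and> (\<forall>i<card (mon_funs_eq k). c i \<subset> c (Suc i))"
proof -
  define h where "h = card (mon_funs_eq k)"
  obtain \<tau> where \<tau>: "bij_betw \<tau> {0..<h} (mon_funs_eq k)"
    unfolding h_def using ex_bij_betw_nat_finite[OF finite_mon_funs_eq] by blast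
  define W where "W S = {p \<in> order_ideal k. (\<lambda>x. hom_part k p (\<Phi> x)) \<in> fun_space.span S}" for S
  have ideal: "ideal (W S) P" for S
    unfolding ideal_poly_ring_iff
  proof (intro conjI ballI)
    show "W S \<subseteq> polys N" by (auto simp: W_def order_ideal_polys)
    have "(\<lambda>x. hom_part k 0 (\<Phi> x)) = 0" by (simp add: fun_eq_iff)
    then show "0 \<in> W S"
      using fun_space.span_zero[of S] by (simp add: W_def order_ideal_def)
    fix p assume p: "p \<in> W S"
    show "p + q \<in> W S" if q: "q \<in> W S" for q
    proof -
      have "(\<lambda>x. hom_part k p (\<Phi> x)) + (\<lambda>x. hom_part k q (\<Phi> x)) \<in> fun_space.span S"
        using p q by (intro fun_space.span_add) (auto simp: W_def)
      with p q show ?thesis by (simp add: W_def order_ideal_add plus_fun_def)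
    qed
    show "q * p \<in> W S" if q: "q \<in> polys N" for q
    proof -
      have "(\<lambda>x. cpoly_eval q origin * hom_part k p (\<Phi> x)) \<in> fun_space.span S"
        using p by (intro fun_space.span_scale) (auto simp: W_def)
      with p q show ?thesis by (simp add: W_def order_ideal_lmult hom_part_mult_order_ideal)
    qed
  qed
  have W_empty: "W (\<tau> ` {..<0}) = order_ideal (Suc k)"
    by (auto simp: W_def order_ideal_def fun_eq_iff less_Suc_eq)
  have W_full: "W (\<tau> ` {..<h}) = order_ideal k"
  proof -
    have "(\<lambda>x. hom_part k p (\<Phi> x)) \<in> fun_space.span (mon_funs_eq k)" if "p \<in> order_ideal k" for p
    proof -
      have "p \<in> polys N" using that by (rule order_ideal_polys)
      then show ?thesis
        unfolding hom_part_eq_sum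
        by (intro combination_in_span) (auto simp: polys_iff dest: mon_fun_in_span_eq)
    qed
    moreover have "\<tau> ` {..<h} = mon_funs_eq k"
      using \<tau> by (simp add: bij_betw_def lessThan_atLeast0)
    ultimately show ?thesis by (auto simp: W_def)
  qed
  have strict: "W (\<tau> ` {..<i}) \<subset> W (\<tau> ` {..<Suc i})" if i: "i < h" for i
  proof -
    have sub: "W (\<tau> ` {..<i}) \<subseteq> W (\<tau> ` {..<Suc i})"
    proof -
      have "\<tau> ` {..<i} \<subseteq> \<tau> ` {..<Suc i}" by (intro image_mono) simp
      then show ?thesis
        using fun_space.span_mono[of "\<tau> ` {..<i}" "\<tau> ` {..<Suc i}"] unfolding W_def by blast
    qed
    have \<tau>i: "\<tau> i \<in> mon_funs_eq k" using \<tau> i by (auto simp: bij_betw_def)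
    then obtain m where m: "m \<in> monoms N" "monom_deg m = k" "\<tau> i = mon_fun m"
      by (auto simp: mon_funs_eq_def)
    define p where "p = (Poly_Mapping.single m 1 :: cpoly)"
    have p: "p \<in> order_ideal k" "(\<lambda>x. hom_part k p (\<Phi> x)) = \<tau> i"
      using m by (simp_all add: p_def order_ideal_def hom_part_single mon_fun_def)
    have "\<tau> i \<in> fun_space.span (\<tau> ` {..<Suc i})" by (intro fun_space.span_base) simp
    with p have 1: "p \<in> W (\<tau> ` {..<Suc i})" by (simp add: W_def)
    have "\<tau> ` {..<i} \<subseteq> mon_funs (Suc k) - {\<tau> i}"
    proof (intro image_subsetI)
      fix j assume "j \<in> {..<i}"
      with i \<tau> have "\<tau> j \<in> mon_funs_eq k" "\<tau> j \<noteq> \<tau> i"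
        unfolding bij_betw_def inj_on_def by (force, fastforce)
      then show "\<tau> j \<in> mon_funs (Suc k) - {\<tau> i}" by (auto simp: mon_funs_UN)
    qed
    then have "fun_space.span (\<tau> ` {..<i}) \<subseteq> fun_space.span (mon_funs (Suc k) - {\<tau> i})"
      by (rule fun_space.span_mono)
    moreover have "\<tau> i \<notin> fun_space.span (mon_funs (Suc k) - {\<tau> i})"
      using independent_mon_funs[of "Suc k"] \<tau>i unfolding fun_space.dependent_def mon_funs_UN by blast
    ultimately have "\<tau> i \<notin> fun_space.span (\<tau> ` {..<i})" by blast
    with p have "p \<notin> W (\<tau> ` {..<i})" by (simp add: W_def)
    with sub 1 show ?thesis by blast
  qed
  show ?thesis
    unfolding h_def[symmetric]
    by (rule exI[of _ "\<lambda>i. W (\<tau> ` {..<i})"]) (use ideal W_empty W_full strict in blast)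
qed

lemma ideal_chain_exists:
  "\<exists>c. (\<forall>i\<le>card (mon_funs k). ideal (c i) P) \<and> c 0 = order_ideal k \<and>
     (\<forall>i<card (mon_funs k). c i \<subset> c (Suc i))"
proof (induction k)
  case 0
  have "mon_funs 0 = {}" by (simp add: mon_funs_def)
  moreover have "ideal (order_ideal 0) P" using P.oneideal by (simp add: order_ideal_0)
  ultimately show ?case by (intro exI[of _ "\<lambda>_. order_ideal 0"]) simp
next
  case (Suc k)
  then obtain c where c: "\<forall>i\<le>card (mon_funs k). ideal (c i) P" "c 0 = order_ideal k"
    "\<forall>i<card (mon_funs k). c i \<subset> c (Suc i)" by blast
  define h where "h = card (mon_funs_eq k)"
  obtain d where d: "\<forall>i\<le>h. ideal (d i) P" "d 0 = order_ideal (Suc k)" "d h = order_ideal k"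
    "\<forall>i<h. d i \<subset> d (Suc i)"
    unfolding h_def using ideal_chain_step[of k] by blast
  define b where "b i = (if i \<le> h then d i else c (i - h))" for i
  have "ideal (b i) P" if "i \<le> card (mon_funs (Suc k))" for i
    using that c(1) d(1) by (simp add: b_def card_mon_funs_Suc h_def)
  moreover have "b 0 = order_ideal (Suc k)" by (simp add: b_def d)
  moreover have "b i \<subset> b (Suc i)" if i: "i < card (mon_funs (Suc k))" for i
  proof -
    consider "i < h" | "i = h" | "h < i" by linarith
    then show ?thesis
    proof cases
      case 1
      then show ?thesis using d(4) by (simp add: b_def)
    next
      case 2
      have "c 0 \<subset> c (Suc 0)" using c(3) i 2 by (simp add: card_mon_funs_Suc h_def)
      then show ?thesis using 2 d(3) c(2) by (simp add: b_def)
    next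
      case 3
      then have "c (i - h) \<subset> c (Suc (i - h))" using c(3) i by (simp add: card_mon_funs_Suc h_def)
      then show ?thesis using 3 by (simp add: b_def Suc_diff_le)
    qed
  qed
  ultimately show ?case by blast
qed

text \<open>The Hilbert--Samuel function counts the monomial functions of small degree.\<close>

theorem ring_length_toric:
  "ring_length (R Quot (THE M. maximalideal M R) [^]\<^bsub>ideals_set R\<^esub> k) = enat (card (mon_funs k))"
proof -
  obtain c where c: "\<forall>i\<le>card (mon_funs k). ideal (c i) P" "c 0 = order_ideal k"
    "\<forall>i<card (mon_funs k). c i \<subset> c (Suc i)" using ideal_chain_exists[of k] by blast
  have "c 0 \<subseteq> c i" if "i \<le> card (mon_funs k)" for i
    using that
  proof (induction i)
    case (Suc i)
    then have "c 0 \<subseteq> c i" "c i \<subset> c (Suc i)" using c(3) by simp_all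
    then show ?case by blast
  qed simp
  with c have "chain_length {W. ideal W P \<and> order_ideal k \<subseteq> W} = enat (card (mon_funs k))"
    by (intro chain_length_eqI[where c = c]) (auto intro: ideal_chain_bound)
  then show ?thesis by (simp add: ring_length_local_ring_quotient)
qed

end

section \<open>Irreducible algebraic sets and chains of them\<close>

lemma algebraic_set_subset: "algebraic_set N B \<Longrightarrow> B \<subseteq> complex_space N"
  by (auto simp: algebraic_set_def)

lemma algebraic_set_zeros:
  assumes "algebraic_set N B" "p \<in> polys N"
  shows "algebraic_set N {y \<in> B. cpoly_eval p y = 0}"
proof -
  from assms(1) obtain F where "F \<subseteq> polys N" "B = {x \<in> complex_space N. \<forall>p\<in>F. cpoly_eval p x = 0}"
    by (auto simp: algebraic_set_def)
  with assms(2) show ?thesis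
    unfolding algebraic_set_def by (intro exI[of _ "insert p F"]) auto
qed

lemma algebraic_set_separate:
  assumes "algebraic_set N B" "y \<in> complex_space N" "y \<notin> B"
  obtains f where "f \<in> polys N" "\<And>x. x \<in> B \<Longrightarrow> cpoly_eval f x = 0" "cpoly_eval f y \<noteq> 0"
proof -
  from assms(1) obtain F where F: "F \<subseteq> polys N" "B = {x \<in> complex_space N. \<forall>p\<in>F. cpoly_eval p x = 0}"
    by (auto simp: algebraic_set_def)
  with assms(2,3) obtain f where "f \<in> F" "cpoly_eval f y \<noteq> 0" by blast
  with F show ?thesis by (intro that[of f]) auto
qed

text \<open>The vanishing ideal of a variety is prime.\<close>

lemma variety_prime:
  assumes B: "algebraic_variety N B" and pq: "p \<in> polys N" "q \<in> polys N"
    and 0: "\<And>y. y \<in> B \<Longrightarrow> cpoly_eval p y * cpoly_eval q y = 0"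
  shows "(\<forall>y\<in>B. cpoly_eval p y = 0) \<or> (\<forall>y\<in>B. cpoly_eval q y = 0)"
proof -
  let ?P = "{y \<in> B. cpoly_eval p y = 0}" and ?Q = "{y \<in> B. cpoly_eval q y = 0}"
  have "B = ?P \<union> ?Q" using 0 by auto
  moreover have "algebraic_set N ?P" "algebraic_set N ?Q"
    using B pq by (auto simp: algebraic_variety_def intro: algebraic_set_zeros)
  ultimately have "B = ?P \<or> B = ?Q"
    using B unfolding algebraic_variety_def by blast
  then show ?thesis by blast
qed

text \<open>If neither of two polynomials vanishes identically on a polynomial curve, neither does their product, so
  the curve through a point outside of \<open>B\<close> and a point outside of \<open>C\<close> is not contained in \<open>B \<union> C\<close>.\<close>

lemma algebraic_variety_if_curves:
  assumes A: "algebraic_set N A" "A \<noteq> {}"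
    and curve: "\<And>y z. y \<in> A \<Longrightarrow> z \<in> A \<Longrightarrow> \<exists>h. (\<forall>t. (\<lambda>i. poly (h i) t) \<in> A) \<and>
      (\<lambda>i. poly (h i) 0) = y \<and> (\<lambda>i. poly (h i) 1) = z"
  shows "algebraic_variety N A"
  unfolding algebraic_variety_def
proof (intro conjI A allI impI, rule ccontr)
  fix B C assume BC: "algebraic_set N B \<and> algebraic_set N C \<and> A = B \<union> C" and no: "\<not> (A = B \<or> A = C)"
  then obtain y z where y: "y \<in> A" "y \<notin> B" and z: "z \<in> A" "z \<notin> C" by blast
  obtain f where f: "\<And>x. x \<in> B \<Longrightarrow> cpoly_eval f x = 0" "cpoly_eval f y \<noteq> 0"
    using algebraic_set_separate[OF conjunct1[OF BC] subsetD[OF algebraic_set_subset[OF A(1)] y(1)] y(2)]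
    by metis
  obtain g where g: "\<And>x. x \<in> C \<Longrightarrow> cpoly_eval g x = 0" "cpoly_eval g z \<noteq> 0"
    using algebraic_set_separate[OF conjunct1[OF conjunct2[OF BC]] subsetD[OF algebraic_set_subset[OF A(1)] z(1)] z(2)]
    by metis
  obtain h where h: "\<And>t. (\<lambda>i. poly (h i) t) \<in> A" "(\<lambda>i. poly (h i) 0) = y" "(\<lambda>i. poly (h i) 1) = z"
    using curve[OF y(1) z(1)] by blast
  have "poly (curve_poly h f * curve_poly h g) t = poly 0 t" for t
    using h(1)[of t] BC f(1) g(1) by auto
  then have "curve_poly h f * curve_poly h g = 0" by (rule poly_eq_if_same_values)
  then have "curve_poly h f = 0 \<or> curve_poly h g = 0" by simp
  moreover have "poly (curve_poly h f) 0 \<noteq> 0" "poly (curve_poly h g) 1 \<noteq> 0"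
    using f(2) g(2) h(2,3) by simp_all
  ultimately show False by (metis poly_0)
qed

text \<open>The coordinate subspace spanned by the coordinates in \<open>S\<close>.\<close>

definition coord_subspace :: "nat \<Rightarrow> nat set \<Rightarrow> (nat \<Rightarrow> complex) set" where
  "coord_subspace N S = {x \<in> complex_space N. \<forall>i. i \<notin> S \<longrightarrow> x i = 0}"

lemma algebraic_variety_coord_subspace: "algebraic_variety N (coord_subspace N S)"
proof (rule algebraic_variety_if_curves)
  define F :: "cpoly set" where "F = {Poly_Mapping.single (Poly_Mapping.single i 1) 1 | i. i < N \<and> i \<notin> S}"
  have "F \<subseteq> polys N" by (auto simp: F_def)
  moreover have "coord_subspace N S = {x \<in> complex_space N. \<forall>p\<in>F. cpoly_eval p x = 0}"
  proof (intro equalityI subsetI)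
    show "x \<in> {x \<in> complex_space N. \<forall>p\<in>F. cpoly_eval p x = 0}" if "x \<in> coord_subspace N S" for x
      using that by (auto simp: coord_subspace_def F_def)
    fix x assume "x \<in> {x \<in> complex_space N. \<forall>p\<in>F. cpoly_eval p x = 0}"
    then have x: "x \<in> complex_space N" "\<And>p. p \<in> F \<Longrightarrow> cpoly_eval p x = 0" by auto
    have "x i = 0" if "i \<notin> S" for i
    proof (cases "i < N")
      case True
      then have "cpoly_eval (Poly_Mapping.single (Poly_Mapping.single i 1) 1) x = 0"
        using that by (intro x(2)) (auto simp: F_def)
      then show ?thesis by simp
    next
      case False
      with x(1) show ?thesis by (simp add: complex_space_def)
    qed
    with x(1) show "x \<in> coord_subspace N S" by (simp add: coord_subspace_def)
  qed
  ultimately show "algebraic_set N (coord_subspace N S)"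
    unfolding algebraic_set_def by blast
  have "origin \<in> coord_subspace N S" by (simp add: coord_subspace_def complex_space_def origin_def)
  then show "coord_subspace N S \<noteq> {}" by blast
  fix y z assume yz: "y \<in> coord_subspace N S" "z \<in> coord_subspace N S"
  show "\<exists>h. (\<forall>t. (\<lambda>i. poly (h i) t) \<in> coord_subspace N S) \<and>
      (\<lambda>i. poly (h i) 0) = y \<and> (\<lambda>i. poly (h i) 1) = z"
    using yz by (intro exI[of _ "\<lambda>i. [:y i, z i - y i:]"])
      (auto simp: coord_subspace_def complex_space_def)
qed

subsection \<open>Algebraic independence along chains\<close>

text \<open>The total degree of \<open>p\<close> is at most \<open>d\<close>; the zero polynomial satisfies this for all \<open>d\<close>.\<close>

definition deg_le :: "nat \<Rightarrow> cpoly \<Rightarrow> bool" where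
  "deg_le d p \<longleftrightarrow> (\<forall>m\<in>Poly_Mapping.keys p. monom_deg m \<le> d)"

lemma deg_le_1: "deg_le d 1"
  by (simp add: deg_le_def)

lemma deg_le_mult: "deg_le d p \<Longrightarrow> deg_le e q \<Longrightarrow> deg_le (d + e) (p * q)"
  using keys_mult[of p q] unfolding deg_le_def by (fastforce simp: monom_deg_add intro: add_mono)

lemma deg_le_mono: "deg_le d p \<Longrightarrow> d \<le> e \<Longrightarrow> deg_le e p"
  by (force simp: deg_le_def)

lemma deg_le_power: "deg_le d p \<Longrightarrow> deg_le (d * k) (p ^ k)"
proof (induction k)
  case (Suc k)
  then show ?case using deg_le_mult[of d p "d * k" "p ^ k"] by simp
qed (simp add: deg_le_1)

lemma deg_le_exists: "\<exists>d. deg_le d p"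
  using finite_nat_set_iff_bounded_le[of "monom_deg ` Poly_Mapping.keys p"]
  by (auto simp: deg_le_def)

text \<open>Linear independence of the restrictions of \<open>p 0, \<dots>, p (M - 1)\<close> to \<open>B\<close>.\<close>

definition indep_on :: "(nat \<Rightarrow> complex) set \<Rightarrow> nat \<Rightarrow> (nat \<Rightarrow> cpoly) \<Rightarrow> bool" where
  "indep_on B M p \<longleftrightarrow> (\<forall>g :: nat \<Rightarrow> complex.
     (\<forall>y\<in>B. (\<Sum>i<M. g i * cpoly_eval (p i) y) = 0) \<longrightarrow> (\<forall>i<M. g i = 0))"

lemma sum_lessThan_add:
  fixes f :: "nat \<Rightarrow> 'a::comm_monoid_add"
  shows "(\<Sum>i<a + b. f i) = (\<Sum>i<a. f i) + (\<Sum>i<b. f (a + i))"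
  by (induction b) (simp_all add: add.assoc)

text \<open>If \<open>f\<close> vanishes on \<open>B\<close> but not on the irreducible \<open>B' \<supseteq> B\<close>, then the products
  \<open>p i * f\<^sup>j\<close> are independent on \<open>B'\<close>: restriction to \<open>B\<close> kills all terms with \<open>j > 0\<close>, and a factor
  \<open>f\<close> may be cancelled on \<open>B'\<close>.\<close>

lemma indep_on_step:
  assumes B': "algebraic_variety N B'" and sub: "B \<subseteq> B'"
    and f: "f \<in> polys N" "\<And>y. y \<in> B \<Longrightarrow> cpoly_eval f y = 0" "\<exists>y\<in>B'. cpoly_eval f y \<noteq> 0"
    and p: "\<And>i. i < M \<Longrightarrow> p i \<in> polys N" and M: "M > 0" and indep: "indep_on B M p"
  shows "indep_on B' (M * J) (\<lambda>i. p (i mod M) * f ^ (i div M))"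
proof (induction J)
  case 0
  show ?case by (simp add: indep_on_def)
next
  case (Suc J)
  define q where "q i = p (i mod M) * f ^ (i div M)" for i
  have q: "q (M + i) = f * q i" for i
    using M by (simp add: q_def mult_ac)
  have q0: "q i = p i" if "i < M" for i
    using that by (simp add: q_def)
  have qN: "q i \<in> polys N" for i
    using p M f(1) by (simp add: q_def)
  show ?case
    unfolding indep_on_def q_def[symmetric]
  proof (intro allI impI)
    fix g :: "nat \<Rightarrow> complex" and j
    assume g: "\<forall>y\<in>B'. (\<Sum>i<M * Suc J. g i * cpoly_eval (q i) y) = 0" and j: "j < M * Suc J"
    have split: "(\<Sum>i<M * Suc J. g i * cpoly_eval (q i) y)
        = (\<Sum>i<M. g i * cpoly_eval (p i) y) + cpoly_eval f y * (\<Sum>i<M * J. g (M + i) * cpoly_eval (q i) y)" for y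
      by (simp add: sum_lessThan_add q q0 sum_distrib_left mult_ac)
    have "\<forall>y\<in>B. (\<Sum>i<M. g i * cpoly_eval (p i) y) = 0"
    proof
      fix y assume y: "y \<in> B"
      then have "(\<Sum>i<M * Suc J. g i * cpoly_eval (q i) y) = 0" using g sub by blast
      then show "(\<Sum>i<M. g i * cpoly_eval (p i) y) = 0" unfolding split f(2)[OF y] by simp
    qed
    then have low: "g i = 0" if "i < M" for i
      using indep that unfolding indep_on_def by blast
    define G where "G = (\<Sum>i<M * J. Poly_Mapping.single 0 (g (M + i)) * q i)"
    have G: "G \<in> polys N" unfolding G_def using qN by (intro polys_sum) simp
    have G_eval: "cpoly_eval G y = (\<Sum>i<M * J. g (M + i) * cpoly_eval (q i) y)" for y
      by (simp add: G_def cpoly_eval_sum)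
    have "cpoly_eval f y * cpoly_eval G y = 0" if "y \<in> B'" for y
      using g split[of y] low that by (simp add: G_eval)
    with variety_prime[OF B' f(1) G] f(3) have "\<forall>y\<in>B'. cpoly_eval G y = 0" by blast
    with Suc.IH have high: "g (M + i) = 0" if "i < M * J" for i
      using that unfolding indep_on_def q_def[symmetric] G_eval by (elim allE[of _ "\<lambda>i. g (M + i)"]) simp
    show "g j = 0"
    proof (cases "j < M")
      case False
      then show ?thesis using high[of "j - M"] j by simp
    qed (rule low)
  qed
qed

text \<open>Along a chain of \<open>k\<close> strict inclusions, the products with exponents below \<open>J\<close> of \<open>k\<close> algebraically
  independent polynomials give \<open>J\<^sup>k\<close> linearly independent polynomials of degree linear in \<open>J\<close>.\<close>

lemma chain_indep:
  assumes "\<forall>i\<le>k. algebraic_variety N (c i)" "\<forall>i<k. c i \<subset> c (Suc i)"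
  shows "\<exists>D. \<forall>J>0. \<exists>p. (\<forall>i<J ^ k. p i \<in> polys N \<and> deg_le (D * J) (p i)) \<and> indep_on (c k) (J ^ k) p"
  using assms
proof (induction k)
  case 0
  then have "c 0 \<noteq> {}" by (simp add: algebraic_variety_def)
  then have "indep_on (c 0) 1 (\<lambda>_. 1)" by (auto simp: indep_on_def)
  then show ?case by (auto intro!: exI[of _ "\<lambda>_. 1"] deg_le_1)
next
  case (Suc k)
  then obtain D where D: "\<forall>J>0. \<exists>p. (\<forall>i<J ^ k. p i \<in> polys N \<and> deg_le (D * J) (p i)) \<and> indep_on (c k) (J ^ k) p"
    by auto
  have var: "algebraic_variety N (c k)" "algebraic_variety N (c (Suc k))" and sub: "c k \<subset> c (Suc k)"
    using Suc.prems by simp_all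
  then obtain y where y: "y \<in> c (Suc k)" "y \<notin> c k" by blast
  obtain f where f: "f \<in> polys N" "\<And>x. x \<in> c k \<Longrightarrow> cpoly_eval f x = 0" "cpoly_eval f y \<noteq> 0"
  proof (rule algebraic_set_separate[of N "c k" y])
    show "algebraic_set N (c k)" using var(1) by (simp add: algebraic_variety_def)
    show "y \<in> complex_space N"
      using var(2) y algebraic_set_subset[of N "c (Suc k)"] by (auto simp: algebraic_variety_def)
  qed (use y in auto)
  obtain e where e: "deg_le e f" using deg_le_exists by blast
  show ?case
  proof (intro exI[of _ "D + e"] allI impI)
    fix J :: nat assume J: "J > 0"
    with D obtain p where p: "\<And>i. i < J ^ k \<Longrightarrow> p i \<in> polys N \<and> deg_le (D * J) (p i)"
      and indep: "indep_on (c k) (J ^ k) p" by blast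
    let ?q = "\<lambda>i. p (i mod J ^ k) * f ^ (i div J ^ k)"
    have "indep_on (c (Suc k)) (J ^ k * J) ?q"
      using var(2) sub f y p indep J by (intro indep_on_step[where B = "c k" and N = N]) auto
    moreover have "?q i \<in> polys N \<and> deg_le ((D + e) * J) (?q i)" if "i < J ^ k * J" for i
    proof
      have mod: "i mod J ^ k < J ^ k" using J by simp
      then show "?q i \<in> polys N" using p f(1) by simp
      have "i div J ^ k < J" using that by (simp add: less_mult_imp_div_less mult.commute)
      then have "e * (i div J ^ k) \<le> e * J" by simp
      then have "D * J + e * (i div J ^ k) \<le> (D + e) * J" by (simp add: add_mult_distrib)
      then show "deg_le ((D + e) * J) (?q i)"
        by (rule deg_le_mono[OF deg_le_mult[OF conjunct2[OF p[OF mod]] deg_le_power[OF e]]])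
    qed
    ultimately show "\<exists>p. (\<forall>i<J ^ Suc k. p i \<in> polys N \<and> deg_le ((D + e) * J) (p i)) \<and>
        indep_on (c (Suc k)) (J ^ Suc k) p"
      by (intro exI[of _ ?q]) (simp add: mult.commute)
  qed
qed

text \<open>If the Hilbert function is bounded by a multiple of \<open>K\<^sup>n\<close>, chains of varieties in \<open>A\<close> have at most
  \<open>n\<close> steps.\<close>

lemma (in toric_cone) variety_chain_bound:
  assumes growth: "\<And>K. card (mon_funs K) \<le> a * K ^ n"
    and c: "\<forall>i\<le>k. algebraic_variety N (c i)" "\<forall>i<k. c i \<subset> c (Suc i)" "c k \<subseteq> A"
  shows "k \<le> n"
proof (rule ccontr)
  assume "\<not> k \<le> n"
  obtain D where D: "\<forall>J>0. \<exists>p. (\<forall>i<J ^ k. p i \<in> polys N \<and> deg_le (D * J) (p i)) \<and> indep_on (c k) (J ^ k) p"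
    using chain_indep[OF c(1,2)] ..
  have bound: "J ^ k \<le> a * (D + 1) ^ n * J ^ n" if J: "J > 0" for J
  proof -
    from D J obtain p where p: "\<And>i. i < J ^ k \<Longrightarrow> p i \<in> polys N \<and> deg_le (D * J) (p i)"
      and indep: "indep_on (c k) (J ^ k) p" by blast
    have "J ^ k \<le> card (mon_funs (Suc (D * J)))"
    proof (rule independent_family_bound)
      show "\<forall>i<J ^ k. g i = 0" if "\<forall>y\<in>A. (\<Sum>i<J ^ k. g i * cpoly_eval (p i) y) = 0" for g
        using that indep c(3) unfolding indep_on_def by blast
    qed (use p in \<open>auto simp: deg_le_def less_Suc_eq_le\<close>)
    also have "\<dots> \<le> a * (Suc (D * J)) ^ n" by (rule growth)
    also have "\<dots> \<le> a * ((D + 1) * J) ^ n"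
      using J by (intro mult_le_mono2 power_mono) simp_all
    finally show ?thesis unfolding power_mult_distrib by (simp only: mult.assoc)
  qed
  define J where "J = Suc (a * (D + 1) ^ n)"
  have "J * J ^ n = J ^ Suc n" by simp
  also have "\<dots> \<le> J ^ k" using \<open>\<not> k \<le> n\<close> by (intro power_increasing) (simp_all add: J_def)
  also have "\<dots> \<le> a * (D + 1) ^ n * J ^ n" by (rule bound) (simp add: J_def)
  finally have "J \<le> a * (D + 1) ^ n" by (simp add: J_def)
  then show False by (simp add: J_def)
qed

section \<open>Uniqueness of the Hilbert--Samuel polynomial\<close>

lemma rat_poly_eq_if_eventually_eq:
  fixes p q :: "rat poly"
  assumes "\<forall>\<^sub>F k in sequentially. poly p (of_nat k) = poly q (of_nat k)"
  shows "p = q"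
proof (rule ccontr)
  assume "p \<noteq> q"
  then have "finite {x. poly (p - q) x = 0}" by (intro poly_roots_finite) simp
  moreover obtain K where "\<And>k. k \<ge> K \<Longrightarrow> poly p (of_nat k) = poly q (of_nat k)"
    using assms by (auto simp: eventually_sequentially)
  then have "of_nat ` {K..} \<subseteq> {x. poly (p - q) x = 0}" by auto
  ultimately have "finite (of_nat ` {K..} :: rat set)" by (rule rev_finite_subset)
  then have "finite {K..}" by (rule finite_imageD) (simp add: inj_on_def)
  then show False using infinite_Ici by blast
qed

lemma hilbert_samuel_multiplicity_eqI:
  fixes p :: "rat poly"
  assumes len: "\<And>k. ring_length (R Quot (J [^]\<^bsub>ideals_set R\<^esub> k)) = enat (f k)"
    and p: "\<And>k. poly p (of_nat k) = of_nat (f k)"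
    and lead: "lead_coeff p = of_nat e / fact (Polynomial.degree p)"
  shows "hilbert_samuel_multiplicity R J = e"
  unfolding hilbert_samuel_multiplicity_def
proof (rule the_equality)
  show "\<exists>P :: rat poly. (\<forall>\<^sub>F k in sequentially. \<exists>l. ring_length (R Quot (J [^]\<^bsub>ideals_set R\<^esub> k)) = enat l \<and>
        poly P (of_nat k) = of_nat l) \<and> lead_coeff P = of_nat e / fact (Polynomial.degree P)"
    using lead by (intro exI[of _ p]) (simp add: len p)
next
  fix e' assume "\<exists>P :: rat poly. (\<forall>\<^sub>F k in sequentially. \<exists>l. ring_length (R Quot (J [^]\<^bsub>ideals_set R\<^esub> k)) = enat l \<and>
        poly P (of_nat k) = of_nat l) \<and> lead_coeff P = of_nat e' / fact (Polynomial.degree P)"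
  then obtain P :: "rat poly" where P: "\<forall>\<^sub>F k in sequentially. \<exists>l. enat (f k) = enat l \<and> poly P (of_nat k) = of_nat l"
    and lead': "lead_coeff P = of_nat e' / fact (Polynomial.degree P)"
    by (auto simp: len)
  from P have "\<forall>\<^sub>F k in sequentially. poly P (of_nat k) = poly p (of_nat k)"
    by eventually_elim (auto simp: p)
  then have "P = p" by (rule rat_poly_eq_if_eventually_eq)
  with lead lead' have "(of_nat e' :: rat) = of_nat e" by simp
  then show "e' = e" by simp
qed

section \<open>Cones over rational normal scrolls\<close>

text \<open>The parametrization of the product of the cone over the scroll \<open>S(a, a)\<close> and an affine space of
  dimension \<open>r\<close>. The parameters \<open>x 0, x 1\<close> are homogeneous coordinates of a point \<open>u\<close> of the projective
  line, \<open>x 2, x 3\<close> are the components of \<open>v\<close>, and \<open>x (4 + l)\<close> are the coordinates of the affine factor. The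
  first \<open>off\<close> coordinates are zero. The parameters may be taken from any commutative ring, in
  particular they may be univariate polynomials.\<close>

definition scroll_param :: "nat \<Rightarrow> nat \<Rightarrow> nat \<Rightarrow> (nat \<Rightarrow> 'a::comm_ring_1) \<Rightarrow> nat \<Rightarrow> 'a" where
  "scroll_param a r off x i =
     (if i < off then 0
      else if i < off + Suc a then x 0 ^ (a - (i - off)) * x 1 ^ (i - off) * x 2
      else if i < off + 2 * Suc a then x 0 ^ (a - (i - off - Suc a)) * x 1 ^ (i - off - Suc a) * x 3
      else if i < off + 2 * Suc a + r then x (4 + (i - off - 2 * Suc a))
      else 0)"

text \<open>The cone itself. It lies in complex \<open>N\<close>-space if \<open>off + 2 (a + 1) + r \<le> N\<close>.\<close>

definition scroll :: "nat \<Rightarrow> nat \<Rightarrow> nat \<Rightarrow> (nat \<Rightarrow> complex) set" where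
  "scroll a r off = range (scroll_param a r off)"

lemma scroll_param_simps:
  "i < off \<Longrightarrow> scroll_param a r off x i = 0"
  "k \<le> a \<Longrightarrow> scroll_param a r off x (off + k) = x 0 ^ (a - k) * x 1 ^ k * x 2"
  "k \<le> a \<Longrightarrow> scroll_param a r off x (off + Suc a + k) = x 0 ^ (a - k) * x 1 ^ k * x 3"
  "l < r \<Longrightarrow> scroll_param a r off x (off + 2 * Suc a + l) = x (4 + l)"
  "off + 2 * Suc a + r \<le> i \<Longrightarrow> scroll_param a r off x i = 0"
  by (simp_all add: scroll_param_def)

lemma coordinate_cases:
  fixes i off a r :: nat
  obtains (below) "i < off" | (first) k where "k \<le> a" "i = off + k"
    | (second) k where "k \<le> a" "i = off + Suc a + k"
    | (affine) l where "l < r" "i = off + 2 * Suc a + l"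
    | (above) "off + 2 * Suc a + r \<le> i"
proof -
  consider "i < off" | "off \<le> i" "i < off + Suc a" | "off + Suc a \<le> i" "i < off + 2 * Suc a"
    | "off + 2 * Suc a \<le> i" "i < off + 2 * Suc a + r" | "off + 2 * Suc a + r \<le> i" by linarith
  then show ?thesis
  proof cases
    case 1 then show ?thesis by (rule below)
  next
    case 2 then show ?thesis by (intro first[of "i - off"]) simp_all
  next
    case 3 then show ?thesis by (intro second[of "i - off - Suc a"]) simp_all
  next
    case 4 then show ?thesis by (intro affine[of "i - off - 2 * Suc a"]) simp_all
  next
    case 5 then show ?thesis by (rule above)
  qed
qed

lemma scroll_param_eqI:
  assumes "\<And>i. i < off \<Longrightarrow> y i = 0"
    and "\<And>k. k \<le> a \<Longrightarrow> y (off + k) = x 0 ^ (a - k) * x 1 ^ k * x 2"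
    and "\<And>k. k \<le> a \<Longrightarrow> y (off + Suc a + k) = x 0 ^ (a - k) * x 1 ^ k * x 3"
    and "\<And>l. l < r \<Longrightarrow> y (off + 2 * Suc a + l) = x (4 + l)"
    and "\<And>i. off + 2 * Suc a + r \<le> i \<Longrightarrow> y i = 0"
  shows "scroll_param a r off x = y"
proof
  fix i
  show "scroll_param a r off x i = y i"
    by (rule coordinate_cases[where i = i and off = off and a = a and r = r]) (use assms in \<open>simp_all only: scroll_param_simps\<close>)
qed

lemma scroll_param_mult:
  "scroll_param a r off (\<lambda>i. x i * y i) = (\<lambda>i. scroll_param a r off x i * scroll_param a r off y i)"
  by (rule scroll_param_eqI) (simp_all only: scroll_param_simps power_mult_distrib mult_zero_left, simp_all only: mult_ac)

lemma scroll_param_scale: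
  "scroll_param a r off (\<lambda>i. if i < 2 then x i else t * x i) = (\<lambda>i. t * scroll_param a r off x i)"
  by (rule scroll_param_eqI) (simp_all only: scroll_param_simps mult_zero_right, simp_all add: mult_ac)

lemma poly_scroll_param:
  "poly (scroll_param a r off x i) t = scroll_param a r off (\<lambda>i. poly (x i) t) i"
  by (simp add: scroll_param_def)

lemma scroll_param_space:
  "off + 2 * Suc a + r \<le> N \<Longrightarrow> scroll_param a r off x \<in> complex_space N"
  by (auto simp: complex_space_def scroll_param_def)

lemma toric_cone_scroll:
  assumes "off + 2 * Suc a + r \<le> N"
  shows "toric_cone N (scroll_param a r off) (\<lambda>x y i. x i * y i)"
proof
  show "scroll_param a r off x \<in> complex_space N" for x
    using assms by (rule scroll_param_space)
  show "scroll_param a r off (\<lambda>i. x i * y i) = (\<lambda>i. scroll_param a r off x i * scroll_param a r off y i)"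
    for x y :: "nat \<Rightarrow> complex" by (rule scroll_param_mult)
  show "\<exists>z. scroll_param a r off z = (\<lambda>i. t * scroll_param a r off x i)" for t :: complex and x
    using scroll_param_scale by blast
qed

text \<open>The defining equations are the 2 by 2 minors of the matrix with rows
  \<open>(X\<^sub>0 \<dots> X\<^bsub>a-1\<^esub> Z\<^sub>0 \<dots> Z\<^bsub>a-1\<^esub>)\<close> and \<open>(X\<^sub>1 \<dots> X\<^sub>a Z\<^sub>1 \<dots> Z\<^sub>a)\<close>.\<close>

lemma scroll_eq_minors:
  assumes a: "a \<ge> 1"
  shows "scroll a r off = {y. (\<forall>i. i < off \<or> off + 2 * Suc a + r \<le> i \<longrightarrow> y i = 0) \<and>
    (\<forall>p\<le>1. \<forall>q\<le>1. \<forall>k<a. \<forall>l<a. y (off + p * Suc a + k) * y (off + q * Suc a + Suc l)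
       = y (off + p * Suc a + Suc k) * y (off + q * Suc a + l))}" (is "_ = ?M")
proof (intro equalityI subsetI)
  fix y assume "y \<in> scroll a r off"
  then obtain x where y: "y = scroll_param a r off x" by (auto simp: scroll_def)
  have row: "y (off + p * Suc a + k) = x 0 ^ (a - k) * x 1 ^ k * x (2 + p)" if "p \<le> 1" "k \<le> a" for p k
  proof (cases "p = 0")
    case True
    then show ?thesis using that scroll_param_simps(2)[of k a r off x] by (simp add: y)
  next
    case False
    then have "p = 1" using that by simp
    then show ?thesis using that scroll_param_simps(3)[of k a r off x] by (simp add: y numeral_3_eq_3 numeral_2_eq_2)
  qed
  have "y (off + p * Suc a + k) * y (off + q * Suc a + Suc l) = y (off + p * Suc a + Suc k) * y (off + q * Suc a + l)"
    if "p \<le> 1" "q \<le> 1" "k < a" "l < a" for p q k l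
  proof -
    have "x 0 ^ (a - k) = x 0 * x 0 ^ (a - Suc k)" "x 0 ^ (a - l) = x 0 * x 0 ^ (a - Suc l)"
      using that by (simp_all flip: power_Suc add: Suc_diff_Suc)
    with that show ?thesis by (simp only: row less_imp_le Suc_leI power_Suc mult_ac)
  qed
  then show "y \<in> ?M" by (auto simp: y scroll_param_simps)
next
  fix y assume y: "y \<in> ?M"
  have outside: "y i = 0" if "i < off \<or> off + 2 * Suc a + r \<le> i" for i using y that by blast
  have minor: "y (off + p * Suc a + k) * y (off + q * Suc a + Suc l)
       = y (off + p * Suc a + Suc k) * y (off + q * Suc a + l)"
    if "p \<le> 1" "q \<le> 1" "k < a" "l < a" for p q k l using y that by blast
  define x where "x u0 u1 v0 v1 i = (if i = 0 then u0 else if i = 1 then u1 else if i = 2 then v0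
      else if i = 3 then v1 else y (off + 2 * Suc a + (i - 4)))" for u0 u1 v0 v1 :: complex and i :: nat
  have x: "x u0 u1 v0 v1 0 = u0" "x u0 u1 v0 v1 1 = u1" "x u0 u1 v0 v1 2 = v0" "x u0 u1 v0 v1 3 = v1"
    "x u0 u1 v0 v1 (4 + l) = y (off + 2 * Suc a + l)" for u0 u1 v0 v1 l
    by (simp_all add: x_def)
  \<comment> \<open>If the upper row is nonzero, the lower row is \<open>s\<close> times the upper one and \<open>u = (1, s)\<close>. Otherwise
    \<open>u = (0, 1)\<close>, where \<open>0\<^sup>0 = 1\<close> accounts for the last coordinates.\<close>
  show "y \<in> scroll a r off"
  proof (cases "\<exists>p\<le>1. \<exists>k<a. y (off + p * Suc a + k) \<noteq> 0")
    case True
    then obtain p k where pk: "p \<le> 1" "k < a" "y (off + p * Suc a + k) \<noteq> 0" by blast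
    define s where "s = y (off + p * Suc a + Suc k) / y (off + p * Suc a + k)"
    have step: "y (off + q * Suc a + Suc l) = s * y (off + q * Suc a + l)" if "q \<le> 1" "l < a" for q l
      using minor[OF pk(1) that(1) pk(2) that(2)] pk(3) by (simp add: s_def field_simps)
    have row: "y (off + q * Suc a + l) = s ^ l * y (off + q * Suc a)" if "q \<le> 1" "l \<le> a" for q l
      using that(2)
    proof (induction l)
      case (Suc l)
      then show ?case using step[OF that(1), of l] by simp
    qed simp
    have "scroll_param a r off (x 1 s (y off) (y (off + Suc a))) = y"
    proof (rule scroll_param_eqI)
      fix k assume k: "k \<le> a"
      show "y (off + k) = x 1 s (y off) (y (off + Suc a)) 0 ^ (a - k) * x 1 s (y off) (y (off + Suc a)) 1 ^ k *
          x 1 s (y off) (y (off + Suc a)) 2"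
        using row[of 0 k] k by (simp only: x) simp
      show "y (off + Suc a + k) = x 1 s (y off) (y (off + Suc a)) 0 ^ (a - k) * x 1 s (y off) (y (off + Suc a)) 1 ^ k *
          x 1 s (y off) (y (off + Suc a)) 3"
        using row[of 1 k] k by (simp only: x) simp
    qed (simp_all only: x outside simp_thms)
    then show ?thesis unfolding scroll_def by (metis rangeI)
  next
    case False
    then have zero: "y (off + q * Suc a + l) = 0" if "q \<le> 1" "l < a" for q l using that by blast
    let ?x = "x 0 1 (y (off + a)) (y (off + Suc a + a))"
    have "scroll_param a r off ?x = y"
    proof (rule scroll_param_eqI)
      fix k assume k: "k \<le> a"
      show "y (off + k) = ?x 0 ^ (a - k) * ?x 1 ^ k * ?x 2"
        using zero[of 0 k] k unfolding x by (cases "k = a") simp_all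
      show "y (off + Suc a + k) = ?x 0 ^ (a - k) * ?x 1 ^ k * ?x 3"
        using zero[of 1 k] k unfolding x by (cases "k = a") simp_all
    qed (simp_all only: x outside simp_thms)
    then show ?thesis unfolding scroll_def by (metis rangeI)
  qed
qed

lemma algebraic_set_scroll:
  assumes a: "a \<ge> 1" and N: "off + 2 * Suc a + r \<le> N"
  shows "algebraic_set N (scroll a r off)"
proof -
  define X :: "nat \<Rightarrow> cpoly" where "X i = Poly_Mapping.single (Poly_Mapping.single i 1) 1" for i
  have X_eval: "cpoly_eval (X i) y = y i" for i y by (simp add: X_def)
  have X_polys: "X i \<in> polys N" if "i < N" for i using that by (simp add: X_def)
  define minor where "minor p q k l = X (off + p * Suc a + k) * X (off + q * Suc a + Suc l)
       - X (off + p * Suc a + Suc k) * X (off + q * Suc a + l)" for p q k l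
  define F where "F = X ` {i. i < N \<and> (i < off \<or> off + 2 * Suc a + r \<le> i)} \<union>
      {minor p q k l | p q k l. p \<le> 1 \<and> q \<le> 1 \<and> k < a \<and> l < a}"
  have "F \<subseteq> polys N"
  proof -
    have "off + p * Suc a + k < N" if "p \<le> 1" "k \<le> a" for p k
    proof -
      have "p * Suc a \<le> Suc a" using that(1) by (cases p) simp_all
      then show ?thesis using N that(2) by simp
    qed
    then have "minor p q k l \<in> polys N" if "p \<le> 1" "q \<le> 1" "k < a" "l < a" for p q k l
      unfolding minor_def using that by (intro polys_diff polys_mult X_polys) (simp_all only: less_imp_le Suc_leI)
    then show ?thesis using X_polys unfolding F_def by blast
  qed
  moreover have "scroll a r off = {x \<in> complex_space N. \<forall>p\<in>F. cpoly_eval p x = 0}"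
  proof (intro equalityI subsetI)
    fix y assume "y \<in> scroll a r off"
    moreover from this have "y \<in> complex_space N"
      using N scroll_param_space by (auto simp: scroll_def)
    ultimately show "y \<in> {x \<in> complex_space N. \<forall>p\<in>F. cpoly_eval p x = 0}"
      unfolding scroll_eq_minors[OF a] F_def minor_def by (auto simp: X_eval)
  next
    fix y assume "y \<in> {x \<in> complex_space N. \<forall>p\<in>F. cpoly_eval p x = 0}"
    then have y: "y \<in> complex_space N" "\<And>p. p \<in> F \<Longrightarrow> cpoly_eval p y = 0" by auto
    have "y i = 0" if "i < off \<or> off + 2 * Suc a + r \<le> i" for i
    proof (cases "i < N")
      case True
      with that have "X i \<in> F" by (auto simp: F_def)
      with y(2)[of "X i"] show ?thesis by (simp add: X_eval)
    qed (use y(1) in \<open>simp add: complex_space_def\<close>)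
    moreover have "y (off + p * Suc a + k) * y (off + q * Suc a + Suc l)
       = y (off + p * Suc a + Suc k) * y (off + q * Suc a + l)" if "p \<le> 1" "q \<le> 1" "k < a" "l < a" for p q k l
    proof -
      have "minor p q k l \<in> F" using that unfolding F_def by blast
      from y(2)[OF this] show ?thesis by (simp only: minor_def cpoly_eval_diff cpoly_eval_mult X_eval right_minus_eq)
    qed
    ultimately show "y \<in> scroll a r off" unfolding scroll_eq_minors[OF a] by blast
  qed
  ultimately show ?thesis unfolding algebraic_set_def by blast
qed

lemma algebraic_variety_scroll:
  assumes a: "a \<ge> 1" and N: "off + 2 * Suc a + r \<le> N"
  shows "algebraic_variety N (scroll a r off)"
proof (rule algebraic_variety_if_curves)
  show "algebraic_set N (scroll a r off)" using assms by (rule algebraic_set_scroll)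
  show "scroll a r off \<noteq> {}" by (simp add: scroll_def)
  fix y z assume "y \<in> scroll a r off" "z \<in> scroll a r off"
  then obtain x x' where yz: "y = scroll_param a r off x" "z = scroll_param a r off x'"
    by (auto simp: scroll_def)
  show "\<exists>h. (\<forall>t. (\<lambda>i. poly (h i) t) \<in> scroll a r off) \<and>
      (\<lambda>i. poly (h i) 0) = y \<and> (\<lambda>i. poly (h i) 1) = z"
    by (intro exI[of _ "scroll_param a r off (\<lambda>i. [:x i, x' i - x i:])"])
      (simp add: poly_scroll_param yz scroll_def)
qed

lemma origin_in_scroll: "origin \<in> scroll a r off"
proof -
  have "scroll_param a r off (\<lambda>_. 0) = (\<lambda>_. 0 :: complex)"
    by (rule scroll_param_eqI) simp_all
  then show ?thesis unfolding scroll_def origin_def by (metis rangeI)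
qed

subsection \<open>The dimension is at least \<open>r + 3\<close>\<close>

lemma scroll_chain:
  assumes a: "a \<ge> 1" and N: "off + 2 * Suc a + r \<le> N"
  shows "\<exists>c. (\<forall>i\<le>r + 3. algebraic_variety N (c i) \<and> c i \<subseteq> scroll a r off) \<and> (\<forall>i<r + 3. c i \<subset> c (Suc i))"
proof -
  \<comment> \<open>The coordinates of the affine factor, followed by those of the plane \<open>u = (1, 0)\<close> in the cone.\<close>
  define s where "s j = (if j < r then off + 2 * Suc a + j else if j = r then off else off + Suc a)" for j
  have s_inj: "s i \<noteq> s j" if "i < j" "j < r + 2" for i j
    using that by (auto simp: s_def)
  have s_less: "s i < N" for i
    using N by (auto simp: s_def)
  define L where "L j = coord_subspace N (s ` {..<j})" for j
  have L_mono: "L j \<subset> L (Suc j)" if "j < r + 2" for j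
  proof -
    have "s j \<notin> s ` {..<j}" using s_inj that by fastforce
    then have "(\<lambda>i. if i = s j then 1 else 0) \<in> L (Suc j) - L j"
      using s_less[of j] by (auto simp: L_def coord_subspace_def complex_space_def)
    moreover have "L j \<subseteq> L (Suc j)" by (auto simp: L_def coord_subspace_def lessThan_Suc)
    ultimately show ?thesis by blast
  qed
  have L_sub: "L (r + 2) \<subset> scroll a r off"
  proof
    show "L (r + 2) \<subseteq> scroll a r off"
    proof
      fix y assume y: "y \<in> L (r + 2)"
      have img: "s ` {..<r + 2} \<subseteq> (\<lambda>j. off + 2 * Suc a + j) ` {..<r} \<union> {off, off + Suc a}"
        by (auto simp: s_def)
      have zero: "y i = 0" if "i \<notin> (\<lambda>j. off + 2 * Suc a + j) ` {..<r} \<union> {off, off + Suc a}" for i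
      proof -
        have "i \<notin> s ` {..<r + 2}" using that img by blast
        with y show ?thesis by (simp add: L_def coord_subspace_def)
      qed
      define x where "x i = (if i = 0 then 1 else if i = 1 then 0 else if i = 2 then y off
          else if i = 3 then y (off + Suc a) else y (off + 2 * Suc a + (i - 4)))" for i :: nat
      have x: "x 0 = 1" "x 1 = 0" "x 2 = y off" "x 3 = y (off + Suc a)" "x (4 + l) = y (off + 2 * Suc a + l)" for l
        by (simp_all add: x_def)
      have "scroll_param a r off x = y"
      proof (rule scroll_param_eqI)
        fix k assume k: "k \<le> a"
        have "y (off + k) = 0" "y (off + Suc a + k) = 0" if "k \<noteq> 0"
          using that k by (auto intro!: zero)
        then show "y (off + k) = x 0 ^ (a - k) * x 1 ^ k * x 2"
          "y (off + Suc a + k) = x 0 ^ (a - k) * x 1 ^ k * x 3"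
          unfolding x by (cases "k = 0"; simp)+
      next
        show "y i = 0" if "i < off" for i using that by (intro zero) auto
        show "y i = 0" if "off + 2 * Suc a + r \<le> i" for i using that by (intro zero) auto
      qed (simp only: x)
      then show "y \<in> scroll a r off" unfolding scroll_def by (metis rangeI)
    qed
    have "scroll_param a r off (\<lambda>_. 1) \<notin> L (r + 2)"
    proof
      assume "scroll_param a r off (\<lambda>_. 1) \<in> L (r + 2)"
      moreover have "off + 1 \<notin> s ` {..<r + 2}" using a by (auto simp: s_def)
      ultimately have "scroll_param a r off (\<lambda>_. 1) (off + 1) = (0 :: complex)"
        by (simp add: L_def coord_subspace_def)
      then show False using a scroll_param_simps(2)[of 1 a r off "\<lambda>_. 1 :: complex"] by simp
    qed
    then show "L (r + 2) \<noteq> scroll a r off" by (auto simp: scroll_def)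
  qed
  define c where "c i = (if i < r + 3 then L i else scroll a r off)" for i
  have c_mono: "c i \<subset> c (Suc i)" if "i < r + 3" for i
  proof (cases "i = r + 2")
    case True then show ?thesis using L_sub by (simp add: c_def)
  next
    case False then show ?thesis using that L_mono[of i] by (simp add: c_def)
  qed
  have "c i \<subseteq> c (r + 3)" if "i \<le> r + 3" for i
    using that
  proof (induction i rule: inc_induct)
    case (step i)
    then show ?case using c_mono[of i] by blast
  qed simp
  moreover have "c (r + 3) = scroll a r off" by (simp add: c_def)
  moreover have "algebraic_variety N (c i)" for i
    using algebraic_variety_coord_subspace algebraic_variety_scroll[OF a N] by (simp add: c_def L_def)
  ultimately show ?thesis using c_mono by blast
qed

subsection \<open>The Hilbert function\<close>

lemma monoms_induct [consumes 1, case_names zero add]: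
  assumes "m \<in> monoms N" "Q 0"
    and "\<And>m i. m \<in> monoms N \<Longrightarrow> i < N \<Longrightarrow> Q m \<Longrightarrow> Q (m + Poly_Mapping.single i 1)"
  shows "Q m"
  using assms(1)
proof (induction "monom_deg m" arbitrary: m)
  case 0
  have "m = 0"
  proof (rule ccontr)
    assume "m \<noteq> 0"
    with 0(2) obtain m' i where "m = m' + Poly_Mapping.single i 1" by (metis monom_split)
    then have "monom_deg m = monom_deg m' + 1"
      using monom_deg_add[of m' "Poly_Mapping.single i 1"] by (simp only: monom_deg_single)
    with 0(1) show False by simp
  qed
  with assms(2) show ?case by simp
next
  case (Suc d)
  then have "m \<noteq> 0" by auto
  with Suc(3) obtain m' i where m': "i < N" "m' \<in> monoms N" "m = m' + Poly_Mapping.single i 1"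
    by (metis monom_split)
  then have "monom_deg m = monom_deg m' + 1"
    using monom_deg_add[of m' "Poly_Mapping.single i 1"] by (simp only: monom_deg_single)
  with Suc(2) have "d = monom_deg m'" by simp
  with Suc(1) m' assms(3) show ?case by blast
qed

lemma monom_eval_sum: "monom_eval (sum f S) x = (\<Prod>s\<in>S. monom_eval (f s) x)"
  by (induction S rule: infinite_finite_induct) (simp_all add: monom_eval_add)

lemma monom_deg_sum: "monom_deg (sum f S) = (\<Sum>s\<in>S. monom_deg (f s))"
  by (induction S rule: infinite_finite_induct) (simp_all add: monom_deg_add)

lemma monoms_sum: "(\<And>s. s \<in> S \<Longrightarrow> f s \<in> monoms N) \<Longrightarrow> sum f S \<in> monoms N"
  by (induction S rule: infinite_finite_induct) (auto intro: monoms_add)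

text \<open>The monomial \<open>u\<^sub>0\<^bsup>a(p+q)-c\<^esup> u\<^sub>1\<^bsup>c\<^esup> v\<^sub>0\<^bsup>p\<^esup> v\<^sub>1\<^bsup>q\<^esup> w\<^bsup>l\<^esup>\<close> in the parameters. For \<open>c \<le> a (p + q)\<close> these are the
  restrictions of the monomials in the coordinates, of degree \<open>p + q + sum_list l\<close>.\<close>

fun param_monom :: "nat \<Rightarrow> nat \<times> nat \<times> nat \<times> nat list \<Rightarrow> (nat \<Rightarrow> complex) \<Rightarrow> complex" where
  "param_monom a (c, p, q, l) x =
     x 0 ^ (a * (p + q) - c) * x 1 ^ c * x 2 ^ p * x 3 ^ q * (\<Prod>i<length l. x (4 + i) ^ (l ! i))"

text \<open>The exponents of the monomial functions of degree less than \<open>K\<close>.\<close>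

definition exponents :: "nat \<Rightarrow> nat \<Rightarrow> nat \<Rightarrow> (nat \<times> nat \<times> nat \<times> nat list) set" where
  "exponents a r K = {(c, p, q, l). c \<le> a * (p + q) \<and> length l = r \<and> p + q + sum_list l < K}"

lemma prod_list_update_power:
  fixes x :: "nat \<Rightarrow> complex"
  assumes "j < length l"
  shows "(\<Prod>i<length l. x i ^ (l[j := Suc (l ! j)] ! i)) = x j * (\<Prod>i<length l. x i ^ (l ! i))"
proof -
  have "(\<Prod>i<length l. x i ^ (l[j := Suc (l ! j)] ! i)) = (\<Prod>i<length l. (if i = j then x j else 1) * x i ^ (l ! i))"
    using assms by (intro prod.cong) (auto simp: nth_list_update)
  also have "\<dots> = x j * (\<Prod>i<length l. x i ^ (l ! i))"
    using assms by (simp add: prod.distrib)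
  finally show ?thesis .
qed

context
  fixes a r off N :: nat
  assumes a: "a \<ge> 1" and N: "off + 2 * Suc a + r \<le> N"
begin

interpretation toric_cone N "scroll_param a r off" "\<lambda>x y i. x i * y i"
  using N by (rule toric_cone_scroll)

text \<open>Every monomial in the coordinates restricts to zero or to one of these monomials in the parameters; the
  converse is \<open>exponents_mon_fun\<close>.\<close>

lemma mon_fun_exponents:
  assumes "m \<in> monoms N"
  shows "mon_fun m = 0 \<or> (\<exists>c p q l. c \<le> a * (p + q) \<and> length l = r \<and>
    p + q + sum_list l = monom_deg m \<and> mon_fun m = param_monom a (c, p, q, l))"
  using assms
proof (induction rule: monoms_induct)
  case zero
  have "mon_fun 0 = param_monom a (0, 0, 0, replicate r 0)"
    by (simp add: fun_eq_iff mon_fun_def)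
  moreover have "sum_list (replicate r (0::nat)) = 0" by (simp add: sum_list_replicate)
  ultimately show ?case
    by (intro disjI2 exI[of _ 0] exI[of _ "replicate r 0"]) simp
next
  case (add m i)
  have step: "mon_fun (m + Poly_Mapping.single i 1) x = mon_fun m x * scroll_param a r off x i" for x
    by (simp add: mon_fun_def monom_eval_add)
  from add.IH show ?case
  proof
    assume "mon_fun m = 0"
    then have "mon_fun (m + Poly_Mapping.single i 1) = 0" unfolding fun_eq_iff step by simp
    then show ?thesis by blast
  next
    assume "\<exists>c p q l. c \<le> a * (p + q) \<and> length l = r \<and>
      p + q + sum_list l = monom_deg m \<and> mon_fun m = param_monom a (c, p, q, l)"
    then obtain c p q l where e: "c \<le> a * (p + q)" "length l = r" "p + q + sum_list l = monom_deg m"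
      "mon_fun m = param_monom a (c, p, q, l)" by blast
    have deg: "monom_deg (m + Poly_Mapping.single i 1) = Suc (monom_deg m)"
      by (simp add: monom_deg_add)
    show ?thesis
    proof (cases rule: coordinate_cases[where i = i and off = off and a = a and r = r])
      case below
      then have "mon_fun (m + Poly_Mapping.single i 1) = 0"
        unfolding fun_eq_iff step by (simp add: scroll_param_simps)
      then show ?thesis by blast
    next
      case above
      then have "mon_fun (m + Poly_Mapping.single i 1) = 0"
        unfolding fun_eq_iff step by (simp add: scroll_param_simps)
      then show ?thesis by blast
    next
      case (first k)
      have exp: "a * (Suc p + q) - (c + k) = (a * (p + q) - c) + (a - k)"
        using e(1) first(1) by simp
      have "mon_fun (m + Poly_Mapping.single i 1) = param_monom a (c + k, Suc p, q, l)"
        unfolding fun_eq_iff step unfolding e(4) first(2) scroll_param_simps(2)[OF first(1)] param_monom.simps exp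
        by (simp add: power_add mult_ac)
      then show ?thesis
        using e first(1) deg
        by (intro disjI2 exI[of _ "c + k"] exI[of _ "Suc p"] exI[of _ q] exI[of _ l]) simp
    next
      case (second k)
      have exp: "a * (p + Suc q) - (c + k) = (a * (p + q) - c) + (a - k)"
        using e(1) second(1) by simp
      have "mon_fun (m + Poly_Mapping.single i 1) = param_monom a (c + k, p, Suc q, l)"
        unfolding fun_eq_iff step unfolding e(4) second(2) scroll_param_simps(3)[OF second(1)] param_monom.simps exp
        by (simp add: power_add mult_ac)
      then show ?thesis
        using e second(1) deg
        by (intro disjI2 exI[of _ "c + k"] exI[of _ p] exI[of _ "Suc q"] exI[of _ l]) simp
    next
      case (affine j)
      have "mon_fun (m + Poly_Mapping.single i 1) = param_monom a (c, p, q, l[j := Suc (l ! j)])"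
        unfolding fun_eq_iff step unfolding e(4) affine(2) scroll_param_simps(4)[OF affine(1)] param_monom.simps
        using prod_list_update_power[of j l "\<lambda>i. _ (4 + i)"] e(2) affine(1) by (simp add: mult_ac)
      moreover have "sum_list (l[j := Suc (l ! j)]) = Suc (sum_list l)"
        using e(2) affine(1) by (simp add: sum_list_update elem_le_sum_list Suc_diff_le)
      ultimately show ?thesis
        using e affine(1) deg
        by (intro disjI2 exI[of _ c] exI[of _ p] exI[of _ q] exI[of _ "l[j := Suc (l ! j)]"]) simp
    qed
  qed
qed

lemma param_monom_scroll_part:
  assumes "c \<le> a * (p + q)"
  shows "\<exists>m\<in>monoms N. monom_deg m = p + q \<and>
    (\<forall>x. mon_fun m x = x 0 ^ (a * (p + q) - c) * x 1 ^ c * x 2 ^ p * x 3 ^ q)"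
  using assms
proof (induction p arbitrary: c)
  case 0
  then show ?case
  proof (induction q arbitrary: c)
    case 0
    then show ?case by (intro bexI[of _ 0]) (simp_all add: mon_fun_def)
  next
    case (Suc q)
    define k where "k = min a c"
    have k: "k \<le> a" "k \<le> c" "c - k \<le> a * (0 + q)" using Suc.prems by (auto simp: k_def)
    then obtain m where m: "m \<in> monoms N" "monom_deg m = 0 + q"
      "\<And>x. mon_fun m x = x 0 ^ (a * (0 + q) - (c - k)) * x 1 ^ (c - k) * x 2 ^ 0 * x 3 ^ q"
      using Suc.IH[of "c - k"] by blast
    let ?m = "m + Poly_Mapping.single (off + Suc a + k) 1"
    have exp: "a * (0 + Suc q) - c = (a * (0 + q) - (c - k)) + (a - k)"
      using k by simp
    have "mon_fun ?m x = x 0 ^ (a * (0 + Suc q) - c) * x 1 ^ ((c - k) + k) * x 2 ^ 0 * x 3 ^ Suc q" for x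
    proof -
      have "mon_fun ?m x = mon_fun m x * scroll_param a r off x (off + Suc a + k)"
        by (simp add: mon_fun_def monom_eval_add)
      then show ?thesis
        unfolding m(3) scroll_param_simps(3)[OF k(1)] exp by (simp add: power_add mult_ac)
    qed
    moreover have "?m \<in> monoms N" using m(1) k(1) N by (intro monoms_add monoms_single) simp_all
    ultimately show ?case using m(2) k(2) by (intro bexI[of _ ?m]) (simp_all add: monom_deg_add)
  qed
next
  case (Suc p)
  define k where "k = min a c"
  have k: "k \<le> a" "k \<le> c" "c - k \<le> a * (p + q)" using Suc.prems by (auto simp: k_def)
  then obtain m where m: "m \<in> monoms N" "monom_deg m = p + q"
    "\<And>x. mon_fun m x = x 0 ^ (a * (p + q) - (c - k)) * x 1 ^ (c - k) * x 2 ^ p * x 3 ^ q"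
    using Suc.IH[of "c - k"] by blast
  let ?m = "m + Poly_Mapping.single (off + k) 1"
  have exp: "a * (Suc p + q) - c = (a * (p + q) - (c - k)) + (a - k)"
    using k by simp
  have "mon_fun ?m x = x 0 ^ (a * (Suc p + q) - c) * x 1 ^ ((c - k) + k) * x 2 ^ Suc p * x 3 ^ q" for x
  proof -
    have "mon_fun ?m x = mon_fun m x * scroll_param a r off x (off + k)"
      by (simp add: mon_fun_def monom_eval_add)
    then show ?thesis
      unfolding m(3) scroll_param_simps(2)[OF k(1)] exp by (simp add: power_add mult_ac)
  qed
  moreover have "?m \<in> monoms N" using m(1) k(1) N by (intro monoms_add monoms_single) simp_all
  ultimately show ?case using m(2) k(2) by (intro bexI[of _ ?m]) (simp_all add: monom_deg_add)
qed

lemma exponents_mon_fun: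
  assumes "c \<le> a * (p + q)" "length l = r"
  shows "\<exists>m\<in>monoms N. monom_deg m = p + q + sum_list l \<and> mon_fun m = param_monom a (c, p, q, l)"
proof -
  obtain m where m: "m \<in> monoms N" "monom_deg m = p + q"
    "\<And>x. mon_fun m x = x 0 ^ (a * (p + q) - c) * x 1 ^ c * x 2 ^ p * x 3 ^ q"
    using param_monom_scroll_part[OF assms(1)] by blast
  define m' where "m' = (\<Sum>i<r. Poly_Mapping.single (off + 2 * Suc a + i) (l ! i))"
  have "m' \<in> monoms N" unfolding m'_def using N by (intro monoms_sum monoms_single) simp
  moreover have "monom_deg m' = sum_list l"
    using assms(2) by (simp add: m'_def monom_deg_sum sum_list_sum_nth lessThan_atLeast0)
  moreover have "mon_fun m' x = (\<Prod>i<length l. x (4 + i) ^ (l ! i))" for x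
    using assms(2) by (simp only: mon_fun_def m'_def monom_eval_sum monom_eval_single)
      (intro prod.cong refl, simp only: scroll_param_simps lessThan_iff)
  moreover have "mon_fun (m + m') x = mon_fun m x * mon_fun m' x" for x
    by (simp add: mon_fun_def monom_eval_add)
  ultimately show ?thesis
    using m by (intro bexI[of _ "m + m'"]) (simp_all add: monoms_add monom_deg_add fun_eq_iff)
qed

lemma mon_funs_scroll: "mon_funs K = param_monom a ` exponents a r K"
proof (intro equalityI subsetI)
  fix f assume "f \<in> mon_funs K"
  then obtain m where m: "m \<in> monoms N" "monom_deg m < K" "f = mon_fun m" "f \<noteq> 0"
    by (auto simp: mon_funs_def)
  with mon_fun_exponents[OF m(1)] show "f \<in> param_monom a ` exponents a r K"
    by (force simp: exponents_def)
next
  fix f assume "f \<in> param_monom a ` exponents a r K"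
  then obtain c p q l where e: "c \<le> a * (p + q)" "length l = r" "p + q + sum_list l < K"
    "f = param_monom a (c, p, q, l)" by (auto simp: exponents_def)
  then obtain m where "m \<in> monoms N" "monom_deg m < K" "f = mon_fun m"
    using exponents_mon_fun[OF e(1,2)] by auto
  moreover have "f (\<lambda>_. 1) \<noteq> 0" by (simp add: e(4))
  then have "f \<noteq> 0" by auto
  ultimately show "f \<in> mon_funs K" by (auto simp: mon_funs_def)
qed

text \<open>The exponents are recovered from the values at the points with one coordinate \<open>2\<close> and the others \<open>1\<close>.\<close>

lemma inj_on_param_monom: "inj_on (param_monom a) (exponents a r K)"
proof (rule inj_onI)
  fix e e' assume e: "e \<in> exponents a r K" "e' \<in> exponents a r K" and eq: "param_monom a e = param_monom a e'"
  obtain c p q l where [simp]: "e = (c, p, q, l)" by (cases e) auto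
  obtain c' p' q' l' where [simp]: "e' = (c', p', q', l')" by (cases e') auto
  have len: "length l = r" "length l' = r" using e by (simp_all add: exponents_def)
  define \<delta> where "\<delta> j = (\<lambda>i::nat. if i = j then 2 else 1 :: complex)" for j
  have power_eq: "u = v" if "(2::complex) ^ u = 2 ^ v" for u v :: nat
  proof -
    from that have "of_nat (2 ^ u) = (of_nat (2 ^ v) :: complex)" by simp
    then have "(2::nat) ^ u = 2 ^ v" unfolding of_nat_eq_iff .
    then show ?thesis by simp
  qed
  have at: "param_monom a e (\<delta> j) = param_monom a e' (\<delta> j)" for j by (rule fun_cong[OF eq])
  have one: "(\<Prod>i<r. \<delta> j (4 + i) ^ f i) = 1" if "j < 4" for j and f :: "nat \<Rightarrow> nat"
    using that by (intro prod.neutral) (simp add: \<delta>_def)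
  have "c = c'" by (rule power_eq) (use at[of 1] one[of 1] len in \<open>simp add: \<delta>_def\<close>)
  moreover have "p = p'" by (rule power_eq) (use at[of 2] one[of 2] len in \<open>simp add: \<delta>_def\<close>)
  moreover have "q = q'" by (rule power_eq) (use at[of 3] one[of 3] len in \<open>simp add: \<delta>_def\<close>)
  moreover have "l = l'"
  proof (rule nth_equalityI)
    show "length l = length l'" by (simp add: len)
    fix j assume "j < length l"
    then have j: "j < r" by (simp add: len)
    have "(\<Prod>i<r. \<delta> (4 + j) (4 + i) ^ f i) = 2 ^ f j" for f :: "nat \<Rightarrow> nat"
    proof -
      have "(\<Prod>i<r. \<delta> (4 + j) (4 + i) ^ f i) = (\<Prod>i<r. if i = j then 2 ^ f i else 1)"
        by (intro prod.cong) (auto simp: \<delta>_def)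
      then show ?thesis using j by simp
    qed
    then show "l ! j = l' ! j"
      by (intro power_eq) (use at[of "4 + j"] len in \<open>simp add: \<delta>_def\<close>)
  qed
  ultimately show "e = e'" by simp
qed

lemma card_mon_funs_exponents: "card (mon_funs K) = card (exponents a r K)"
  unfolding mon_funs_scroll by (rule card_image[OF inj_on_param_monom])

end

subsection \<open>Counting exponents\<close>

lemma exponents_0: "exponents a r 0 = {}"
  by (simp add: exponents_def)

lemma finite_exponents: "finite (exponents a r K)"
proof -
  have "finite {l :: nat list. set l \<subseteq> {..K} \<and> length l = r}" by (rule finite_lists_length_eq) simp
  then have "finite ({..a * (K + K)} \<times> {..K} \<times> {..K} \<times> {l :: nat list. set l \<subseteq> {..K} \<and> length l = r})"
    by simp
  moreover have "exponents a r K \<subseteq> {..a * (K + K)} \<times> {..K} \<times> {..K} \<times> {l. set l \<subseteq> {..K} \<and> length l = r}"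
  proof clarify
    fix c p q l assume "(c, p, q, l) \<in> exponents a r K"
    then have e: "c \<le> a * (p + q)" "length l = r" "p + q + sum_list l < K" by (simp_all add: exponents_def)
    have "a * (p + q) \<le> a * (K + K)" using e(3) by (intro mult_le_mono2) simp
    with e(1) have "c \<le> a * (K + K)" by (rule order_trans)
    moreover have "set l \<subseteq> {..K}" using e(3) member_le_sum_list[of _ l] by fastforce
    ultimately show "c \<in> {..a * (K + K)} \<and> (p, q, l) \<in> {..K} \<times> {..K} \<times> {l. set l \<subseteq> {..K} \<and> length l = r}"
      using e by simp
  qed
  ultimately show ?thesis by (rule rev_finite_subset)
qed

lemma card_exponents_base_Suc: "card (exponents a 0 (Suc K)) = card (exponents a 0 K) + Suc (a * K) * Suc K"
proof -
  let ?f = "\<lambda>(c, p). (c, p, K - p, [] :: nat list)"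
  have "exponents a 0 (Suc K) = exponents a 0 K \<union> ?f ` ({..a * K} \<times> {..K})"
  proof (intro equalityI subsetI)
    fix e assume "e \<in> exponents a 0 (Suc K)"
    then obtain c p q where e: "e = (c, p, q, [])" "c \<le> a * (p + q)" "p + q < Suc K"
      by (auto simp: exponents_def)
    show "e \<in> exponents a 0 K \<union> ?f ` ({..a * K} \<times> {..K})"
    proof (cases "p + q < K")
      case True
      with e show ?thesis by (simp add: exponents_def)
    next
      case False
      with e have "p + q = K" by simp
      with e have "e = ?f (c, p)" "(c, p) \<in> {..a * K} \<times> {..K}" by auto
      then show ?thesis by blast
    qed
  qed (auto simp: exponents_def)
  moreover have "exponents a 0 K \<inter> ?f ` ({..a * K} \<times> {..K}) = {}"
    by (auto simp: exponents_def)
  moreover have "card (?f ` ({..a * K} \<times> {..K})) = Suc (a * K) * Suc K"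
    by (subst card_image) (auto simp: inj_on_def)
  ultimately show ?thesis by (simp add: card_Un_disjoint finite_exponents)
qed

text \<open>The first affine coordinate has exponent zero, or its exponent can be decreased. This gives the
  recursion of Pascal's triangle.\<close>

lemma card_exponents_Suc_Suc:
  "card (exponents a (Suc r) (Suc K)) = card (exponents a r (Suc K)) + card (exponents a (Suc r) K)"
proof -
  let ?f = "\<lambda>(c :: nat, p :: nat, q :: nat, l). (c, p, q, (0::nat) # l)"
  let ?g = "\<lambda>(c :: nat, p :: nat, q :: nat, l). (c, p, q, Suc (hd l) # tl l)"
  have "exponents a (Suc r) (Suc K) = ?f ` exponents a r (Suc K) \<union> ?g ` exponents a (Suc r) K"
  proof (intro equalityI subsetI)
    fix e assume "e \<in> exponents a (Suc r) (Suc K)"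
    then obtain c p q b l where e: "e = (c, p, q, b # l)" "c \<le> a * (p + q)" "length l = r" "p + q + (b + sum_list l) < Suc K"
      by (auto simp: exponents_def length_Suc_conv)
    show "e \<in> ?f ` exponents a r (Suc K) \<union> ?g ` exponents a (Suc r) K"
    proof (cases b)
      case 0
      with e have "(c, p, q, l) \<in> exponents a r (Suc K)" "e = ?f (c, p, q, l)" by (simp_all add: exponents_def)
      then show ?thesis by blast
    next
      case (Suc b')
      with e have "(c, p, q, b' # l) \<in> exponents a (Suc r) K" "e = ?g (c, p, q, b' # l)" by (simp_all add: exponents_def)
      then show ?thesis by blast
    qed
  qed (auto simp: exponents_def length_Suc_conv)
  moreover have "?f ` exponents a r (Suc K) \<inter> ?g ` exponents a (Suc r) K = {}" by auto
  moreover have "card (?f ` exponents a r (Suc K)) = card (exponents a r (Suc K))"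
    by (rule card_image) (auto simp: inj_on_def)
  moreover have "card (?g ` exponents a (Suc r) K) = card (exponents a (Suc r) K)"
  proof (intro card_image inj_on_inverseI[where g = "\<lambda>(c, p, q, l). (c, p, q, (hd l - 1) # tl l)"])
    fix e assume "e \<in> exponents a (Suc r) K"
    then obtain c p q b l where "e = (c, p, q, b # l)" by (auto simp: exponents_def length_Suc_conv)
    then show "(\<lambda>(c, p, q, l). (c, p, q, (hd l - 1) # tl l)) (?g e) = e" by simp
  qed
  ultimately show ?thesis by (simp add: card_Un_disjoint finite_exponents)
qed

lemma card_exponents:
  assumes a: "a \<ge> 1"
  shows "card (exponents a r K) = (K + r + 2 choose (r + 3)) + (2 * a - 1) * (K + r + 1 choose (r + 3))"
proof (induction r arbitrary: K)
  case 0
  show ?case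
  proof (induction K)
    case 0
    show ?case by (simp add: exponents_0)
  next
    case (Suc K)
    obtain b where b: "a = Suc b" using a by (cases a) auto
    have two: "2 * (Suc K choose 2) = K * Suc K"
      by (induction K) (simp_all add: numeral_2_eq_2)
    have "Suc (a * K) * Suc K = (Suc (Suc K) choose 2) + (2 * a - 1) * (Suc K choose 2)"
    proof -
      have "(Suc (Suc K) choose 2) + (2 * a - 1) * (Suc K choose 2) = Suc K + a * (2 * (Suc K choose 2))"
        by (simp add: b numeral_2_eq_2 algebra_simps)
      then show ?thesis unfolding two by (simp add: algebra_simps)
    qed
    then show ?case
      unfolding card_exponents_base_Suc Suc.IH by (simp add: numeral_3_eq_3 numeral_2_eq_2 algebra_simps)
  qed
next
  case (Suc r)
  note IH = Suc.IH
  show ?case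
  proof (induction K)
    case 0
    show ?case by (simp add: exponents_0)
  next
    case (Suc K)
    have "(Suc K + Suc r + 2 choose (Suc r + 3)) = (Suc K + r + 2 choose (r + 3)) + (K + Suc r + 2 choose (Suc r + 3))"
      "(Suc K + Suc r + 1 choose (Suc r + 3)) = (Suc K + r + 1 choose (r + 3)) + (K + Suc r + 1 choose (Suc r + 3))"
      by (simp_all add: numeral_3_eq_3 numeral_2_eq_2)
    then show ?case
      unfolding card_exponents_Suc_Suc Suc.IH IH by (simp only: distrib_left add_ac)
  qed
qed

subsection \<open>Dimension and multiplicity\<close>

lemma card_exponents_le:
  assumes a: "a \<ge> 1"
  shows "card (exponents a r K) \<le> (2 * a * (r + 3) ^ (r + 3)) * K ^ (r + 3)"
proof (cases "K = 0")
  case True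
  then show ?thesis by (simp add: exponents_0)
next
  case False
  have "(m choose (r + 3)) \<le> ((r + 3) * K) ^ (r + 3)" if "m \<le> K + r + 2" for m
  proof -
    have "K + r + 2 \<le> (r + 3) * K"
      using False by (cases K) (simp_all add: algebra_simps)
    then have "m ^ (r + 3) \<le> ((r + 3) * K) ^ (r + 3)" using that by (intro power_mono) simp_all
    then show ?thesis using binomial_le_pow2 order_trans
      by (cases "r + 3 \<le> m") (auto simp: binomial_eq_0 intro: order_trans[OF binomial_le_pow])
  qed
  from this[of "K + r + 2"] this[of "K + r + 1"]
  have "card (exponents a r K) \<le> ((r + 3) * K) ^ (r + 3) + (2 * a - 1) * ((r + 3) * K) ^ (r + 3)"
    unfolding card_exponents[OF a] by (intro add_mono mult_le_mono2) simp_all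
  also have "\<dots> = Suc (2 * a - 1) * ((r + 3) * K) ^ (r + 3)" by (simp only: mult_Suc)
  also have "\<dots> = (2 * a * (r + 3) ^ (r + 3)) * K ^ (r + 3)"
    using a by (simp only: power_mult_distrib mult.assoc) simp
  finally show ?thesis .
qed

theorem variety_dim_scroll:
  assumes a: "a \<ge> 1" and N: "off + 2 * Suc a + r \<le> N"
  shows "variety_dim N (scroll a r off) = enat (r + 3)"
proof -
  interpret toric_cone N "scroll_param a r off" "\<lambda>x y i. x i * y i"
    using N by (rule toric_cone_scroll)
  obtain c where c: "\<forall>i\<le>r + 3. algebraic_variety N (c i) \<and> c i \<subseteq> scroll a r off"
    "\<forall>i<r + 3. c i \<subset> c (Suc i)"
    using scroll_chain[OF a N] by blast
  show ?thesis
    unfolding variety_dim_def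
  proof (rule chain_length_eqI[where c = c])
    fix k b assume b: "\<forall>i\<le>k. b i \<in> {B. B \<subseteq> scroll a r off \<and> algebraic_variety N B}"
      and strict: "\<forall>i<k. b i \<subset> b (Suc i)"
    have growth: "card (mon_funs K) \<le> (2 * a * (r + 3) ^ (r + 3)) * K ^ (r + 3)" for K
      unfolding card_mon_funs_exponents[OF a N] by (rule card_exponents_le[OF a])
    show "k \<le> r + 3"
    proof (rule variety_chain_bound[OF growth])
      show "\<forall>i\<le>k. algebraic_variety N (b i)" using b by blast
      show "b k \<subseteq> range (scroll_param a r off)" using b unfolding scroll_def by blast
    qed (rule strict)
  qed (use c in auto)
qed

theorem point_multiplicity_scroll:
  assumes a: "a \<ge> 1" and N: "off + 2 * Suc a + r \<le> N"
  shows "point_multiplicity N (scroll a r off) origin = 2 * a"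
proof -
  interpret toric_cone N "scroll_param a r off" "\<lambda>x y i. x i * y i"
    using N by (rule toric_cone_scroll)
  define n where "n = r + 3"
  define binom where "binom s = smult (1 / fact n) (\<Prod>i<n. [:s - of_nat i, 1 :: rat:])" for s
  have prod_deg: "Polynomial.degree (\<Prod>i<n. [:s - of_nat i, 1 :: rat:]) = n" for s
    by (subst degree_prod_eq_sum_degree) auto
  have prod_lead: "lead_coeff (\<Prod>i<n. [:s - of_nat i, 1 :: rat:]) = 1" for s
    by (simp add: lead_coeff_prod)
  have binom_eval: "poly (binom (of_nat s)) (of_nat k) = of_nat ((k + s) choose n)" for s k
    by (simp add: binom_def poly_prod binomial_gbinomial gbinomial_prod_rev add_diff_eq add.commute
        lessThan_atLeast0 algebra_simps)
  define p where "p = binom (of_nat (r + 2)) + smult (of_nat (2 * a - 1)) (binom (of_nat (r + 1)))"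
  have coeff_n: "coeff p n = of_nat (2 * a) / fact n"
  proof -
    have "coeff (\<Prod>i<n. [:s - of_nat i, 1 :: rat:]) n = 1" for s
      using prod_lead[of s] prod_deg[of s] by simp
    then have "coeff p n = (1 + of_nat (2 * a - 1)) / fact n"
      by (simp add: p_def binom_def add_divide_distrib)
    also have "1 + of_nat (2 * a - 1) = (of_nat (Suc (2 * a - 1)) :: rat)" by simp
    also have "Suc (2 * a - 1) = 2 * a" using a by simp
    finally show ?thesis .
  qed
  have deg: "Polynomial.degree p = n"
  proof (rule antisym)
    show "Polynomial.degree p \<le> n"
      unfolding p_def binom_def using prod_deg
      by (intro degree_add_le order_trans[OF degree_smult_le]) simp_all
    show "n \<le> Polynomial.degree p" using coeff_n a by (intro le_degree) simp
  qed
  show ?thesis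
    unfolding point_multiplicity_def scroll_def
  proof (rule hilbert_samuel_multiplicity_eqI)
    show "ring_length (R Quot (THE M. maximalideal M R) [^]\<^bsub>ideals_set R\<^esub> k) = enat (card (mon_funs k))" for k
      by (rule ring_length_toric)
    show "poly p (of_nat k) = of_nat (card (mon_funs k))" for k
      unfolding card_mon_funs_exponents[OF a N] card_exponents[OF a]
      unfolding p_def poly_add poly_smult binom_eval by (simp only: n_def add.assoc of_nat_add of_nat_mult)
    show "lead_coeff p = of_nat (2 * a) / fact (Polynomial.degree p)"
      using coeff_n by (simp add: deg)
  qed
qed

section \<open>Quaternionic trivialization\<close>

text \<open>Multiplication of quaternions, where the pair \<open>(\<alpha>, \<beta>)\<close> stands for \<open>\<alpha> + \<beta> j\<close>.\<close>

definition qmul :: "complex \<times> complex \<Rightarrow> complex \<times> complex \<Rightarrow> complex \<times> complex" where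
  "qmul e q = (fst e * fst q - snd e * cnj (snd q), fst e * snd q + snd e * cnj (fst q))"

lemma norm_pair_power2: "(norm (v :: complex \<times> complex))\<^sup>2 = (cmod (fst v))\<^sup>2 + (cmod (snd v))\<^sup>2"
  by (simp add: norm_prod_def)

lemma cmod_components_le:
  fixes v :: "complex \<times> complex"
  shows "cmod (fst v) \<le> norm v" "cmod (snd v) \<le> norm v"
  by (metis norm_fst_le prod.collapse, metis norm_snd_le prod.collapse)

lemma norm_qmul: "norm (qmul e q) = norm e * norm q"
proof -
  have "(norm (qmul e q))\<^sup>2 = (norm e * norm q)\<^sup>2"
    unfolding power_mult_distrib norm_pair_power2 qmul_def fst_conv snd_conv cmod_power2
    by (simp add: power2_eq_square algebra_simps)
  then show ?thesis by (simp add: power2_eq_iff_nonneg)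
qed

lemma qmul_diff_left: "qmul (e - e') q = qmul e q - qmul e' q"
  by (simp add: qmul_def algebra_simps prod_eq_iff)

lemma qmul_diff_right: "qmul e (q - q') = qmul e q - qmul e q'"
  by (simp add: qmul_def algebra_simps prod_eq_iff)

lemma qmul_inverse:
  assumes "norm e = 1"
  shows "qmul e (qmul (cnj (fst e), - snd e) v) = v"
proof -
  have e: "fst e * cnj (fst e) + snd e * cnj (snd e) = 1"
  proof -
    have "(cmod (fst e))\<^sup>2 + (cmod (snd e))\<^sup>2 = 1" using norm_pair_power2[of e] assms by simp
    then have "complex_of_real ((cmod (fst e))\<^sup>2 + (cmod (snd e))\<^sup>2) = 1" by simp
    then show ?thesis by (simp only: of_real_add complex_norm_square)
  qed
  have "qmul e (qmul (cnj (fst e), - snd e) v)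
      = ((fst e * cnj (fst e) + snd e * cnj (snd e)) * fst v, (fst e * cnj (fst e) + snd e * cnj (snd e)) * snd v)"
    by (simp add: qmul_def algebra_simps)
  then show ?thesis by (simp add: e)
qed

text \<open>The quaternion \<open>cnj (u\<^sub>0)\<^sup>a + cnj (u\<^sub>1)\<^sup>a j\<close> and its normalization. For \<open>\<bar>\<tau>\<bar> = 1\<close> both are multiplied by
  \<open>\<tau>\<^bsup>-a\<^esup>\<close> under \<open>u \<mapsto> \<tau> u\<close>.\<close>

definition frame0 :: "nat \<Rightarrow> complex \<times> complex \<Rightarrow> complex \<times> complex" where
  "frame0 a u = (cnj (fst u) ^ a, cnj (snd u) ^ a)"

definition frame :: "nat \<Rightarrow> complex \<times> complex \<Rightarrow> complex \<times> complex" where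
  "frame a u = frame0 a u /\<^sub>R norm (frame0 a u)"

text \<open>One of the two components of a unit vector has absolute value at least \<open>1 / 2\<close>.\<close>

lemma norm_frame0_ge:
  assumes "norm u = 1"
  shows "norm (frame0 a u) \<ge> (1 / 2) ^ a"
proof -
  have 1: "(cmod (fst u))\<^sup>2 + (cmod (snd u))\<^sup>2 = 1"
    using norm_pair_power2[of u] assms by simp
  have le: "z ^ a \<le> norm (frame0 a u)" if "z = cmod (fst u) \<or> z = cmod (snd u)" for z
    using that cmod_components_le[of "frame0 a u"]
    by (auto simp: frame0_def norm_power)
  have "1 / 2 \<le> cmod (fst u) \<or> 1 / 2 \<le> cmod (snd u)"
  proof (rule ccontr)
    assume "\<not> ?thesis"
    then have "(cmod (fst u))\<^sup>2 < (1 / 2)\<^sup>2" "(cmod (snd u))\<^sup>2 < (1 / 2)\<^sup>2"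
      by (auto intro!: power_strict_mono)
    with 1 show False by (simp add: power2_eq_square)
  qed
  then show ?thesis
  proof
    assume "1 / 2 \<le> cmod (fst u)"
    then have "(1 / 2) ^ a \<le> cmod (fst u) ^ a" by (intro power_mono) simp_all
    also have "\<dots> \<le> norm (frame0 a u)" by (rule le) simp
    finally show ?thesis .
  next
    assume "1 / 2 \<le> cmod (snd u)"
    then have "(1 / 2) ^ a \<le> cmod (snd u) ^ a" by (intro power_mono) simp_all
    also have "\<dots> \<le> norm (frame0 a u)" by (rule le) simp
    finally show ?thesis .
  qed
qed

lemma norm_frame: "norm u = 1 \<Longrightarrow> norm (frame a u) = 1"
proof -
  assume "norm u = 1"
  then have "0 < norm (frame0 a u)" using norm_frame0_ge[of u a] zero_less_power[of "1 / 2 :: real" a] by linarith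
  then show ?thesis by (simp add: frame_def)
qed

lemma norm_unit_diff_le:
  fixes x y :: "'a::real_normed_vector"
  assumes "x \<noteq> 0" "y \<noteq> 0"
  shows "norm (x /\<^sub>R norm x - y /\<^sub>R norm y) \<le> 2 * norm (x - y) / norm x"
proof -
  have "x /\<^sub>R norm x - y /\<^sub>R norm y = (x - y) /\<^sub>R norm x + (inverse (norm x) - inverse (norm y)) *\<^sub>R y"
    by (simp add: algebra_simps)
  also have "norm \<dots> \<le> norm ((x - y) /\<^sub>R norm x) + norm ((inverse (norm x) - inverse (norm y)) *\<^sub>R y)"
    by (rule norm_triangle_ineq)
  also have "norm ((x - y) /\<^sub>R norm x) = norm (x - y) / norm x"
    by (simp add: divide_inverse mult.commute)
  also have "norm ((inverse (norm x) - inverse (norm y)) *\<^sub>R y) = \<bar>norm y - norm x\<bar> / norm x"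
  proof -
    have "norm ((inverse (norm x) - inverse (norm y)) *\<^sub>R y) = \<bar>(inverse (norm x) - inverse (norm y)) * norm y\<bar>"
      by (simp add: abs_mult)
    also have "(inverse (norm x) - inverse (norm y)) * norm y = (norm y - norm x) / norm x"
      using assms by (simp add: field_simps)
    finally show ?thesis by simp
  qed
  also have "\<bar>norm y - norm x\<bar> / norm x \<le> norm (x - y) / norm x"
    using norm_triangle_ineq3[of y x] by (intro divide_right_mono) (simp_all add: norm_minus_commute)
  finally show ?thesis by simp
qed

lemma frame_lipschitz:
  assumes "norm u = 1" "norm u' = 1"
  shows "norm (frame a u - frame a u') \<le> 4 * real a * 2 ^ a * norm (u - u')"
proof -
  have le1: "cmod (fst v) \<le> 1" "cmod (snd v) \<le> 1" if "norm v = 1" for v :: "complex \<times> complex"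
    using that cmod_components_le[of v] by simp_all
  have "norm (frame0 a u - frame0 a u') \<le> cmod (cnj (fst u) ^ a - cnj (fst u') ^ a) + cmod (cnj (snd u) ^ a - cnj (snd u') ^ a)"
    unfolding frame0_def by (simp add: norm_Pair sqrt_sum_squares_le_sum)
  also have "\<dots> \<le> a * cmod (cnj (fst u) - cnj (fst u')) + a * cmod (cnj (snd u) - cnj (snd u'))"
    using assms le1 by (intro add_mono norm_power_diff) simp_all
  also have "cnj (fst u) - cnj (fst u') = cnj (fst (u - u'))" by simp
  also have "cnj (snd u) - cnj (snd u') = cnj (snd (u - u'))" by simp
  also have "a * cmod (cnj (fst (u - u'))) + a * cmod (cnj (snd (u - u'))) \<le> a * norm (u - u') + a * norm (u - u')"
    unfolding complex_mod_cnj
    by (intro add_mono mult_left_mono cmod_components_le) simp_all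
  finally have diff: "norm (frame0 a u - frame0 a u') \<le> 2 * a * norm (u - u')" by simp
  have pos: "(1 / 2) ^ a \<le> norm (frame0 a u)" "(1 / 2) ^ a \<le> norm (frame0 a u')" "0 < (1 / 2 :: real) ^ a"
    using assms norm_frame0_ge by simp_all
  then have "0 < norm (frame0 a u)" "0 < norm (frame0 a u')" by linarith+
  then have nz: "frame0 a u \<noteq> 0" "frame0 a u' \<noteq> 0" by simp_all
  have "norm (frame a u - frame a u') \<le> 2 * norm (frame0 a u - frame0 a u') / norm (frame0 a u)"
    unfolding frame_def by (rule norm_unit_diff_le[OF nz])
  also have "\<dots> \<le> 2 * (2 * a * norm (u - u')) / (1 / 2) ^ a"
    using diff pos by (intro frac_le mult_left_mono) simp_all
  also have "\<dots> = 4 * real a * 2 ^ a * norm (u - u')" by (simp add: power_one_over)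
  finally show ?thesis .
qed

lemma frame_equivariant:
  assumes "cmod \<tau> = 1"
  shows "frame a (\<tau> * fst u, \<tau> * snd u) = (cnj \<tau> ^ a * fst (frame a u), cnj \<tau> ^ a * snd (frame a u))"
proof -
  have 0: "frame0 a (\<tau> * fst u, \<tau> * snd u) = (cnj \<tau> ^ a * fst (frame0 a u), cnj \<tau> ^ a * snd (frame0 a u))"
    by (simp add: frame0_def power_mult_distrib)
  have "norm (frame0 a (\<tau> * fst u, \<tau> * snd u)) = norm (frame0 a u)"
    unfolding 0 norm_Pair using assms by (simp add: norm_mult norm_power norm_prod_def)
  then show ?thesis unfolding frame_def by (simp add: 0 scaleR_conv_of_real mult_ac)
qed

lemma qmul_scale: "qmul (c * fst e, c * snd e) q = (c * fst (qmul e q), c * snd (qmul e q))"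
  by (simp add: qmul_def algebra_simps)

section \<open>Metric estimates\<close>

text \<open>The Hermitian product.\<close>

definition herm :: "complex \<times> complex \<Rightarrow> complex \<times> complex \<Rightarrow> complex" where
  "herm u u' = fst u * cnj (fst u') + snd u * cnj (snd u')"

lemma cmod_diff_power2: "(cmod (s - t))\<^sup>2 = (cmod s)\<^sup>2 + (cmod t)\<^sup>2 - 2 * Re (s * cnj t)"
  unfolding cmod_power2 by (simp add: power2_eq_square algebra_simps)

lemma norm_diff_herm:
  assumes "norm u = 1" "norm u' = 1" "herm u u' = complex_of_real c"
  shows "(norm (u - u'))\<^sup>2 = 2 - 2 * c"
proof -
  have "(norm (u - u'))\<^sup>2 = (norm u)\<^sup>2 + (norm u')\<^sup>2 - 2 * Re (herm u u')"
    unfolding norm_pair_power2 fst_diff snd_diff cmod_diff_power2 herm_def by simp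
  with assms show ?thesis by simp
qed

text \<open>The basic identity: with binomial weights, the Hermitian product of \<open>u\<^sup>a\<close> and \<open>u'\<^sup>a\<close> is the
  \<open>a\<close>-th power of that of \<open>u\<close> and \<open>u'\<close>.\<close>

lemma weighted_distance:
  assumes u: "norm u = 1" "norm u' = 1" and c: "herm u u' = complex_of_real c"
  shows "(\<Sum>k\<le>a. real (a choose k) * (cmod (fst u ^ (a - k) * snd u ^ k * t - fst u' ^ (a - k) * snd u' ^ k * t'))\<^sup>2)
    = c ^ a * (cmod (t - t'))\<^sup>2 + (1 - c ^ a) * ((cmod t)\<^sup>2 + (cmod t')\<^sup>2)"
proof -
  define z where "z k = fst u ^ (a - k) * snd u ^ k" for k
  define z' where "z' k = fst u' ^ (a - k) * snd u' ^ k" for k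
  have unit: "(\<Sum>k\<le>a. real (a choose k) * (cmod (fst v ^ (a - k) * snd v ^ k))\<^sup>2) = 1"
    if v: "norm v = 1" for v :: "complex \<times> complex"
  proof -
    have "((cmod (snd v))\<^sup>2 + (cmod (fst v))\<^sup>2) ^ a = 1"
      using norm_pair_power2[of v] v by (simp add: add.commute)
    then show ?thesis
      by (subst (asm) binomial_ring) (simp add: norm_mult norm_power power_mult_distrib mult_ac flip: power_mult)
  qed
  have Re_scale: "Re (complex_of_real x * w) = x * Re w" for x w by simp
  have mixed: "(\<Sum>k\<le>a. of_nat (a choose k) * (z k * cnj (z' k))) = complex_of_real (c ^ a)"
  proof -
    have "(snd u * cnj (snd u') + fst u * cnj (fst u')) ^ a = complex_of_real (c ^ a)"
      using c by (simp add: herm_def add.commute)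
    then show ?thesis
      by (subst (asm) binomial_ring) (simp add: z_def z'_def power_mult_distrib mult_ac)
  qed
  have "(\<Sum>k\<le>a. real (a choose k) * (cmod (z k * t - z' k * t'))\<^sup>2)
      = (\<Sum>k\<le>a. (cmod t)\<^sup>2 * (real (a choose k) * (cmod (z k))\<^sup>2) + (cmod t')\<^sup>2 * (real (a choose k) * (cmod (z' k))\<^sup>2)
          - 2 * Re (t * cnj t' * (of_nat (a choose k) * (z k * cnj (z' k)))))"
  proof (intro sum.cong refl)
    fix k
    have "Re (t * cnj t' * (of_nat (a choose k) * (z k * cnj (z' k))))
        = real (a choose k) * Re (z k * t * cnj (z' k * t'))"
    proof -
      have "t * cnj t' * (of_nat (a choose k) * (z k * cnj (z' k)))
          = complex_of_real (real (a choose k)) * (z k * t * cnj (z' k * t'))" by (simp add: mult_ac)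
      then show ?thesis by (simp only: Re_scale)
    qed
    then show "real (a choose k) * (cmod (z k * t - z' k * t'))\<^sup>2
      = (cmod t)\<^sup>2 * (real (a choose k) * (cmod (z k))\<^sup>2) + (cmod t')\<^sup>2 * (real (a choose k) * (cmod (z' k))\<^sup>2)
          - 2 * Re (t * cnj t' * (of_nat (a choose k) * (z k * cnj (z' k))))"
      unfolding cmod_diff_power2 norm_mult power_mult_distrib by (simp add: algebra_simps)
  qed
  also have "\<dots> = (cmod t)\<^sup>2 * (\<Sum>k\<le>a. real (a choose k) * (cmod (z k))\<^sup>2)
      + (cmod t')\<^sup>2 * (\<Sum>k\<le>a. real (a choose k) * (cmod (z' k))\<^sup>2)
      - 2 * Re (t * cnj t' * (\<Sum>k\<le>a. of_nat (a choose k) * (z k * cnj (z' k))))"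
    by (simp only: sum.distrib sum_subtractf sum_distrib_left Re_sum)
  also have "\<dots> = (cmod t)\<^sup>2 + (cmod t')\<^sup>2 - 2 * (c ^ a * Re (t * cnj t'))"
    unfolding mixed using unit[OF u(1)] unit[OF u(2)]
    by (simp only: z_def z'_def mult.commute[of "t * cnj t'"] Re_scale)
  also have "\<dots> = c ^ a * (cmod (t - t'))\<^sup>2 + (1 - c ^ a) * ((cmod t)\<^sup>2 + (cmod t')\<^sup>2)"
    unfolding cmod_diff_power2 by (simp add: algebra_simps)
  finally show ?thesis by (simp add: z_def z'_def)
qed

text \<open>The squared distance between the points \<open>u\<^sup>a \<otimes> v\<close> and \<open>u'\<^sup>a \<otimes> v'\<close> of the cone over the scroll. The
  binomial weights of \<open>weighted_distance\<close> lie between \<open>1\<close> and \<open>2\<^sup>a\<close>.\<close>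

definition cone_dist2 :: "nat \<Rightarrow> complex \<times> complex \<Rightarrow> complex \<times> complex \<Rightarrow> complex \<times> complex \<Rightarrow> complex \<times> complex \<Rightarrow> real" where
  "cone_dist2 a u v u' v' =
     (\<Sum>k\<le>a. (cmod (fst u ^ (a - k) * snd u ^ k * fst v - fst u' ^ (a - k) * snd u' ^ k * fst v'))\<^sup>2) +
     (\<Sum>k\<le>a. (cmod (fst u ^ (a - k) * snd u ^ k * snd v - fst u' ^ (a - k) * snd u' ^ k * snd v'))\<^sup>2)"

lemma cone_dist2_bounds:
  fixes u u' v v' :: "complex \<times> complex" and c w :: real and a :: nat
  assumes u: "norm u = 1" "norm u' = 1" and c: "herm u u' = complex_of_real c"
  defines "w \<equiv> c ^ a * (norm (v - v'))\<^sup>2 + (1 - c ^ a) * ((norm v)\<^sup>2 + (norm v')\<^sup>2)"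
  shows "cone_dist2 a u v u' v' \<le> w" "w \<le> 2 ^ a * cone_dist2 a u v u' v'"
proof -
  define f where "f t t' k = (cmod (fst u ^ (a - k) * snd u ^ k * t - fst u' ^ (a - k) * snd u' ^ k * t'))\<^sup>2" for t t' k
  have w: "w = (\<Sum>k\<le>a. real (a choose k) * f (fst v) (fst v') k) + (\<Sum>k\<le>a. real (a choose k) * f (snd v) (snd v') k)"
    unfolding f_def weighted_distance[OF u c] w_def norm_pair_power2 fst_diff snd_diff by (simp add: algebra_simps)
  have d: "cone_dist2 a u v u' v' = (\<Sum>k\<le>a. f (fst v) (fst v') k) + (\<Sum>k\<le>a. f (snd v) (snd v') k)"
    by (simp add: cone_dist2_def f_def)
  have f_nonneg: "0 \<le> f t t' k" for t t' k by (simp add: f_def)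
  have "(\<Sum>k\<le>a. f t t' k) \<le> (\<Sum>k\<le>a. real (a choose k) * f t t' k)" for t t'
  proof (intro sum_mono)
    fix k assume "k \<in> {..a}"
    then have "0 < a choose k" by simp
    then have "1 \<le> real (a choose k)" by linarith
    then show "f t t' k \<le> real (a choose k) * f t t' k" using f_nonneg[of t t' k] by (simp add: mult_le_cancel_right1)
  qed
  then show "cone_dist2 a u v u' v' \<le> w" unfolding w d by (intro add_mono)
  have "(\<Sum>k\<le>a. real (a choose k) * f t t' k) \<le> 2 ^ a * (\<Sum>k\<le>a. f t t' k)" for t t'
    unfolding sum_distrib_left
  proof (intro sum_mono mult_right_mono f_nonneg)
    fix k
    have "a choose k \<le> 2 ^ a" by (rule binomial_le_pow2)
    then have "real (a choose k) \<le> real (2 ^ a)" by (simp only: of_nat_le_iff)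
    then show "real (a choose k) \<le> 2 ^ a" by simp
  qed
  then show "w \<le> 2 ^ a * cone_dist2 a u v u' v'" unfolding w d distrib_left by (intro add_mono)
qed

lemma norm_add_power2_le:
  fixes x y :: "'a::real_normed_vector"
  shows "(norm (x + y))\<^sup>2 \<le> 2 * (norm x)\<^sup>2 + 2 * (norm y)\<^sup>2"
proof -
  have "(norm (x + y))\<^sup>2 \<le> (norm x + norm y)\<^sup>2" by (intro power_mono norm_triangle_ineq norm_ge_zero)
  also have "\<dots> \<le> 2 * (norm x)\<^sup>2 + 2 * (norm y)\<^sup>2"
    using sum_squares_bound[of "norm x" "norm y"] by (simp add: power2_sum)
  finally show ?thesis .
qed

text \<open>An expression that does not depend on \<open>a\<close> and is comparable with the squared distance of the cone. It
  depends on the unit vectors \<open>u\<close> and \<open>u'\<close> only through the points of the projective line.\<close>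

definition model_dist2 :: "complex \<times> complex \<Rightarrow> complex \<times> complex \<Rightarrow> complex \<times> complex \<Rightarrow> complex \<times> complex \<Rightarrow> real" where
  "model_dist2 u q u' q' = (norm (q - q'))\<^sup>2 + (1 - cmod (herm u u')) * ((norm q)\<^sup>2 + (norm q')\<^sup>2)"

text \<open>The comparison when the Hermitian product of \<open>u\<close> and \<open>u'\<close> is real and nonnegative. Then
  \<open>\<bar>u - u'\<bar>\<^sup>2 = 2 (1 - c)\<close>, and the Lipschitz constant of the frame compares \<open>v - v'\<close> with \<open>q - q'\<close>.\<close>

lemma cone_dist2_model_aligned:
  fixes u u' q q' :: "complex \<times> complex" and c D S E :: real and a :: nat
  assumes a: "a \<ge> 1" and u: "norm u = 1" "norm u' = 1" and c: "herm u u' = complex_of_real c" "0 \<le> c" "c \<le> 1"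
  defines "D \<equiv> (norm (q - q'))\<^sup>2 + (1 - c) * ((norm q)\<^sup>2 + (norm q')\<^sup>2)"
    and "S \<equiv> cone_dist2 a u (qmul (frame a u) q) u' (qmul (frame a u') q')"
    and "E \<equiv> 2 * (4 * real a * 2 ^ a)\<^sup>2"
  shows "S \<le> (2 + 2 * E + a) * D" "D \<le> (2 ^ a * (5 + 2 * E)) * S"
proof -
  define v where "v = qmul (frame a u) q"
  define v' where "v' = qmul (frame a u') q'"
  define d where "d = qmul (frame a u - frame a u') q'"
  define s where "s = (norm q)\<^sup>2 + (norm q')\<^sup>2"
  define w where "w = c ^ a * (norm (v - v'))\<^sup>2 + (1 - c ^ a) * ((norm v)\<^sup>2 + (norm v')\<^sup>2)"
  have nv: "norm v = norm q" "norm v' = norm q'"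
    using u by (simp_all add: v_def v'_def norm_qmul norm_frame)
  have w: "w = c ^ a * (norm (v - v'))\<^sup>2 + (1 - c ^ a) * s" by (simp add: w_def nv s_def)
  have S: "S \<le> w" "w \<le> 2 ^ a * S"
    unfolding S_def w_def v_def v'_def using cone_dist2_bounds[OF u c(1)] by simp_all
  have D: "D = (norm (q - q'))\<^sup>2 + (1 - c) * s" by (simp add: D_def s_def)
  have s: "0 \<le> s" "(norm q')\<^sup>2 \<le> s" by (simp_all add: s_def)
  have E: "0 \<le> E" by (simp add: E_def)
  have c1: "0 \<le> (1 - c) * s" using c(3) s by simp
  have ca: "0 \<le> c ^ a" "c ^ a \<le> c" "c ^ a \<le> 1"
    using c(2,3) a power_decreasing[of 1 a c] by (simp_all add: power_le_one)
  have bernoulli: "1 - c ^ a \<le> a * (1 - c)"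
    using Bernoulli_inequality[of "c - 1" a] c(2) by (simp add: algebra_simps)
  have "(norm d)\<^sup>2 \<le> E * ((1 - c) * s)"
  proof -
    have "norm d \<le> 4 * real a * 2 ^ a * norm (u - u') * norm q'"
      unfolding d_def norm_qmul using frame_lipschitz[OF u] by (intro mult_right_mono) simp_all
    then have "(norm d)\<^sup>2 \<le> (4 * real a * 2 ^ a * norm (u - u') * norm q')\<^sup>2" by (intro power_mono) simp_all
    also have "\<dots> = E * ((1 - c) * (norm q')\<^sup>2)"
      unfolding power_mult_distrib[of _ "norm q'"] power_mult_distrib[of _ "norm (u - u')"]
        norm_diff_herm[OF u c(1)] E_def by simp
    also have "\<dots> \<le> E * ((1 - c) * s)" using c(3) s E by (intro mult_left_mono) simp_all
    finally show ?thesis .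
  qed
  moreover have vv: "v - v' = qmul (frame a u) (q - q') + d"
    by (simp add: v_def v'_def d_def qmul_diff_left qmul_diff_right)
  have nq: "norm (qmul (frame a u) (q - q')) = norm (q - q')" using u by (simp add: norm_qmul norm_frame)
  have "(norm (v - v'))\<^sup>2 \<le> 2 * (norm (q - q'))\<^sup>2 + 2 * (norm d)\<^sup>2"
    unfolding vv nq[symmetric] by (rule norm_add_power2_le)
  moreover have "(norm (q - q'))\<^sup>2 \<le> 2 * (norm (v - v'))\<^sup>2 + 2 * (norm d)\<^sup>2"
  proof -
    have "qmul (frame a u) (q - q') = (v - v') + (- d)" by (simp add: vv)
    then show ?thesis unfolding nq[symmetric] using norm_add_power2_le[of "v - v'" "- d"] by simp
  qed
  ultimately have 1: "(norm (v - v'))\<^sup>2 \<le> 2 * (norm (q - q'))\<^sup>2 + 2 * E * ((1 - c) * s)"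
    and 2: "(norm (q - q'))\<^sup>2 \<le> 2 * (norm (v - v'))\<^sup>2 + 2 * E * ((1 - c) * s)" by simp_all
  have "w \<le> (norm (v - v'))\<^sup>2 + a * ((1 - c) * s)"
    unfolding w using ca bernoulli s
    by (intro add_mono) (simp_all add: mult_left_le_one_le mult_right_mono flip: mult.assoc)
  also have "\<dots> \<le> 2 * (norm (q - q'))\<^sup>2 + (2 * E + a) * ((1 - c) * s)"
    using 1 by (simp add: distrib_right)
  also have "\<dots> \<le> (2 + 2 * E + a) * D"
  proof -
    have "(2 + 2 * E + a) * D - (2 * (norm (q - q'))\<^sup>2 + (2 * E + a) * ((1 - c) * s))
        = (2 * E + a) * (norm (q - q'))\<^sup>2 + 2 * ((1 - c) * s)"
      unfolding D by (simp add: algebra_simps)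
    also have "\<dots> \<ge> 0" using E c(3) s by (intro add_nonneg_nonneg mult_nonneg_nonneg) simp_all
    finally show ?thesis by simp
  qed
  finally show "S \<le> (2 + 2 * E + a) * D" using S(1) by simp
  have "(norm (v - v'))\<^sup>2 \<le> 2 * s"
    using norm_add_power2_le[of v "- v'"] nv by (simp add: s_def)
  then have "(1 - c ^ a) * (norm (v - v'))\<^sup>2 \<le> (1 - c ^ a) * (2 * s)" using ca by (intro mult_left_mono) simp_all
  moreover have "0 \<le> c ^ a * (norm (v - v'))\<^sup>2" using ca by simp
  ultimately have 3: "(norm (v - v'))\<^sup>2 \<le> 2 * w" unfolding w by (simp add: algebra_simps)
  have "(1 - c) * s \<le> (1 - c ^ a) * s" using ca s by (intro mult_right_mono) simp_all
  then have 4: "(1 - c) * s \<le> w" unfolding w using ca by (simp add: add_increasing)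
  have "2 * E * ((1 - c) * s) \<le> 2 * E * w" using 4 E by (intro mult_left_mono) simp_all
  then have "D \<le> (5 + 2 * E) * w" unfolding D using 2 3 4 by (simp add: algebra_simps)
  also have "\<dots> \<le> (5 + 2 * E) * (2 ^ a * S)" using S(2) E by (intro mult_left_mono) simp_all
  finally show "D \<le> (2 ^ a * (5 + 2 * E)) * S" by (simp add: mult_ac)
qed

text \<open>Multiplication of \<open>u'\<close> by a phase does not change the point with the coordinates \<open>(u', q')\<close>.\<close>

lemma cone_dist2_rotate:
  assumes "cmod \<tau> = 1"
  shows "cone_dist2 a u (qmul (frame a u) q) (\<tau> * fst u', \<tau> * snd u') (qmul (frame a (\<tau> * fst u', \<tau> * snd u')) q')
    = cone_dist2 a u (qmul (frame a u) q) u' (qmul (frame a u') q')"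
proof -
  have \<tau>: "\<tau> * cnj \<tau> = 1"
    using assms complex_norm_square[of \<tau>] by simp
  have key: "(\<tau> * s) ^ (a - k) * (\<tau> * t) ^ k * (cnj \<tau> ^ a * z) = s ^ (a - k) * t ^ k * z" if "k \<le> a" for k s t z
  proof -
    have key: "(\<tau> * s) ^ (a - k) * (\<tau> * t) ^ k * (cnj \<tau> ^ a * z)
        = (\<tau> ^ ((a - k) + k) * cnj \<tau> ^ a) * (s ^ (a - k) * t ^ k * z)"
      by (simp only: power_mult_distrib power_add mult_ac)
    also have "\<tau> ^ ((a - k) + k) * cnj \<tau> ^ a = 1"
      using that \<tau> by (simp flip: power_mult_distrib)
    finally show ?thesis by simp
  qed
  show ?thesis
    unfolding cone_dist2_def frame_equivariant[OF assms] qmul_scale fst_conv snd_conv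
    by (intro arg_cong2[where f = "(+)"] sum.cong refl) (simp_all only: key atMost_iff)
qed

lemma cone_dist2_model:
  assumes a: "a \<ge> 1"
  obtains K where "K > 0" "\<And>u u' q q'. norm u = 1 \<Longrightarrow> norm u' = 1 \<Longrightarrow>
      cone_dist2 a u (qmul (frame a u) q) u' (qmul (frame a u') q') \<le> K * model_dist2 u q u' q' \<and>
      model_dist2 u q u' q' \<le> K * cone_dist2 a u (qmul (frame a u) q) u' (qmul (frame a u') q')"
proof -
  define E where "E = 2 * (4 * real a * 2 ^ a)\<^sup>2"
  define K where "K = max (2 + 2 * E + a) (2 ^ a * (5 + 2 * E))"
  have "0 \<le> E" by (simp add: E_def)
  then have K: "K > 0" by (simp add: K_def less_max_iff_disj)
  show ?thesis
  proof (rule that[OF K])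
    fix u u' q q' :: "complex \<times> complex" assume u: "norm u = 1" "norm u' = 1"
    define S where "S = cone_dist2 a u (qmul (frame a u) q) u' (qmul (frame a u') q')"
    define h where "h = herm u u'"
    \<comment> \<open>The phase that makes the Hermitian product real and nonnegative.\<close>
    define \<tau> where "\<tau> = (if h = 0 then 1 else h / cmod h)"
    define u'' where "u'' = (\<tau> * fst u', \<tau> * snd u')"
    have \<tau>: "cmod \<tau> = 1" by (simp add: \<tau>_def norm_divide)
    have S'': "S = cone_dist2 a u (qmul (frame a u) q) u'' (qmul (frame a u'') q')"
      unfolding S_def u''_def by (rule cone_dist2_rotate[OF \<tau>, symmetric])
    have "(norm u'')\<^sup>2 = (norm u')\<^sup>2"
      unfolding norm_pair_power2 u''_def fst_conv snd_conv norm_mult \<tau> by simp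
    with u have nu'': "norm u'' = 1" using power2_eq_iff_nonneg[of "norm u''" 1] by simp
    have "herm u u'' = cnj \<tau> * h"
      by (simp add: herm_def u''_def h_def algebra_simps)
    also have "\<dots> = complex_of_real (cmod h)"
    proof (cases "h = 0")
      case False
      have "cnj h * h = complex_of_real ((cmod h)\<^sup>2)" by (simp only: complex_norm_square mult.commute)
      with False show ?thesis by (simp add: \<tau>_def power2_eq_square)
    qed simp
    finally have herm: "herm u u'' = complex_of_real (cmod h)" .
    have "0 \<le> 2 - 2 * cmod h" using norm_diff_herm[OF u(1) nu'' herm] by (metis zero_le_power2)
    then have h1: "cmod h \<le> 1" by simp
    have D: "model_dist2 u q u' q' = (norm (q - q'))\<^sup>2 + (1 - cmod h) * ((norm q)\<^sup>2 + (norm q')\<^sup>2)"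
      by (simp add: model_dist2_def h_def)
    have D0: "0 \<le> model_dist2 u q u' q'" unfolding D using h1 by simp
    have S0: "0 \<le> S" unfolding S_def cone_dist2_def by (intro add_nonneg_nonneg sum_nonneg) simp_all
    have "S \<le> (2 + 2 * E + a) * model_dist2 u q u' q'" "model_dist2 u q u' q' \<le> (2 ^ a * (5 + 2 * E)) * S"
      unfolding D S'' E_def using cone_dist2_model_aligned[OF a u(1) nu'' herm _ h1] by simp_all
    moreover have "(2 + 2 * E + a) * model_dist2 u q u' q' \<le> K * model_dist2 u q u' q'" "(2 ^ a * (5 + 2 * E)) * S \<le> K * S"
      using D0 S0 by (auto intro!: mult_right_mono simp: K_def)
    ultimately show "cone_dist2 a u (qmul (frame a u) q) u' (qmul (frame a u') q') \<le> K * model_dist2 u q u' q' \<and>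
      model_dist2 u q u' q' \<le> K * cone_dist2 a u (qmul (frame a u) q) u' (qmul (frame a u') q')"
      unfolding S_def[symmetric] by simp
  qed
qed

section \<open>Bi-Lipschitz equivalence of the cones\<close>

text \<open>Model coordinates of a point are \<open>x 0, x 1\<close> for the unit vector \<open>u\<close>, \<open>x 2, x 3\<close> for the quaternion
  \<open>q\<close>, and \<open>x (4 + l)\<close> for the affine factor. The vector \<open>v\<close> is the product of the frame at \<open>u\<close> and \<open>q\<close>.\<close>

definition fibre :: "nat \<Rightarrow> (nat \<Rightarrow> complex) \<Rightarrow> complex \<times> complex" where
  "fibre a x = qmul (frame a (x 0, x 1)) (x 2, x 3)"

text \<open>The point of the cone with the model coordinates \<open>x\<close>.\<close>

definition chart :: "nat \<Rightarrow> nat \<Rightarrow> nat \<Rightarrow> (nat \<Rightarrow> complex) \<Rightarrow> nat \<Rightarrow> complex" where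
  "chart a r off x = scroll_param a r off (x(2 := fst (fibre a x), 3 := snd (fibre a x)))"

text \<open>The admissible model coordinates.\<close>

definition unit_base :: "(nat \<Rightarrow> complex) \<Rightarrow> bool" where
  "unit_base x \<longleftrightarrow> norm (x 0, x 1) = 1"

text \<open>The extension of \<open>model_dist2\<close> to the affine factor.\<close>

definition model2 :: "nat \<Rightarrow> (nat \<Rightarrow> complex) \<Rightarrow> (nat \<Rightarrow> complex) \<Rightarrow> real" where
  "model2 r x x' = model_dist2 (x 0, x 1) (x 2, x 3) (x' 0, x' 1) (x' 2, x' 3) +
     (\<Sum>l<r. (cmod (x (4 + l) - x' (4 + l)))\<^sup>2)"

lemma chart_in_scroll: "chart a r off x \<in> scroll a r off"
  by (simp add: chart_def scroll_def)

lemma chart_surj: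
  assumes a: "a \<ge> 1" and y: "y \<in> scroll a r off"
  obtains x where "unit_base x" "chart a r off x = y"
proof -
  from y obtain z where z: "y = scroll_param a r off z" by (auto simp: scroll_def)
  define \<rho> where "\<rho> = norm (z 0, z 1)"
  \<comment> \<open>Normalize \<open>u\<close> and compensate in \<open>v\<close>. If \<open>u = 0\<close>, the first coordinates vanish since \<open>a \<ge> 1\<close>.\<close>
  obtain u v :: "complex \<times> complex" where u: "norm u = 1"
    and eq: "\<And>k. k \<le> a \<Longrightarrow> fst u ^ (a - k) * snd u ^ k * fst v = z 0 ^ (a - k) * z 1 ^ k * z 2"
      "\<And>k. k \<le> a \<Longrightarrow> fst u ^ (a - k) * snd u ^ k * snd v = z 0 ^ (a - k) * z 1 ^ k * z 3"
  proof (cases "\<rho> = 0")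
    case True
    then have 0: "z 0 = 0" "z 1 = 0" by (simp_all add: \<rho>_def zero_prod_def)
    have "z 0 ^ (a - k) * z 1 ^ k = 0" if "k \<le> a" for k
      using a that unfolding 0 by (cases "k = 0") (simp_all add: zero_power)
    then show ?thesis by (intro that[of "(1, 0)" "(0, 0)"]) (simp_all add: norm_Pair)
  next
    case False
    let ?u = "(z 0 / complex_of_real \<rho>, z 1 / complex_of_real \<rho>)"
    let ?v = "(complex_of_real \<rho> ^ a * z 2, complex_of_real \<rho> ^ a * z 3)"
    have \<rho>2: "\<rho>\<^sup>2 = (cmod (z 0))\<^sup>2 + (cmod (z 1))\<^sup>2" unfolding \<rho>_def norm_pair_power2 by simp
    have "(norm ?u)\<^sup>2 = ((cmod (z 0))\<^sup>2 + (cmod (z 1))\<^sup>2) / \<rho>\<^sup>2"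
      unfolding norm_pair_power2 fst_conv snd_conv norm_divide power_divide add_divide_distrib by simp
    also have "\<dots> = 1" unfolding \<rho>2[symmetric] using False by simp
    finally have "norm ?u = 1" using power2_eq_iff_nonneg[of "norm ?u" 1] by simp
    moreover have "(z 0 / complex_of_real \<rho>) ^ (a - k) * (z 1 / complex_of_real \<rho>) ^ k * (complex_of_real \<rho> ^ a * t)
        = z 0 ^ (a - k) * z 1 ^ k * t" if "k \<le> a" for k t
    proof -
      have "complex_of_real \<rho> ^ a = complex_of_real \<rho> ^ (a - k) * complex_of_real \<rho> ^ k"
        using that by (simp flip: power_add)
      with False show ?thesis by (simp add: power_divide)
    qed
    ultimately show ?thesis by (intro that[of ?u ?v]) (simp_all only: fst_conv snd_conv)
  qed
  define e where "e = frame a u"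
  define q where "q = qmul (cnj (fst e), - snd e) v"
  have qv: "qmul e q = v"
    unfolding q_def by (rule qmul_inverse) (simp add: e_def norm_frame[OF u])
  define x where "x i = (if i = 0 then fst u else if i = 1 then snd u else if i = 2 then fst q
      else if i = 3 then snd q else z i)" for i :: nat
  have x: "x 0 = fst u" "x 1 = snd u" "x 2 = fst q" "x 3 = snd q" "\<And>l. x (4 + l) = z (4 + l)"
    by (simp_all add: x_def)
  have "chart a r off x = y"
    unfolding chart_def fibre_def x prod.collapse e_def[symmetric] qv
    by (rule scroll_param_eqI)
      (simp_all only: z scroll_param_simps eq[symmetric], simp_all add: x x(2)[unfolded One_nat_def])
  moreover have "unit_base x" using u unfolding unit_base_def x prod.collapse .
  ultimately show ?thesis by (rule that[rotated])
qed

lemma complex_dist_power2: "(complex_dist N y y')\<^sup>2 = (\<Sum>i<N. (cmod (y i - y' i))\<^sup>2)"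
  by (simp add: complex_dist_def L2_set_def sum_nonneg dist_norm)

lemma complex_dist_chart:
  assumes N: "off + 2 * Suc a + r \<le> N"
  shows "(complex_dist N (chart a r off x) (chart a r off x'))\<^sup>2 =
    cone_dist2 a (x 0, x 1) (fibre a x)
      (x' 0, x' 1) (fibre a x') +
    (\<Sum>l<r. (cmod (x (4 + l) - x' (4 + l)))\<^sup>2)"
proof -
  define f where "f i = (cmod (chart a r off x i - chart a r off x' i))\<^sup>2" for i
  define R where "R = N - (off + 2 * Suc a + r)"
  have NR: "N = off + (Suc a + (Suc a + (r + R)))" using N by (simp add: R_def)
  have "(\<Sum>i<N. f i) = (\<Sum>i<off. f i) + ((\<Sum>k<Suc a. f (off + k)) + ((\<Sum>k<Suc a. f (off + (Suc a + k))) +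
      ((\<Sum>l<r. f (off + (Suc a + (Suc a + l)))) + (\<Sum>i<R. f (off + (Suc a + (Suc a + (r + i))))))))"
    unfolding NR sum_lessThan_add ..
  also have "(\<Sum>i<off. f i) = 0"
    by (intro sum.neutral) (simp add: f_def chart_def scroll_param_simps)
  also have "(\<Sum>i<R. f (off + (Suc a + (Suc a + (r + i))))) = 0"
    by (intro sum.neutral) (simp add: f_def chart_def scroll_param_simps)
  also have "(\<Sum>l<r. f (off + (Suc a + (Suc a + l)))) = (\<Sum>l<r. (cmod (x (4 + l) - x' (4 + l)))\<^sup>2)"
  proof (intro sum.cong refl)
    fix l assume "l \<in> {..<r}"
    then have l: "l < r" by simp
    have ix: "off + (Suc a + (Suc a + l)) = off + 2 * Suc a + l" by simp
    show "f (off + (Suc a + (Suc a + l))) = (cmod (x (4 + l) - x' (4 + l)))\<^sup>2"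
      unfolding f_def chart_def ix scroll_param_simps(4)[OF l] by simp
  qed
  also have "(\<Sum>k<Suc a. f (off + k)) = (\<Sum>k\<le>a. (cmod (x 0 ^ (a - k) * x 1 ^ k * fst (fibre a x) -
      x' 0 ^ (a - k) * x' 1 ^ k * fst (fibre a x')))\<^sup>2)"
  proof (intro sum.cong)
    fix k assume "k \<in> {..a}"
    then have k: "k \<le> a" by simp
    show "f (off + k) = (cmod (x 0 ^ (a - k) * x 1 ^ k * fst (fibre a x) -
      x' 0 ^ (a - k) * x' 1 ^ k * fst (fibre a x')))\<^sup>2"
      unfolding f_def chart_def scroll_param_simps(2)[OF k] by simp
  qed (simp add: lessThan_Suc_atMost)
  also have "(\<Sum>k<Suc a. f (off + (Suc a + k))) = (\<Sum>k\<le>a. (cmod (x 0 ^ (a - k) * x 1 ^ k * snd (fibre a x) -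
      x' 0 ^ (a - k) * x' 1 ^ k * snd (fibre a x')))\<^sup>2)"
  proof (intro sum.cong)
    fix k assume "k \<in> {..a}"
    then have k: "k \<le> a" by simp
    have ix: "off + (Suc a + k) = off + Suc a + k" by simp
    show "f (off + (Suc a + k)) = (cmod (x 0 ^ (a - k) * x 1 ^ k * snd (fibre a x) -
      x' 0 ^ (a - k) * x' 1 ^ k * snd (fibre a x')))\<^sup>2"
      unfolding f_def chart_def ix scroll_param_simps(3)[OF k] by simp
  qed (simp add: lessThan_Suc_atMost)
  finally show ?thesis unfolding complex_dist_power2 f_def cone_dist2_def fst_conv snd_conv by linarith
qed

lemma chart_bounds:
  assumes a: "a \<ge> 1" and N: "off + 2 * Suc a + r \<le> N"
  obtains K where "K > 0" "\<And>x x'. unit_base x \<Longrightarrow> unit_base x' \<Longrightarrow>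
      (complex_dist N (chart a r off x) (chart a r off x'))\<^sup>2 \<le> K * model2 r x x' \<and>
      model2 r x x' \<le> K * (complex_dist N (chart a r off x) (chart a r off x'))\<^sup>2"
proof -
  obtain K where K: "K > 0" "\<And>u u' q q'. norm u = 1 \<Longrightarrow> norm u' = 1 \<Longrightarrow>
      cone_dist2 a u (qmul (frame a u) q) u' (qmul (frame a u') q') \<le> K * model_dist2 u q u' q' \<and>
      model_dist2 u q u' q' \<le> K * cone_dist2 a u (qmul (frame a u) q) u' (qmul (frame a u') q')"
    using cone_dist2_model[OF a] by metis
  show ?thesis
  proof (rule that[of "K + 1"])
    show "K + 1 > 0" using K(1) by simp
    fix x x' assume x: "unit_base x" "unit_base x'"
    define S where "S = cone_dist2 a (x 0, x 1) (fibre a x) (x' 0, x' 1) (fibre a x')"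
    define D where "D = model_dist2 (x 0, x 1) (x 2, x 3) (x' 0, x' 1) (x' 2, x' 3)"
    define w where "w = (\<Sum>l<r. (cmod (x (4 + l) - x' (4 + l)))\<^sup>2)"
    have SD: "S \<le> K * D" "D \<le> K * S" using K(2) x by (simp_all add: S_def D_def fibre_def unit_base_def)
    have S0: "0 \<le> S" unfolding S_def cone_dist2_def by (intro add_nonneg_nonneg sum_nonneg) simp_all
    then have "0 \<le> K * D" using SD(1) by simp
    then have D0: "0 \<le> D" using K(1) by (simp add: zero_le_mult_iff)
    have w0: "0 \<le> w" unfolding w_def by (intro sum_nonneg) simp
    then have Kw: "0 \<le> K * w" using K(1) by simp
    show "(complex_dist N (chart a r off x) (chart a r off x'))\<^sup>2 \<le> (K + 1) * model2 r x x' \<and>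
      model2 r x x' \<le> (K + 1) * (complex_dist N (chart a r off x) (chart a r off x'))\<^sup>2"
      unfolding complex_dist_chart[OF N] model2_def S_def[symmetric] D_def[symmetric] w_def[symmetric]
      using SD S0 D0 Kw by (simp add: algebra_simps)
  qed
qed

text \<open>The expression \<open>model2\<close> is comparable with the squared distances of both cones.\<close>

lemma chart_comparison:
  assumes a: "a \<ge> 1" and N: "off + 2 * Suc a + r \<le> N"
    and b: "b \<ge> 1" and N': "off' + 2 * Suc b + r \<le> N'"
  obtains C where "\<And>x x'. unit_base x \<Longrightarrow> unit_base x' \<Longrightarrow>
    complex_dist N' (chart b r off' x) (chart b r off' x') \<le> C * complex_dist N (chart a r off x) (chart a r off x')"
proof -
  obtain K where K: "K > 0" "\<And>x x'. unit_base x \<Longrightarrow> unit_base x' \<Longrightarrow>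
      (complex_dist N (chart a r off x) (chart a r off x'))\<^sup>2 \<le> K * model2 r x x' \<and>
      model2 r x x' \<le> K * (complex_dist N (chart a r off x) (chart a r off x'))\<^sup>2"
    using chart_bounds[OF a N] by blast
  obtain L where L: "L > 0" "\<And>x x'. unit_base x \<Longrightarrow> unit_base x' \<Longrightarrow>
      (complex_dist N' (chart b r off' x) (chart b r off' x'))\<^sup>2 \<le> L * model2 r x x' \<and>
      model2 r x x' \<le> L * (complex_dist N' (chart b r off' x) (chart b r off' x'))\<^sup>2"
    using chart_bounds[OF b N'] by blast
  show ?thesis
  proof (rule that[of "sqrt (L * K)"], rule power2_le_imp_le)
    fix x x' assume x: "unit_base x" "unit_base x'"
    have "(complex_dist N' (chart b r off' x) (chart b r off' x'))\<^sup>2 \<le> L * model2 r x x'" using L(2) x by simp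
    also have "\<dots> \<le> L * (K * (complex_dist N (chart a r off x) (chart a r off x'))\<^sup>2)"
      using K(2)[OF x] L(1) by (intro mult_left_mono) simp_all
    also have "\<dots> = (sqrt (L * K) * complex_dist N (chart a r off x) (chart a r off x'))\<^sup>2"
      using K(1) L(1) by (simp add: power_mult_distrib)
    finally show "(complex_dist N' (chart b r off' x) (chart b r off' x'))\<^sup>2
        \<le> (sqrt (L * K) * complex_dist N (chart a r off x) (chart a r off x'))\<^sup>2" .
    show "0 \<le> sqrt (L * K) * complex_dist N (chart a r off x) (chart a r off x')"
      using K(1) L(1) by (simp add: complex_dist_def)
  qed
qed

lemma scroll_subset_complex_space:
  "off + 2 * Suc a + r \<le> N \<Longrightarrow> scroll a r off \<subseteq> complex_space N"
  using scroll_param_space by (auto simp: scroll_def)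

text \<open>The map from the cone over \<open>S(a, a)\<close> to that over \<open>S(b, b)\<close> that preserves the model coordinates. These are not
  unique, but the result does not depend on their choice.\<close>

definition transition :: "nat \<Rightarrow> nat \<Rightarrow> nat \<Rightarrow> nat \<Rightarrow> nat \<Rightarrow> (nat \<Rightarrow> complex) \<Rightarrow> nat \<Rightarrow> complex" where
  "transition r a off b off' y = chart b r off' (SOME x. unit_base x \<and> chart a r off x = y)"

lemma transition_in_scroll: "transition r a off b off' y \<in> scroll b r off'"
  by (simp add: transition_def chart_in_scroll)

lemma transition_chart:
  assumes a: "a \<ge> 1" and b: "b \<ge> 1" and x: "unit_base x"
  shows "transition r a off b off' (chart a r off x) = chart b r off' x"
proof -
  define x' where "x' = (SOME x'. unit_base x' \<and> chart a r off x' = chart a r off x)"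
  define N where "N = off + 2 * Suc a + r"
  define N' where "N' = off' + 2 * Suc b + r"
  have x': "unit_base x'" "chart a r off x' = chart a r off x"
    unfolding x'_def using someI[of "\<lambda>x'. unit_base x' \<and> chart a r off x' = chart a r off x" x] x by simp_all
  obtain C where C: "complex_dist N' (chart b r off' x') (chart b r off' x) \<le> C * complex_dist N (chart a r off x') (chart a r off x)"
    using chart_comparison[of a off r N b off' N'] a b x x' by (metis N_def N'_def order_refl)
  have space: "chart a r off x \<in> complex_space N" "\<And>z. chart b r off' z \<in> complex_space N'"
    by (simp_all add: chart_def scroll_param_space N_def N'_def)
  have "complex_dist N' (chart b r off' x') (chart b r off' x) \<le> 0"
    using C Metric_space.mdist_zero[OF Metric_space_complex space(1)] by (simp add: x'(2))
  moreover have "0 \<le> complex_dist N' (chart b r off' x') (chart b r off' x)" by (simp add: complex_dist_def)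
  ultimately have "chart b r off' x' = chart b r off' x"
    using Metric_space.zero[OF Metric_space_complex space(2) space(2)] by force
  then show ?thesis by (simp add: transition_def x'_def)
qed

lemma transition_inverse:
  assumes "a \<ge> 1" "b \<ge> 1" "y \<in> scroll a r off"
  shows "transition r b off' a off (transition r a off b off' y) = y"
proof -
  obtain x where "unit_base x" "y = chart a r off x" using chart_surj[OF assms(1,3)] by blast
  with assms show ?thesis by (simp add: transition_chart)
qed

lemma transition_origin:
  assumes "a \<ge> 1" "b \<ge> 1"
  shows "transition r a off b off' origin = origin"
proof -
  define x :: "nat \<Rightarrow> complex" where "x i = (if i = 0 then 1 else 0)" for i
  have x: "unit_base x" by (simp add: unit_base_def x_def norm_Pair)
  have "chart c r s x = origin" for c s
  proof -
    have "fibre c x = (0, 0)" by (simp add: fibre_def qmul_def x_def)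
    then show ?thesis
      unfolding chart_def origin_def by (intro scroll_param_eqI) (simp_all add: x_def)
  qed
  with transition_chart[OF assms x] show ?thesis by metis
qed

lemma Lipschitz_continuous_map_transition:
  assumes a: "a \<ge> 1" and N: "off + 2 * Suc a + r \<le> N"
    and b: "b \<ge> 1" and N': "off' + 2 * Suc b + r \<le> N'"
  shows "Lipschitz_continuous_map (submetric (complex_metric N) (scroll a r off))
    (submetric (complex_metric N') (scroll b r off')) (transition r a off b off')"
proof -
  obtain C where C: "\<And>x x'. unit_base x \<Longrightarrow> unit_base x' \<Longrightarrow>
    complex_dist N' (chart b r off' x) (chart b r off' x') \<le> C * complex_dist N (chart a r off x) (chart a r off x')"
    using chart_comparison[OF assms] by blast
  have "complex_dist N' (transition r a off b off' y) (transition r a off b off' y') \<le> C * complex_dist N y y'"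
    if y: "y \<in> scroll a r off" "y' \<in> scroll a r off" for y y'
  proof -
    obtain x x' where "unit_base x" "y = chart a r off x" "unit_base x'" "y' = chart a r off x'"
      using chart_surj[OF a] y by metis
    then show ?thesis by (simp add: transition_chart[OF a b] C)
  qed
  then show ?thesis
    unfolding Lipschitz_continuous_map_def
    using transition_in_scroll scroll_subset_complex_space[OF N'] by (intro conjI exI[of _ C]) auto
qed

lemma openin_complex_space: "openin (mtopology_of (complex_metric N)) (complex_space N)"
  using openin_topspace[of "mtopology_of (complex_metric N)"] by (simp add: topspace_mtopology_of)

lemma origin_in_complex_space: "origin \<in> complex_space N"
  by (simp add: origin_def complex_space_def)

theorem bi_lipschitz_equivalent_scroll:
  assumes a: "a \<ge> 1" and N: "off + 2 * Suc a + r \<le> N"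
    and b: "b \<ge> 1" and N': "off' + 2 * Suc b + r \<le> N'"
  shows "bi_lipschitz_equivalent N (scroll a r off) origin N' (scroll b r off') origin"
proof -
  have "scroll a r off \<inter> complex_space N = scroll a r off" "scroll b r off' \<inter> complex_space N' = scroll b r off'"
    using scroll_subset_complex_space[OF N] scroll_subset_complex_space[OF N'] by blast+
  moreover have "bi_lipschitz_homeomorphism (submetric (complex_metric N) (scroll a r off))
      (submetric (complex_metric N') (scroll b r off')) (transition r a off b off')"
    unfolding bi_lipschitz_homeomorphism_def
    using Lipschitz_continuous_map_transition[OF assms] Lipschitz_continuous_map_transition[OF b N' a N]
      transition_inverse[OF a b] transition_inverse[OF b a]
    by (intro exI[of _ "transition r b off' a off"]) auto
  ultimately show ?thesis
    unfolding bi_lipschitz_equivalent_def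
    by (intro exI[of _ "complex_space N"] exI[of _ "complex_space N'"] exI[of _ "transition r a off b off'"])
      (simp add: openin_complex_space origin_in_complex_space transition_origin[OF a b])
qed

section \<open>Extension of Lipschitz maps and ambient equivalence\<close>

text \<open>The McShane extension of a real-valued Lipschitz function.\<close>

lemma (in Metric_space) lipschitz_extension_real:
  fixes f :: "'a \<Rightarrow> real"
  assumes A: "A \<subseteq> M" "A \<noteq> {}" and L: "L \<ge> 0"
    and f: "\<And>x y. x \<in> A \<Longrightarrow> y \<in> A \<Longrightarrow> \<bar>f x - f y\<bar> \<le> L * d x y"
  obtains F where "\<And>x y. x \<in> M \<Longrightarrow> y \<in> M \<Longrightarrow> \<bar>F x - F y\<bar> \<le> L * d x y" "\<And>x. x \<in> A \<Longrightarrow> F x = f x"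
proof -
  define F where "F x = (INF y\<in>A. f y + L * d x y)" for x
  obtain y0 where y0: "y0 \<in> A" using A(2) by blast
  have bdd: "bdd_below ((\<lambda>y. f y + L * d x y) ` A)" if x: "x \<in> M" for x
  proof (rule bdd_belowI2)
    fix y assume y: "y \<in> A"
    have "d y0 y \<le> d x y0 + d x y" using triangle[of y0 x y] x y y0 A(1) commute[of y0 x] by auto
    then have "L * d y0 y \<le> L * (d x y0 + d x y)" using L by (intro mult_left_mono)
    with f[OF y0 y] show "f y0 - L * d x y0 \<le> f y + L * d x y" by (simp add: distrib_left)
  qed
  have le: "F x \<le> F y + L * d x y" if xy: "x \<in> M" "y \<in> M" for x y
  proof -
    have "F x - L * d x y \<le> f z + L * d y z" if z: "z \<in> A" for z
    proof -
      have "F x \<le> f z + L * d x z" unfolding F_def using bdd[OF xy(1)] z by (rule cINF_lower)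
      moreover have "L * d x z \<le> L * (d x y + d y z)"
        using triangle[of x y z] xy z A(1) L by (intro mult_left_mono) auto
      ultimately show ?thesis by (simp add: distrib_left)
    qed
    then have "F x - L * d x y \<le> F y" unfolding F_def[of y] by (intro cINF_greatest[OF A(2)])
    then show ?thesis by simp
  qed
  show ?thesis
  proof (rule that[of F])
    show "\<bar>F x - F y\<bar> \<le> L * d x y" if "x \<in> M" "y \<in> M" for x y
      using le[OF that] le[OF that(2,1)] commute[of x y] by (simp add: abs_le_iff)
    show "F x = f x" if x: "x \<in> A" for x
    proof (rule antisym)
      have xM: "x \<in> M" using x A(1) by blast
      have "F x \<le> f x + L * d x x" unfolding F_def using bdd[OF xM] x by (rule cINF_lower)
      then show "F x \<le> f x" using mdist_zero[OF xM] by simp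
      show "f x \<le> F x" unfolding F_def
      proof (rule cINF_greatest[OF A(2)])
        fix z assume "z \<in> A"
        with f[OF x this] show "f x \<le> f z + L * d x z" by (simp add: abs_le_iff)
      qed
    qed
  qed
qed

lemma complex_dist_component: "i < N \<Longrightarrow> cmod (x i - y i) \<le> complex_dist N x y"
  unfolding complex_dist_def by (subst dist_norm[symmetric], rule member_le_L2_set) simp_all

lemma complex_dist_le_sum: "complex_dist N x y \<le> (\<Sum>i<N. cmod (x i - y i))"
  unfolding complex_dist_def by (simp add: L2_set_le_sum dist_norm)

lemma lipschitz_extension_complex:
  assumes A: "A \<subseteq> complex_space N" "A \<noteq> {}" "f ` A \<subseteq> complex_space N" and L: "L \<ge> 0"
    and f: "\<And>x y. x \<in> A \<Longrightarrow> y \<in> A \<Longrightarrow> complex_dist N (f x) (f y) \<le> L * complex_dist N x y"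
  obtains F where "Lipschitz_continuous_map (complex_metric N) (complex_metric N) F" "\<And>x. x \<in> A \<Longrightarrow> F x = f x"
proof -
  interpret Metric_space "complex_space N" "complex_dist N" by (rule Metric_space_complex)
  have comp: "cmod (f x i - f y i) \<le> L * complex_dist N x y" if "i < N" "x \<in> A" "y \<in> A" for i x y
    using complex_dist_component[OF that(1), of "f x" "f y"] f[OF that(2,3)] by linarith
  have "\<exists>G. (\<forall>x\<in>complex_space N. \<forall>y\<in>complex_space N. cmod (G x - G y) \<le> 2 * L * complex_dist N x y) \<and> (\<forall>x\<in>A. G x = f x i)"
    if i: "i < N" for i
  proof -
    have re: "\<bar>Re (f x i) - Re (f y i)\<bar> \<le> L * complex_dist N x y" if "x \<in> A" "y \<in> A" for x y
      using abs_Re_le_cmod[of "f x i - f y i"] comp[OF i that] by simp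
    obtain G where G: "\<And>x y. x \<in> complex_space N \<Longrightarrow> y \<in> complex_space N \<Longrightarrow> \<bar>G x - G y\<bar> \<le> L * complex_dist N x y"
      "\<And>x. x \<in> A \<Longrightarrow> G x = Re (f x i)"
      using lipschitz_extension_real[of A L "\<lambda>x. Re (f x i)", OF A(1,2) L re] by blast
    have im: "\<bar>Im (f x i) - Im (f y i)\<bar> \<le> L * complex_dist N x y" if "x \<in> A" "y \<in> A" for x y
      using abs_Im_le_cmod[of "f x i - f y i"] comp[OF i that] by simp
    obtain H where H: "\<And>x y. x \<in> complex_space N \<Longrightarrow> y \<in> complex_space N \<Longrightarrow> \<bar>H x - H y\<bar> \<le> L * complex_dist N x y"
      "\<And>x. x \<in> A \<Longrightarrow> H x = Im (f x i)"
      using lipschitz_extension_real[of A L "\<lambda>x. Im (f x i)", OF A(1,2) L im] by blast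
    have "cmod (Complex (G x) (H x) - Complex (G y) (H y)) \<le> 2 * L * complex_dist N x y"
      if "x \<in> complex_space N" "y \<in> complex_space N" for x y
      using cmod_le[of "Complex (G x) (H x) - Complex (G y) (H y)"] G(1)[OF that] H(1)[OF that] by simp
    moreover have "Complex (G x) (H x) = f x i" if "x \<in> A" for x using G(2) H(2) that by simp
    ultimately show ?thesis by (intro exI[of _ "\<lambda>x. Complex (G x) (H x)"]) blast
  qed
  then obtain G where G: "\<And>i x y. i < N \<Longrightarrow> x \<in> complex_space N \<Longrightarrow> y \<in> complex_space N \<Longrightarrow>
      cmod (G i x - G i y) \<le> 2 * L * complex_dist N x y" "\<And>i x. i < N \<Longrightarrow> x \<in> A \<Longrightarrow> G i x = f x i"
    by metis
  define F where "F x i = (if i < N then G i x else 0)" for x i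
  show ?thesis
  proof (rule that[of F])
    have "complex_dist N (F x) (F y) \<le> (real N * (2 * L)) * complex_dist N x y"
      if "x \<in> complex_space N" "y \<in> complex_space N" for x y
    proof -
      have "complex_dist N (F x) (F y) \<le> (\<Sum>i<N. cmod (F x i - F y i))" by (rule complex_dist_le_sum)
      also have "\<dots> \<le> (\<Sum>i<N. 2 * L * complex_dist N x y)"
        using G(1) that by (intro sum_mono) (simp add: F_def)
      finally show ?thesis by simp
    qed
    moreover have "F x \<in> complex_space N" for x by (simp add: F_def complex_space_def)
    ultimately show "Lipschitz_continuous_map (complex_metric N) (complex_metric N) F"
      unfolding Lipschitz_continuous_map_def by auto
    show "F x = f x" if "x \<in> A" for x
    proof
      fix i
      have "f x \<in> complex_space N" using A(3) that by blast
      then show "F x i = f x i" using G(2) that by (simp add: F_def complex_space_def)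
    qed
  qed
qed

lemma Lipschitz_continuous_map_add_sub:
  assumes f: "Lipschitz_continuous_map (complex_metric N) (complex_metric N) f"
    and g: "Lipschitz_continuous_map (complex_metric N) (complex_metric N) g"
  shows "Lipschitz_continuous_map (complex_metric N) (complex_metric N) (\<lambda>x i. f x i + g x i)"
    "Lipschitz_continuous_map (complex_metric N) (complex_metric N) (\<lambda>x i. f x i - g x i)"
proof -
  obtain B where B: "\<And>x y. x \<in> complex_space N \<Longrightarrow> y \<in> complex_space N \<Longrightarrow> complex_dist N (f x) (f y) \<le> B * complex_dist N x y"
    using f by (auto simp: Lipschitz_continuous_map_def)
  obtain B' where B': "\<And>x y. x \<in> complex_space N \<Longrightarrow> y \<in> complex_space N \<Longrightarrow> complex_dist N (g x) (g y) \<le> B' * complex_dist N x y"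
    using g by (auto simp: Lipschitz_continuous_map_def)
  have space: "f x \<in> complex_space N" "g x \<in> complex_space N" if "x \<in> complex_space N" for x
    using f g that by (auto simp: Lipschitz_continuous_map_def)
  have tri: "complex_dist N z z' \<le> complex_dist N (f x) (f y) + complex_dist N (g x) (g y)"
    if "\<And>i. cmod (z i - z' i) \<le> cmod (f x i - f y i) + cmod (g x i - g y i)" for x y z z'
  proof -
    have "L2_set (\<lambda>i. cmod (z i - z' i)) {..<N} \<le> L2_set (\<lambda>i. cmod (f x i - f y i) + cmod (g x i - g y i)) {..<N}"
      using that by (intro L2_set_mono) simp_all
    also have "\<dots> \<le> L2_set (\<lambda>i. cmod (f x i - f y i)) {..<N} + L2_set (\<lambda>i. cmod (g x i - g y i)) {..<N}"
      by (rule L2_set_triangle_ineq)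
    finally show ?thesis by (simp add: complex_dist_def dist_norm)
  qed
  have plus: "complex_dist N (\<lambda>i. f x i + g x i) (\<lambda>i. f y i + g y i) \<le> complex_dist N (f x) (f y) + complex_dist N (g x) (g y)" for x y
  proof (rule tri)
    fix i
    have "f x i + g x i - (f y i + g y i) = (f x i - f y i) + (g x i - g y i)" by simp
    then show "cmod (f x i + g x i - (f y i + g y i)) \<le> cmod (f x i - f y i) + cmod (g x i - g y i)"
      by (simp only: norm_triangle_ineq)
  qed
  have minus: "complex_dist N (\<lambda>i. f x i - g x i) (\<lambda>i. f y i - g y i) \<le> complex_dist N (f x) (f y) + complex_dist N (g x) (g y)" for x y
  proof (rule tri)
    fix i
    have "f x i - g x i - (f y i - g y i) = (f x i - f y i) - (g x i - g y i)" by simp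
    then show "cmod (f x i - g x i - (f y i - g y i)) \<le> cmod (f x i - f y i) + cmod (g x i - g y i)"
      by (simp only: norm_triangle_ineq4)
  qed
  have bound: "complex_dist N (f x) (f y) + complex_dist N (g x) (g y) \<le> (B + B') * complex_dist N x y"
    if "x \<in> complex_space N" "y \<in> complex_space N" for x y
    using B[OF that] B'[OF that] by (simp add: distrib_right)
  show "Lipschitz_continuous_map (complex_metric N) (complex_metric N) (\<lambda>x i. f x i + g x i)"
    unfolding Lipschitz_continuous_map_def
    using order_trans[OF plus bound] space by (auto simp: complex_space_def intro!: exI[of _ "B + B'"])
  show "Lipschitz_continuous_map (complex_metric N) (complex_metric N) (\<lambda>x i. f x i - g x i)"
    unfolding Lipschitz_continuous_map_def
    using order_trans[OF minus bound] space by (auto simp: complex_space_def intro!: exI[of _ "B + B'"])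
qed

text \<open>The projection to the coordinates in \<open>S\<close>.\<close>

definition coord_proj :: "nat set \<Rightarrow> (nat \<Rightarrow> complex) \<Rightarrow> nat \<Rightarrow> complex" where
  "coord_proj S x i = (if i \<in> S then x i else 0)"

lemma Lipschitz_continuous_map_coord_proj:
  "Lipschitz_continuous_map (complex_metric N) (complex_metric N) (coord_proj S)"
proof -
  have "complex_dist N (coord_proj S x) (coord_proj S y) \<le> 1 * complex_dist N x y" for x y
    unfolding complex_dist_def mult_1 by (intro L2_set_mono) (simp_all add: coord_proj_def)
  then show ?thesis
    unfolding Lipschitz_continuous_map_def
    by (auto simp: complex_space_def coord_proj_def intro!: exI[of _ 1])
qed

text \<open>Sets \<open>X\<close> and \<open>X'\<close> in complementary coordinate subspaces that are bi-Lipschitz homeomorphic are ambient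
  equivalent: extend the homeomorphism \<open>h\<close> and its inverse \<open>g\<close> to Lipschitz maps \<open>H\<close> and \<open>K\<close> between the two
  subspaces, and compose the shears \<open>(x, y) \<mapsto> (x, y + H x)\<close> and \<open>(x, y) \<mapsto> (x - K y, y)\<close>.\<close>

lemma ambient_bi_lipschitz_equivalent_complementary:
  assumes X: "X \<subseteq> complex_space N" "\<And>x i. x \<in> X \<Longrightarrow> i \<notin> S \<Longrightarrow> x i = 0" "origin \<in> X"
    and X': "X' \<subseteq> complex_space N" "\<And>x i. x \<in> X' \<Longrightarrow> i \<in> S \<Longrightarrow> x i = 0" "origin \<in> X'"
    and h: "Lipschitz_continuous_map (submetric (complex_metric N) X) (submetric (complex_metric N) X') h"
    and g: "Lipschitz_continuous_map (submetric (complex_metric N) X') (submetric (complex_metric N) X) g"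
    and gh: "\<And>x. x \<in> X \<Longrightarrow> g (h x) = x" and hg: "\<And>y. y \<in> X' \<Longrightarrow> h (g y) = y" and h0: "h origin = origin"
  shows "ambient_bi_lipschitz_equivalent N X origin X' origin"
proof -
  let ?m = "complex_metric N"
  have int: "X \<inter> complex_space N = X" "X' \<inter> complex_space N = X'" using X(1) X'(1) by blast+
  have hX: "h x \<in> X'" if "x \<in> X" for x using h that int by (auto simp: Lipschitz_continuous_map_def)
  have gX: "g x \<in> X" if "x \<in> X'" for x using g that int by (auto simp: Lipschitz_continuous_map_def)
  obtain B where B: "B > 0" "\<And>x y. x \<in> X \<Longrightarrow> y \<in> X \<Longrightarrow> complex_dist N (h x) (h y) \<le> B * complex_dist N x y"
    using h int by (auto simp: Lipschitz_continuous_map_pos)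
  obtain H0 where H0: "Lipschitz_continuous_map ?m ?m H0" "\<And>x. x \<in> X \<Longrightarrow> H0 x = h x"
  proof (rule lipschitz_extension_complex[OF X(1) _ _ less_imp_le[OF B(1)] B(2)])
    show "X \<noteq> {}" using X(3) by blast
    show "h ` X \<subseteq> complex_space N" using hX X'(1) by blast
  qed auto
  obtain B' where B': "B' > 0" "\<And>x y. x \<in> X' \<Longrightarrow> y \<in> X' \<Longrightarrow> complex_dist N (g x) (g y) \<le> B' * complex_dist N x y"
    using g int by (auto simp: Lipschitz_continuous_map_pos)
  obtain K0 where K0: "Lipschitz_continuous_map ?m ?m K0" "\<And>x. x \<in> X' \<Longrightarrow> K0 x = g x"
  proof (rule lipschitz_extension_complex[OF X'(1) _ _ less_imp_le[OF B'(1)] B'(2)])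
    show "X' \<noteq> {}" using X'(3) by blast
    show "g ` X' \<subseteq> complex_space N" using gX X(1) by blast
  qed auto
  define H where "H = coord_proj (- S) \<circ> (H0 \<circ> coord_proj S)"
  define K where "K = coord_proj S \<circ> (K0 \<circ> coord_proj (- S))"
  note proj = Lipschitz_continuous_map_coord_proj
  have H: "Lipschitz_continuous_map ?m ?m H" and K: "Lipschitz_continuous_map ?m ?m K"
    unfolding H_def K_def
    by (rule Lipschitz_continuous_map_compose[OF Lipschitz_continuous_map_compose[OF proj H0(1)] proj],
        rule Lipschitz_continuous_map_compose[OF Lipschitz_continuous_map_compose[OF proj K0(1)] proj])
  have H_cong: "H x = H y" if "\<And>i. i \<in> S \<Longrightarrow> x i = y i" for x y
  proof -
    have "coord_proj S x = coord_proj S y" using that by (auto simp: coord_proj_def)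
    then show ?thesis by (simp add: H_def)
  qed
  have K_cong: "K x = K y" if "\<And>i. i \<notin> S \<Longrightarrow> x i = y i" for x y
  proof -
    have "coord_proj (- S) x = coord_proj (- S) y" using that by (auto simp: coord_proj_def)
    then show ?thesis by (simp add: K_def)
  qed
  have H_zero: "H x i = 0" if "i \<in> S" for x i using that by (simp add: H_def coord_proj_def)
  have K_zero: "K x i = 0" if "i \<notin> S" for x i using that by (simp add: K_def coord_proj_def)
  have HX: "H x = h x" if x: "x \<in> X" for x
  proof -
    have "coord_proj S x = x" using X(2)[OF x] by (auto simp: coord_proj_def)
    moreover have "coord_proj (- S) (h x) = h x" using X'(2)[OF hX[OF x]] by (auto simp: coord_proj_def)
    ultimately show ?thesis by (simp add: H_def H0(2)[OF x])
  qed
  have KX: "K x = g x" if x: "x \<in> X'" for x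
  proof -
    have "coord_proj (- S) x = x" using X'(2)[OF x] by (auto simp: coord_proj_def)
    moreover have "coord_proj S (g x) = g x" using X(2)[OF gX[OF x]] by (auto simp: coord_proj_def)
    ultimately show ?thesis by (simp add: K_def K0(2)[OF x])
  qed
  define s where "s x i = x i + H x i" for x i
  define s' where "s' x i = x i - H x i" for x i
  define t where "t x i = x i - K x i" for x i
  define t' where "t' x i = x i + K x i" for x i
  have lip: "Lipschitz_continuous_map ?m ?m s" "Lipschitz_continuous_map ?m ?m s'"
    "Lipschitz_continuous_map ?m ?m t" "Lipschitz_continuous_map ?m ?m t'"
    unfolding s_def[abs_def] s'_def[abs_def] t_def[abs_def] t'_def[abs_def]
    by (rule Lipschitz_continuous_map_add_sub[OF Lipschitz_continuous_map_id H]
        Lipschitz_continuous_map_add_sub[OF Lipschitz_continuous_map_id K])+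
  have "H (s x) = H x" "H (s' x) = H x" "K (t x) = K x" "K (t' x) = K x" for x
    by (intro H_cong K_cong, simp add: s_def s'_def t_def t'_def H_zero K_zero)+
  then have inv: "s' (s x) = x" "s (s' x) = x" "t (t' x) = x" "t' (t x) = x" for x
    by (simp_all add: fun_eq_iff) (simp_all add: s_def[of "s' x" for x] s_def s'_def t_def t'_def)
  have ts: "t (s x) = h x" if x: "x \<in> X" for x
  proof -
    have "K (s x) = K (h x)"
      using X(2)[OF x] by (intro K_cong) (simp add: s_def HX[OF x])
    also have "\<dots> = x" using KX[OF hX[OF x]] gh[OF x] by simp
    finally show ?thesis by (simp add: t_def s_def HX[OF x] fun_eq_iff)
  qed
  have "bi_lipschitz_homeomorphism (submetric ?m (complex_space N)) (submetric ?m (complex_space N)) (t \<circ> s)"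
    unfolding bi_lipschitz_homeomorphism_def
    using Lipschitz_continuous_map_compose[OF lip(1,3)] Lipschitz_continuous_map_compose[OF lip(4,2)] inv
      submetric_mspace[of ?m]
    by (intro exI[of _ "s' \<circ> t'"]) simp
  moreover have "(t \<circ> s) ` (X \<inter> complex_space N) = X' \<inter> complex_space N"
  proof -
    have "(t \<circ> s) ` X = h ` X" using ts by (intro image_cong) simp_all
    also have "h ` X = X'" using hX gX hg by (force simp: image_iff)
    finally show ?thesis by (simp add: int)
  qed
  moreover have "(t \<circ> s) origin = origin" using ts[OF X(3)] h0 by simp
  ultimately show ?thesis
    unfolding ambient_bi_lipschitz_equivalent_def
    by (intro exI[of _ "complex_space N"] exI[of _ "t \<circ> s"])
      (simp add: openin_complex_space origin_in_complex_space)
qed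

theorem ambient_bi_lipschitz_equivalent_scroll:
  assumes a: "a \<ge> 1" and b: "b \<ge> 1" and M: "M = 2 * Suc a + r" and N: "N = M + (2 * Suc b + r)"
  shows "ambient_bi_lipschitz_equivalent N (scroll a r 0) origin (scroll b r M) origin"
proof -
  have le: "0 + 2 * Suc a + r \<le> N" "M + 2 * Suc b + r \<le> N" using M N by simp_all
  show ?thesis
  proof (rule ambient_bi_lipschitz_equivalent_complementary[where S = "{..<M}"
        and h = "transition r a 0 b M" and g = "transition r b M a 0"])
    show "x i = 0" if "x \<in> scroll a r 0" "i \<notin> {..<M}" for x i
      using that M by (auto simp: scroll_def scroll_param_simps)
    show "x i = 0" if "x \<in> scroll b r M" "i \<in> {..<M}" for x i
      using that by (auto simp: scroll_def scroll_param_simps)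
  qed (use a b le in \<open>simp_all add: scroll_subset_complex_space origin_in_scroll
      Lipschitz_continuous_map_transition transition_inverse transition_origin\<close>)
qed

section \<open>Bi-Lipschitz equivalent germs of different multiplicity\<close>

theorem theorem4p3:
  fixes n :: nat
  assumes "n \<ge> 3"
  shows "\<exists>(m :: int \<Rightarrow> nat) (Y :: int \<Rightarrow> (nat \<Rightarrow> complex) set).
    (\<forall>i. algebraic_variety (m i + 1) (Y i) \<and> variety_dim (m i + 1) (Y i) = enat n \<and>
         origin \<in> Y i) \<and>
    (\<forall>i j. i \<noteq> j \<longrightarrow>
         bi_lipschitz_equivalent (m i + 1) (Y i) origin (m j + 1) (Y j) origin \<and>
         point_multiplicity (m i + 1) (Y i) origin \<noteq> point_multiplicity (m j + 1) (Y j) origin) \<and>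
    (\<forall>i j. i \<noteq> j \<longrightarrow> (\<exists>Z Z'.
         algebraic_variety (m i + m j + 2) Z \<and> variety_dim (m i + m j + 2) Z = enat n \<and>
         origin \<in> Z \<and>
         algebraic_variety (m i + m j + 2) Z' \<and> variety_dim (m i + m j + 2) Z' = enat n \<and>
         origin \<in> Z' \<and>
         ambient_bi_lipschitz_equivalent (m i + m j + 2) Z origin Z' origin \<and>
         point_multiplicity (m i + m j + 2) Z origin = point_multiplicity (m i + 1) (Y i) origin \<and>
         point_multiplicity (m i + m j + 2) Z' origin = point_multiplicity (m j + 1) (Y j) origin \<and>
         point_multiplicity (m i + m j + 2) Z origin \<noteq> point_multiplicity (m i + m j + 2) Z' origin))"
proof -
  define r where "r = n - 3"
  have n: "n = r + 3" using assms by (simp add: r_def)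
  \<comment> \<open>Any injective family of positive integers would do.\<close>
  define a where "a i = Suc (int_encode i)" for i
  have a: "a i \<ge> 1" for i by (simp add: a_def)
  have a_inj: "a i \<noteq> a j" if "i \<noteq> j" for i j
    using that inj_int_encode[of UNIV] by (auto simp: a_def inj_on_def)
  define m where "m i = 2 * a i + r + 1" for i
  define Y where "Y i = scroll (a i) r 0" for i
  have fits: "0 + 2 * Suc (a i) + r \<le> m i + 1" for i by (simp add: m_def)
  have fits1: "0 + 2 * Suc (a i) + r \<le> m i + m j + 2" for i j by (simp add: m_def)
  have fits2: "(m i + 1) + 2 * Suc (a j) + r \<le> m i + m j + 2" for i j by (simp add: m_def)
  have ambient: "ambient_bi_lipschitz_equivalent (m i + m j + 2) (Y i) origin (scroll (a j) r (m i + 1)) origin" for i j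
    unfolding Y_def by (rule ambient_bi_lipschitz_equivalent_scroll[OF a a]) (simp_all add: m_def)
  show ?thesis
  proof (intro exI[of _ m] exI[of _ Y] conjI allI impI)
    fix i j :: int
    show "algebraic_variety (m i + 1) (Y i)" "variety_dim (m i + 1) (Y i) = enat n" "origin \<in> Y i"
      unfolding Y_def n
      by (rule algebraic_variety_scroll[OF a fits] variety_dim_scroll[OF a fits] origin_in_scroll)+
    assume ij: "i \<noteq> j"
    show "bi_lipschitz_equivalent (m i + 1) (Y i) origin (m j + 1) (Y j) origin"
      unfolding Y_def by (rule bi_lipschitz_equivalent_scroll[OF a fits a fits])
    show "point_multiplicity (m i + 1) (Y i) origin \<noteq> point_multiplicity (m j + 1) (Y j) origin"
      unfolding Y_def point_multiplicity_scroll[OF a fits] using a_inj[OF ij] by simp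
    show "\<exists>Z Z'.
         algebraic_variety (m i + m j + 2) Z \<and> variety_dim (m i + m j + 2) Z = enat n \<and>
         origin \<in> Z \<and>
         algebraic_variety (m i + m j + 2) Z' \<and> variety_dim (m i + m j + 2) Z' = enat n \<and>
         origin \<in> Z' \<and>
         ambient_bi_lipschitz_equivalent (m i + m j + 2) Z origin Z' origin \<and>
         point_multiplicity (m i + m j + 2) Z origin = point_multiplicity (m i + 1) (Y i) origin \<and>
         point_multiplicity (m i + m j + 2) Z' origin = point_multiplicity (m j + 1) (Y j) origin \<and>
         point_multiplicity (m i + m j + 2) Z origin \<noteq> point_multiplicity (m i + m j + 2) Z' origin"
    proof (rule exI[of _ "Y i"], rule exI[of _ "scroll (a j) r (m i + 1)"], intro conjI)
      show "algebraic_variety (m i + m j + 2) (Y i)" "variety_dim (m i + m j + 2) (Y i) = enat n" "origin \<in> Y i"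
        unfolding Y_def n
        by (rule algebraic_variety_scroll[OF a fits1] variety_dim_scroll[OF a fits1] origin_in_scroll)+
      show "algebraic_variety (m i + m j + 2) (scroll (a j) r (m i + 1))"
        "variety_dim (m i + m j + 2) (scroll (a j) r (m i + 1)) = enat n" "origin \<in> scroll (a j) r (m i + 1)"
        unfolding n
        by (rule algebraic_variety_scroll[OF a fits2] variety_dim_scroll[OF a fits2] origin_in_scroll)+
      show "ambient_bi_lipschitz_equivalent (m i + m j + 2) (Y i) origin (scroll (a j) r (m i + 1)) origin"
        by (rule ambient)
    qed (use a_inj[OF ij] in \<open>simp_all only: Y_def point_multiplicity_scroll[OF a fits] point_multiplicity_scroll[OF a fits1]
        point_multiplicity_scroll[OF a fits2] mult_cancel1\<close>, simp_all)
  qed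
qed

end
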